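(* Let $\mathsf{queryCF}$, $\mathsf{insertCF}$ and $\mathsf{removeCF}$ be the operations of the compatibility-forest data structure for general (not necessarily monotonic) interval sets described in the context. These algorithms solve the dynamic interval scheduling problem (every query$(i)$ returns $\mathsf{true}$ iff $i$ belongs to the greedy optimal set of the current set $I$), insertion and removal of an interval take $O(d\log^2 n)$ amortised time and a query takes $O(\log n)$ amortised time, where $n$ is the size of the set $I$ of intervals and $d$ is the size of a maximal subset of pairwise overlapping intervals (over all sets occurring during the sequence of operations).
   Context: An interval $i$ is a pair $(s(i),f(i))\in\mathbb{R}^2$ with $s(i)<f(i)$. Intervals $i,j$ are compatible if $f(i)<s(j)$ or $f(j)<s(i)$; otherwise they overlap. Intervals have pairwise distinct finishing times, and $\preceq$ is the ordering by finishing time. The greedy optimal set of $I$: $i_1$ is the least interval, and $i_{k+1}$ is the least interval with $i_k\prec i_{k+1}$ compatible with $i_k$. $\mathsf{rc}(i)$ is the least $j\in I$ with $i\prec j$ compatible with $i$. The dynamic interval scheduling problem: process an arbitrary sequence of operations $\mathsf{insert}(i)$, $\mathsf{remove}(i)$, $\mathsf{query}(i)$ on a changing set $I$, with $\mathsf{query}(i)$ returning $\mathsf{true}$ iff $i$ is in the greedy optimal set of the current $I$. If $I_t$ is the set after $t$ operations of a sequence of $k$ operations, $d=\max_{1\le t\le k}\max\{|J|: J\subseteq I_t,\ \text{all pairs in } J \text{ overlap}\}$. The compatibility forest $\mathcal{F}(I)$ has nodes $I$ and edges $i\to\mathsf{rc}(i)$. Its edges are partitioned into solid and dashed edges, each node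 having at most one incoming solid edge, and each maximal solid path is stored in a splay tree ordered by $\preceq$ ($\mathrm{ST}_i$ denotes the splay tree containing $i$). Further components: a balanced search tree $T(I)$ in which every node stores a pointer to the interval of smallest finishing time in its subtree, used to compute $\mathsf{rc}(i)$ in $O(\log n)$ time; and an interval tree (red–black tree over endpoints, each internal node $v$ storing the intervals containing its split point and contained in its range, kept in two search trees sorted by start and by finish) supporting insertion/deletion in $O(\log n)$ and an operation $\mathsf{covers}(i)$ reporting all intervals containing $i$. $\mathsf{expose}(i)$: repeatedly take $j=\max(\mathrm{ST}_i)$, $i'=\mathsf{rc}(j)$; if $i'$ exists, split $\mathrm{ST}_{i'}$ at $i'$ and join $\mathrm{ST}_i$ with the part containing the elements $\ge i'$; stop when $i'$ does not exist. $\mathsf{queryCF}(i)$: let $m$ be the $\preceq$-least interval; return whether $i\in\mathrm{ST}_m$. $\mathsf{removeCF}(i)$: delete $i$ from its splay tree, from $T(I)$ (and the interval tree); expose the $\preceq$-least interval. $\mathsf{insertCF}(i)$: insert $i$ into $T(I)$ and the interval tree; let $r$ be the $\preceq$-next interval after $i$ that does not cover $i$; if $r$ exists, let $j$ be the predecessor of $r$ in $\mathrm{ST}_r$, and if $j$ exists and is compatible with $i$, split $\mathrm{ST}_r$ at $r$; for each $c\in\mathsf{covers}(i)$, let $j$ be the predecessor of $c$ in $\mathrm{ST}_c$, and if $j$ exists and is compatible with $i$, split $\mathrm{ST}_c$ at $c$; finally expose the $\preceq$-least interval. *)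

theory Defs
  imports Complex_Main "HOL-Library.Tree" "HOL-Library.Product_Lexorder"
begin

section \<open>Intervals and the dynamic scheduling problem\<close>

type_synonym interval = "real \<times> real"

abbreviation start :: "interval \<Rightarrow> real" where "start \<equiv> fst"
abbreviation fin :: "interval \<Rightarrow> real" where "fin \<equiv> snd"

definition is_interval :: "interval \<Rightarrow> bool" where
  "is_interval i \<longleftrightarrow> start i < fin i"

definition compatible :: "interval \<Rightarrow> interval \<Rightarrow> bool" where
  "compatible i j \<longleftrightarrow> fin i < start j \<or> fin j < start i"

definition overlap :: "interval \<Rightarrow> interval \<Rightarrow> bool" where
  "overlap i j \<longleftrightarrow> \<not> compatible i j"

definition least_fin :: "interval set \<Rightarrow> interval \<Rightarrow> bool" where
  "least_fin I i \<longleftrightarrow> i \<in> I \<and> (\<forall>j\<in>I. fin i \<le> fin j)"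

inductive_set greedy :: "interval set \<Rightarrow> interval set" for I :: "interval set" where
  greedy_first: "least_fin I i \<Longrightarrow> i \<in> greedy I"
| greedy_next: "i \<in> greedy I \<Longrightarrow> least_fin {j \<in> I. fin i < fin j \<and> compatible i j} j \<Longrightarrow> j \<in> greedy I"

datatype operation = Insert interval | Remove interval | Query interval

fun operand :: "operation \<Rightarrow> interval" where
  "operand (Insert i) = i"
| "operand (Remove i) = i"
| "operand (Query i) = i"

fun update :: "operation \<Rightarrow> interval set \<Rightarrow> interval set" where
  "update (Insert i) I = insert i I"
| "update (Remove i) I = I - {i}"
| "update (Query i) I = I"

definition set_after :: "operation list \<Rightarrow> nat \<Rightarrow> interval set" where
  "set_after ops t = fold update (take t ops) {}"

definition admissible :: "operation list \<Rightarrow> bool" where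
  "admissible ops \<longleftrightarrow>
     (\<forall>p\<in>set ops. is_interval (operand p)) \<and>
     (\<forall>t\<le>length ops. inj_on fin (set_after ops t))"

definition depth :: "operation list \<Rightarrow> nat" where
  "depth ops = Max {card J | J t. 1 \<le> t \<and> t \<le> length ops \<and> J \<subseteq> set_after ops t \<and>
                                  (\<forall>i\<in>J. \<forall>j\<in>J. i \<noteq> j \<longrightarrow> overlap i j)}"

text \<open>Every operation of the data structure below returns its result together with its running
  time: the number of tree nodes (and list items) that it visits, each visit being a constant
  amount of work.  Following a pointer to a node of a tree takes constant time and is covered by
  the visit of that node.\<close>

section \<open>Splay trees, ordered by finishing time\<close>

type_synonym stree = "interval tree"

fun splay :: "interval \<Rightarrow> stree \<Rightarrow> stree \<times> nat" where
  "splay x Leaf = (Leaf, 1)"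
| "splay x (Node L b R) =
    (if fin x = fin b then (Node L b R, 1)
     else if fin x < fin b then
       (case L of
          Leaf \<Rightarrow> (Node L b R, 1)
        | Node A a B \<Rightarrow>
            if fin x = fin a then (Node A a (Node B b R), 1)
            else if fin x < fin a then
              (case splay x A of
                 (Leaf, c) \<Rightarrow> (Node A a (Node B b R), c + 1)
               | (Node A1 y A2, c) \<Rightarrow> (Node A1 y (Node A2 a (Node B b R)), c + 1))
            else
              (case splay x B of
                 (Leaf, c) \<Rightarrow> (Node A a (Node B b R), c + 1)
               | (Node B1 y B2, c) \<Rightarrow> (Node (Node A a B1) y (Node B2 b R), c + 1)))
     else
       (case R of
          Leaf \<Rightarrow> (Node L b R, 1)
        | Node A a B \<Rightarrow>
            if fin x = fin a then (Node (Node L b A) a B, 1)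
            else if fin x < fin a then
              (case splay x A of
                 (Leaf, c) \<Rightarrow> (Node (Node L b A) a B, c + 1)
               | (Node A1 y A2, c) \<Rightarrow> (Node (Node L b A1) y (Node A2 a B), c + 1))
            else
              (case splay x B of
                 (Leaf, c) \<Rightarrow> (Node (Node L b A) a B, c + 1)
               | (Node B1 y B2, c) \<Rightarrow> (Node (Node (Node L b A) a B1) y B2, c + 1))))"

fun splay_max :: "stree \<Rightarrow> stree \<times> nat" where
  "splay_max Leaf = (Leaf, 1)"
| "splay_max (Node A a Leaf) = (Node A a Leaf, 1)"
| "splay_max (Node A a (Node B b R)) =
    (case splay_max R of
       (Leaf, c) \<Rightarrow> (Node (Node A a B) b Leaf, c + 1)
     | (Node C y D, c) \<Rightarrow> (Node (Node (Node A a B) b C) y D, c + 1))"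

definition split_at :: "interval \<Rightarrow> stree \<Rightarrow> (stree \<times> stree) \<times> nat" where
  "split_at x t = (case splay x t of
     (Leaf, c) \<Rightarrow> ((Leaf, Leaf), c)
   | (Node A y B, c) \<Rightarrow> ((A, Node Leaf y B), c))"

definition join :: "stree \<Rightarrow> stree \<Rightarrow> stree \<times> nat" where
  "join t u = (case splay_max t of
     (Leaf, c) \<Rightarrow> (u, c)
   | (Node A y B, c) \<Rightarrow> (Node A y u, c))"

definition predecessor :: "interval \<Rightarrow> stree \<Rightarrow> interval option \<times> stree \<times> nat" where
  "predecessor x t = (case splay x t of
     (Leaf, c) \<Rightarrow> (None, Leaf, c)
   | (Node A y B, c) \<Rightarrow>
       (case splay_max A of
          (Leaf, c') \<Rightarrow> (None, Node A y B, c + c')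
        | (Node A1 j A2, c') \<Rightarrow> (Some j, Node (Node A1 j A2) y B, c + c')))"

section \<open>Balanced search trees with pointers to the least finishing time\<close>

text \<open>AVL trees over pairs, in the lexicographic order (for intervals: by start).  A node consists
  of left subtree, element, height, pointer to the element with least second component in its
  subtree, and right subtree.\<close>

datatype avl = Tip | Bin avl "real \<times> real" nat "real \<times> real" avl

fun ht :: "avl \<Rightarrow> nat" where
  "ht Tip = 0"
| "ht (Bin l a h m r) = h"

fun lower :: "avl \<Rightarrow> real \<times> real \<Rightarrow> real \<times> real" where
  "lower Tip x = x"
| "lower (Bin l a h m r) x = (if snd m < snd x then m else x)"

fun least :: "avl \<Rightarrow> (real \<times> real) option" where
  "least Tip = None"
| "least (Bin l a h m r) = Some m"

definition bin :: "avl \<Rightarrow> real \<times> real \<Rightarrow> avl \<Rightarrow> avl" where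
  "bin l a r = Bin l a (max (ht l) (ht r) + 1) (lower l (lower r a)) r"

definition balL :: "avl \<Rightarrow> real \<times> real \<Rightarrow> avl \<Rightarrow> avl" where
  "balL l c r =
    (if ht l = ht r + 2 then
       (case l of
          Tip \<Rightarrow> bin l c r
        | Bin A a _ _ B \<Rightarrow>
            if ht B \<le> ht A then bin A a (bin B c r)
            else (case B of
                    Tip \<Rightarrow> bin l c r
                  | Bin B1 b _ _ B2 \<Rightarrow> bin (bin A a B1) b (bin B2 c r)))
     else bin l c r)"

definition balR :: "avl \<Rightarrow> real \<times> real \<Rightarrow> avl \<Rightarrow> avl" where
  "balR l a r =
    (if ht r = ht l + 2 then
       (case r of
          Tip \<Rightarrow> bin l a r
        | Bin B c _ _ C \<Rightarrow>
            if ht B \<le> ht C then bin (bin l a B) c C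
            else (case B of
                    Tip \<Rightarrow> bin l a r
                  | Bin B1 b _ _ B2 \<Rightarrow> bin (bin l a B1) b (bin B2 c C)))
     else bin l a r)"

fun avl_member :: "real \<times> real \<Rightarrow> avl \<Rightarrow> bool \<times> nat" where
  "avl_member x Tip = (False, 1)"
| "avl_member x (Bin l a h m r) =
    (if x = a then (True, 1)
     else if x < a then (let (b, c) = avl_member x l in (b, c + 1))
     else (let (b, c) = avl_member x r in (b, c + 1)))"

fun avl_insert :: "real \<times> real \<Rightarrow> avl \<Rightarrow> avl \<times> nat" where
  "avl_insert x Tip = (bin Tip x Tip, 1)"
| "avl_insert x (Bin l a h m r) =
    (if x = a then (Bin l a h m r, 1)
     else if x < a then (let (l', c) = avl_insert x l in (balL l' a r, c + 1))
     else (let (r', c) = avl_insert x r in (balR l a r', c + 1)))"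

fun split_max :: "avl \<Rightarrow> real \<times> real \<Rightarrow> avl \<Rightarrow> (avl \<times> (real \<times> real)) \<times> nat" where
  "split_max l a Tip = ((l, a), 1)"
| "split_max l a (Bin rl b h m rr) =
    (let ((r', x), c) = split_max rl b rr in ((balL l a r', x), c + 1))"

fun avl_delete :: "real \<times> real \<Rightarrow> avl \<Rightarrow> avl \<times> nat" where
  "avl_delete x Tip = (Tip, 1)"
| "avl_delete x (Bin l a h m r) =
    (if x = a then
       (case l of
          Tip \<Rightarrow> (r, 1)
        | Bin ll b _ _ lr \<Rightarrow> (let ((l', y), c) = split_max ll b lr in (balR l' y r, c + 1)))
     else if x < a then (let (l', c) = avl_delete x l in (balR l' a r, c + 1))
     else (let (r', c) = avl_delete x r in (balL l a r', c + 1)))"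

text \<open>The interval of least finishing time among those that start after \<open>x\<close>; with \<open>x = fin i\<close>
  this is the least interval after \<open>i\<close> that is compatible with \<open>i\<close>.\<close>

fun first_after :: "real \<Rightarrow> avl \<Rightarrow> interval option \<times> nat" where
  "first_after x Tip = (None, 1)"
| "first_after x (Bin l a h m r) =
    (if x < start a then
       (let (b, c) = first_after x l in
        (Some (lower r (case b of None \<Rightarrow> a | Some k \<Rightarrow> if fin k < fin a then k else a)), c + 1))
     else (let (b, c) = first_after x r in (b, c + 1)))"

definition right_compatible :: "interval \<Rightarrow> avl \<Rightarrow> interval option \<times> nat" where
  "right_compatible i T = first_after (fin i) T"

text \<open>All elements whose first component is at most (at least) \<open>x\<close>.\<close>

fun elems_le :: "real \<Rightarrow> avl \<Rightarrow> (real \<times> real) list \<times> nat" where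
  "elems_le x Tip = ([], 1)"
| "elems_le x (Bin l a h m r) =
    (if fst a \<le> x then
       (let (as, c) = elems_le x l; (bs, c') = elems_le x r in (as @ a # bs, c + c' + 1))
     else (let (as, c) = elems_le x l in (as, c + 1)))"

fun elems_ge :: "real \<Rightarrow> avl \<Rightarrow> (real \<times> real) list \<times> nat" where
  "elems_ge x Tip = ([], 1)"
| "elems_ge x (Bin l a h m r) =
    (if x \<le> fst a then
       (let (as, c) = elems_ge x l; (bs, c') = elems_ge x r in (as @ a # bs, c + c' + 1))
     else (let (bs, c) = elems_ge x r in (bs, c + 1)))"

section \<open>Interval trees\<close>

text \<open>The intervals stored at a node are kept in two search trees, the first sorted by start, the
  second by finish; the second one therefore contains the swapped pairs.\<close>

type_synonym store = "avl \<times> avl"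

definition store_insert :: "interval \<Rightarrow> store \<Rightarrow> store \<times> nat" where
  "store_insert i S =
    (let (A, c) = avl_insert i (fst S); (B, c') = avl_insert (prod.swap i) (snd S)
     in ((A, B), c + c'))"

definition store_delete :: "interval \<Rightarrow> store \<Rightarrow> store \<times> nat" where
  "store_delete i S =
    (let (A, c) = avl_delete i (fst S); (B, c') = avl_delete (prod.swap i) (snd S)
     in ((A, B), c + c'))"

text \<open>An endpoint is tagged with its interval, since different intervals may share endpoints.
  Endpoints, too, are ordered lexicographically.\<close>

type_synonym endpoint = "real \<times> interval"
type_synonym entry = "endpoint \<times> store"

abbreviation split_point :: "entry \<Rightarrow> real" where
  "split_point e \<equiv> fst (fst e)"

datatype color = Red | Black

datatype itree = ILeaf | INode itree color entry itree

abbreviation RNode :: "itree \<Rightarrow> entry \<Rightarrow> itree \<Rightarrow> itree" where "RNode l e r \<equiv> INode l Red e r"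
abbreviation BNode :: "itree \<Rightarrow> entry \<Rightarrow> itree \<Rightarrow> itree" where "BNode l e r \<equiv> INode l Black e r"

fun paint :: "color \<Rightarrow> itree \<Rightarrow> itree" where
  "paint k ILeaf = ILeaf"
| "paint k (INode l _ e r) = INode l k e r"

text \<open>The intervals in the store of \<open>e\<close> that contain \<open>x\<close>.  Since they all contain the split point,
  it suffices to compare one of their endpoints with \<open>x\<close>.\<close>

definition stored_at :: "real \<Rightarrow> entry \<Rightarrow> interval list \<times> nat" where
  "stored_at x e =
    (if x \<le> split_point e then elems_le x (fst (snd e))
     else (let (js, c) = elems_ge x (snd (snd e)) in (map prod.swap js, c)))"

fun move_all :: "interval list \<Rightarrow> store \<Rightarrow> store \<Rightarrow> (store \<times> store) \<times> nat" where
  "move_all [] S S' = ((S, S'), 1)"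
| "move_all (j # js) S S' =
    (let (S1, c1) = store_delete j S; (S1', c2) = store_insert j S'; (SS, c3) = move_all js S1 S1'
     in (SS, c1 + c2 + c3 + 1))"

text \<open>An interval is stored at the highest node whose split point it contains.  Hence, when a
  rotation lifts the entry \<open>b\<close> above \<open>e\<close>, the intervals stored at \<open>e\<close> that contain the split point
  of \<open>b\<close> move to \<open>b\<close>.\<close>

definition lift :: "entry \<Rightarrow> entry \<Rightarrow> (entry \<times> entry) \<times> nat" where
  "lift b e =
    (let (js, c) = stored_at (split_point b) e; ((S, S'), c') = move_all js (snd e) (snd b)
     in (((fst b, S'), (fst e, S)), c + c'))"

definition lift2 :: "entry \<Rightarrow> entry \<Rightarrow> entry \<Rightarrow> (entry \<times> entry \<times> entry) \<times> nat" where
  "lift2 a b e =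
    (let ((b1, a'), c) = lift b a; ((b2, e'), c') = lift b1 e in ((a', b2, e'), c + c'))"

definition rotate :: "color \<Rightarrow> itree \<Rightarrow> entry \<Rightarrow> itree \<Rightarrow> entry \<Rightarrow> itree \<Rightarrow> entry \<Rightarrow> itree \<Rightarrow> itree \<times> nat"
  where
  "rotate k t1 a t2 b t3 e t4 =
    (let ((a', b', e'), c) = lift2 a b e
     in (RNode (INode t1 k a' t2) b' (INode t3 k e' t4), c + 1))"

fun baliL :: "itree \<Rightarrow> entry \<Rightarrow> itree \<Rightarrow> itree \<times> nat" where
  "baliL (RNode (RNode t1 a t2) b t3) e t4 = rotate Black t1 a t2 b t3 e t4"
| "baliL (RNode t1 a (RNode t2 b t3)) e t4 = rotate Black t1 a t2 b t3 e t4"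
| "baliL t1 a t2 = (BNode t1 a t2, 1)"

fun baliR :: "itree \<Rightarrow> entry \<Rightarrow> itree \<Rightarrow> itree \<times> nat" where
  "baliR t1 a (RNode t2 b (RNode t3 e t4)) = rotate Black t1 a t2 b t3 e t4"
| "baliR t1 a (RNode (RNode t2 b t3) e t4) = rotate Black t1 a t2 b t3 e t4"
| "baliR t1 a t2 = (BNode t1 a t2, 1)"

fun baldL :: "itree \<Rightarrow> entry \<Rightarrow> itree \<Rightarrow> itree \<times> nat" where
  "baldL (RNode t1 a t2) b t3 = (RNode (BNode t1 a t2) b t3, 1)"
| "baldL t1 a (BNode t2 b t3) = baliR t1 a (RNode t2 b t3)"
| "baldL t1 a (RNode (BNode t2 b t3) e t4) =
    (let ((a', b', e'), c) = lift2 a b e; (t, c') = baliR t3 e' (paint Red t4)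
     in (RNode (BNode t1 a' t2) b' t, c + c'))"
| "baldL t1 a t2 = (RNode t1 a t2, 1)"

fun baldR :: "itree \<Rightarrow> entry \<Rightarrow> itree \<Rightarrow> itree \<times> nat" where
  "baldR t1 a (RNode t2 b t3) = (RNode t1 a (BNode t2 b t3), 1)"
| "baldR (BNode t1 a t2) b t3 = baliL (RNode t1 a t2) b t3"
| "baldR (RNode t1 a (BNode t2 b t3)) e t4 =
    (let ((a', b', e'), c) = lift2 a b e; (t, c') = baliL (paint Red t1) a' t2
     in (RNode t b' (BNode t3 e' t4), c + c'))"
| "baldR t1 a t2 = (RNode t1 a t2, 1)"

fun ijoin :: "itree \<Rightarrow> itree \<Rightarrow> itree \<times> nat" where
  "ijoin ILeaf t = (t, 1)"
| "ijoin t ILeaf = (t, 1)"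
| "ijoin (RNode t1 a t2) (RNode t3 e t4) =
    (case ijoin t2 t3 of
       (RNode u2 b u3, c) \<Rightarrow> (let (t, c') = rotate Red t1 a u2 b u3 e t4 in (t, c + c'))
     | (t23, c) \<Rightarrow> (RNode t1 a (RNode t23 e t4), c + 1))"
| "ijoin (BNode t1 a t2) (BNode t3 e t4) =
    (case ijoin t2 t3 of
       (RNode u2 b u3, c) \<Rightarrow> (let (t, c') = rotate Black t1 a u2 b u3 e t4 in (t, c + c'))
     | (t23, c) \<Rightarrow> (let (t, c') = baldL t1 a (BNode t23 e t4) in (t, c + c')))"
| "ijoin t1 (RNode t2 a t3) = (let (t, c) = ijoin t1 t2 in (RNode t a t3, c + 1))"
| "ijoin (RNode t1 a t2) t3 = (let (t, c) = ijoin t2 t3 in (RNode t1 a t, c + 1))"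

fun endpoint_ins :: "endpoint \<Rightarrow> itree \<Rightarrow> itree \<times> nat" where
  "endpoint_ins x ILeaf = (RNode ILeaf (x, (Tip, Tip)) ILeaf, 1)"
| "endpoint_ins x (INode l k e r) =
    (if x = fst e then (INode l k e r, 1)
     else if x < fst e then
       (let (l', c) = endpoint_ins x l;
            (t, c') = (if k = Black then baliL l' e r else (RNode l' e r, 1)) in (t, c + c'))
     else
       (let (r', c) = endpoint_ins x r;
            (t, c') = (if k = Black then baliR l e r' else (RNode l e r', 1)) in (t, c + c')))"

definition endpoint_insert :: "endpoint \<Rightarrow> itree \<Rightarrow> itree \<times> nat" where
  "endpoint_insert x t = (let (t', c) = endpoint_ins x t in (paint Black t', c))"

fun black_node :: "itree \<Rightarrow> bool" where
  "black_node ILeaf = False"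
| "black_node (INode l k e r) = (k = Black)"

text \<open>Deleting a node leaves the intervals stored at it without a place; they are returned, too.\<close>

fun endpoint_del :: "endpoint \<Rightarrow> itree \<Rightarrow> (itree \<times> interval list) \<times> nat" where
  "endpoint_del x ILeaf = ((ILeaf, []), 1)"
| "endpoint_del x (INode l k e r) =
    (if x = fst e then
       (let (t, c) = ijoin l r; (js, c') = stored_at (split_point e) e in ((t, js), c + c'))
     else if x < fst e then
       (let ((l', js), c) = endpoint_del x l;
            (t, c') = (if black_node l then baldL l' e r else (RNode l' e r, 1))
        in ((t, js), c + c'))
     else
       (let ((r', js), c) = endpoint_del x r;
            (t, c') = (if black_node r then baldR l e r' else (RNode l e r', 1))
        in ((t, js), c + c')))"

fun place :: "interval \<Rightarrow> itree \<Rightarrow> itree \<times> nat" where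
  "place i ILeaf = (ILeaf, 1)"
| "place i (INode l k e r) =
    (if fin i < split_point e then (let (l', c) = place i l in (INode l' k e r, c + 1))
     else if split_point e < start i then (let (r', c) = place i r in (INode l k e r', c + 1))
     else (let (S, c) = store_insert i (snd e) in (INode l k (fst e, S) r, c + 1)))"

fun unplace :: "interval \<Rightarrow> itree \<Rightarrow> itree \<times> nat" where
  "unplace i ILeaf = (ILeaf, 1)"
| "unplace i (INode l k e r) =
    (if fin i < split_point e then (let (l', c) = unplace i l in (INode l' k e r, c + 1))
     else if split_point e < start i then (let (r', c) = unplace i r in (INode l k e r', c + 1))
     else (let (S, c) = store_delete i (snd e) in (INode l k (fst e, S) r, c + 1)))"

fun place_all :: "interval list \<Rightarrow> itree \<Rightarrow> itree \<times> nat" where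
  "place_all [] t = (t, 1)"
| "place_all (j # js) t =
    (let (t1, c1) = place j t; (t2, c2) = place_all js t1 in (t2, c1 + c2 + 1))"

definition endpoint_delete :: "endpoint \<Rightarrow> itree \<Rightarrow> itree \<times> nat" where
  "endpoint_delete x t =
    (let ((t1, js), c1) = endpoint_del x t; (t2, c2) = place_all js (paint Black t1)
     in (t2, c1 + c2))"

definition itree_insert :: "interval \<Rightarrow> itree \<Rightarrow> itree \<times> nat" where
  "itree_insert i t =
    (let (t1, c1) = endpoint_insert (start i, i) t; (t2, c2) = endpoint_insert (fin i, i) t1;
         (t3, c3) = place i t2
     in (t3, c1 + c2 + c3))"

definition itree_delete :: "interval \<Rightarrow> itree \<Rightarrow> itree \<times> nat" where
  "itree_delete i t =
    (let (t1, c1) = unplace i t; (t2, c2) = endpoint_delete (start i, i) t1;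
         (t3, c3) = endpoint_delete (fin i, i) t2
     in (t3, c1 + c2 + c3))"

text \<open>All intervals that contain the point \<open>x\<close>.\<close>

fun stab :: "real \<Rightarrow> itree \<Rightarrow> interval list \<times> nat" where
  "stab x ILeaf = ([], 1)"
| "stab x (INode l k e r) =
    (let (is, c) = stored_at x e in
     if x < split_point e then (let (js, c') = stab x l in (is @ js, c + c' + 1))
     else if split_point e < x then (let (js, c') = stab x r in (is @ js, c + c' + 1))
     else (is, c + 1))"

definition covers :: "interval \<Rightarrow> itree \<Rightarrow> interval list \<times> nat" where
  "covers i t =
    (let (js, c) = stab (fin i) t
     in (filter (\<lambda>j. start j \<le> start i \<and> fin i \<le> fin j) js, c + length js))"

section \<open>The compatibility forest\<close>

text \<open>\<open>paths\<close> contains one splay tree for every maximal solid path; dashed edges are implicit, as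
  \<open>i\<close> has an edge to \<open>right_compatible i\<close>.  \<open>search\<close> is the balanced search tree and \<open>ivals\<close> the
  interval tree over the same intervals.\<close>

record forest =
  paths :: "stree list"
  search :: avl
  ivals :: itree

definition empty_forest :: forest where
  "empty_forest = \<lparr>paths = [], search = Tip, ivals = ILeaf\<rparr>"

text \<open>The splay tree that contains \<open>i\<close>.  This lookup stands for the pointer to the node of \<open>i\<close>, and
  so it takes no time of its own; splaying at \<open>i\<close> then visits the path between \<open>i\<close> and the root.\<close>

definition tree_of :: "interval \<Rightarrow> stree list \<Rightarrow> stree" where
  "tree_of i F = (case find (\<lambda>t. i \<in> set_tree t) F of None \<Rightarrow> Leaf | Some t \<Rightarrow> t)"

definition without :: "interval \<Rightarrow> stree list \<Rightarrow> stree list" where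
  "without i F = remove1 (tree_of i F) F"

definition add_tree :: "stree \<Rightarrow> stree list \<Rightarrow> stree list" where
  "add_tree t F = (if t = Leaf then F else t # F)"

lemma size_splay: "size (fst (splay x t)) = size t"
  by (induction x t rule: splay.induct) (auto split: tree.splits prod.splits)

lemma splay_eq_Leaf: "fst (splay x t) = Leaf \<longleftrightarrow> t = Leaf"
  by (metis size_splay eq_size_0)

lemma size_split_at:
  "split_at x t = ((l, r), c) \<Longrightarrow> t \<noteq> Leaf \<Longrightarrow> size l < size t"
  using size_splay[of x t] splay_eq_Leaf[of x t]
  by (auto simp: split_at_def split: prod.splits tree.splits)

lemma tree_of_in: "tree_of i F \<noteq> Leaf \<Longrightarrow> tree_of i F \<in> set F"
  by (cases "find (\<lambda>t. i \<in> set_tree t) F") (auto simp: tree_of_def dest: find_Some_iff[THEN iffD1])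

lemma size_without:
  "tree_of i F \<noteq> Leaf \<Longrightarrow>
   sum_list (map size F) = size (tree_of i F) + sum_list (map size (without i F))"
  by (simp add: without_def tree_of_in sum_list_map_remove1)

text \<open>The loop of \<open>expose\<close>; \<open>t\<close> is the current splay tree and \<open>F\<close> contains all the other ones.
  If the edge of \<open>j\<close> leads to \<open>i'\<close>, then \<open>i'\<close> is in one of the trees in \<open>F\<close>, so that the test for
  \<open>Leaf\<close> only serves to make the function total.\<close>

function expose_loop :: "avl \<Rightarrow> stree \<Rightarrow> stree list \<Rightarrow> stree list \<times> nat" where
  "expose_loop T t F =
    (case splay_max t of
       (Leaf, c) \<Rightarrow> (F, c)
     | (Node A j B, c) \<Rightarrow>
         (case right_compatible j T of
            (None, c1) \<Rightarrow> (Node A j B # F, c + c1)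
          | (Some i', c1) \<Rightarrow>
              if tree_of i' F = Leaf then (Node A j B # F, c + c1)
              else
                (case split_at i' (tree_of i' F) of ((l, r), c2) \<Rightarrow>
                 case join (Node A j B) r of (t', c3) \<Rightarrow>
                 case expose_loop T t' (add_tree l (without i' F)) of (F', c4) \<Rightarrow>
                   (F', c + c1 + c2 + c3 + c4))))"
  by pat_completeness auto
termination
  by (relation "measure (\<lambda>(T, t, F). sum_list (map size F))")
     (auto simp: add_tree_def size_without dest!: size_split_at[OF sym])

definition expose :: "interval \<Rightarrow> forest \<Rightarrow> forest \<times> nat" where
  "expose i D =
    (let (t, c) = splay i (tree_of i (paths D));
         (F, c') = expose_loop (search D) t (without i (paths D))
     in (D\<lparr>paths := F\<rparr>, c + c'))"

definition expose_least :: "forest \<Rightarrow> forest \<times> nat" where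
  "expose_least D = (case least (search D) of None \<Rightarrow> (D, 1) | Some m \<Rightarrow> expose m D)"

text \<open>If the predecessor of \<open>c\<close> on its solid path is compatible with \<open>i\<close>, cut the path below \<open>c\<close>.\<close>

definition cut :: "interval \<Rightarrow> interval \<Rightarrow> stree list \<Rightarrow> stree list \<times> nat" where
  "cut i c F =
    (case predecessor c (tree_of c F) of
       (None, t, n) \<Rightarrow> (add_tree t (without c F), n)
     | (Some j, t, n) \<Rightarrow>
         if compatible j i then
           (let ((l, r), n') = split_at c t in (add_tree l (add_tree r (without c F)), n + n'))
         else (add_tree t (without c F), n))"

fun cut_all :: "interval \<Rightarrow> interval list \<Rightarrow> stree list \<Rightarrow> stree list \<times> nat" where
  "cut_all i [] F = (F, 1)"
| "cut_all i (c # cs) F =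
    (let (F1, n1) = cut i c F; (F2, n2) = cut_all i cs F1 in (F2, n1 + n2 + 1))"

fun least_of :: "interval option \<Rightarrow> interval list \<Rightarrow> interval option" where
  "least_of r [] = r"
| "least_of r (j # js) =
    (case r of
       None \<Rightarrow> least_of (Some j) js
     | Some k \<Rightarrow> least_of (Some (if fin j < fin k then j else k)) js)"

text \<open>The next interval after \<open>i\<close> that does not cover \<open>i\<close>.  Such an interval starts after \<open>i\<close> does:
  either after \<open>i\<close> finishes, and then it is the right compatible interval of \<open>i\<close>; or not, and then
  it contains the finishing time of \<open>i\<close>.\<close>

definition next_noncovering :: "interval \<Rightarrow> avl \<Rightarrow> itree \<Rightarrow> interval option \<times> nat" where
  "next_noncovering i T V =
    (let (r, c) = right_compatible i T; (js, c') = stab (fin i) V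
     in (least_of r (filter (\<lambda>j. start i < start j \<and> fin i < fin j) js), c + c' + length js))"

text \<open>Inserting an interval that is present, or removing one that is absent, changes nothing.\<close>

definition insertCF :: "interval \<Rightarrow> forest \<Rightarrow> forest \<times> nat" where
  "insertCF i D =
    (let (present, c0) = avl_member i (search D) in
     if present then (D, c0)
     else
       let (T, c1) = avl_insert i (search D);
           (V, c2) = itree_insert i (ivals D);
           F0 = Node Leaf i Leaf # paths D;
           (r, c3) = next_noncovering i T V;
           (F1, c4) = (case r of None \<Rightarrow> (F0, 1) | Some k \<Rightarrow> cut i k F0);
           (cs, c5) = covers i V;
           (F2, c6) = cut_all i cs F1;
           (D', c7) = expose_least \<lparr>paths = F2, search = T, ivals = V\<rparr>
       in (D', c0 + c1 + c2 + c3 + c4 + c5 + c6 + c7))"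

text \<open>Deleting the node \<open>i\<close> from the forest deletes its incoming and its outgoing solid edge, so
  that the parts of the path before and after \<open>i\<close> become two separate paths.  (They must not be
  concatenated: after the removal, the predecessor of \<open>i\<close> may have its edge to another interval
  than the former successor of \<open>i\<close>.)\<close>

definition removeCF :: "interval \<Rightarrow> forest \<Rightarrow> forest \<times> nat" where
  "removeCF i D =
    (let (present, c0) = avl_member i (search D) in
     if \<not> present then (D, c0)
     else
       let (F, c1) =
             (case splay i (tree_of i (paths D)) of
                (Leaf, c) \<Rightarrow> (paths D, c)
              | (Node l j r, c) \<Rightarrow> (add_tree l (add_tree r (without i (paths D))), c));
           (T, c2) = avl_delete i (search D);
           (V, c3) = itree_delete i (ivals D);
           (D', c4) = expose_least \<lparr>paths = F, search = T, ivals = V\<rparr>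
       in (D', c0 + c1 + c2 + c3 + c4))"

text \<open>Starting from the node of the least interval \<open>m\<close>, find the root of its splay tree and search
  for \<open>i\<close> there.\<close>

definition queryCF :: "interval \<Rightarrow> forest \<Rightarrow> bool \<times> forest \<times> nat" where
  "queryCF i D =
    (case least (search D) of
       None \<Rightarrow> (False, D, 1)
     | Some m \<Rightarrow>
         (let (t, c) = splay m (tree_of m (paths D)); (t', c') = splay i t
          in ((case t' of Leaf \<Rightarrow> False | Node l j r \<Rightarrow> j = i),
              D\<lparr>paths := add_tree t' (without m (paths D))\<rparr>, c + c')))"

section \<open>Processing a sequence of operations\<close>

text \<open>Result (relevant for queries only), new state and running time of one operation.\<close>

fun perform :: "operation \<Rightarrow> forest \<Rightarrow> bool \<times> forest \<times> nat" where
  "perform (Insert i) D = (True, insertCF i D)"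
| "perform (Remove i) D = (True, removeCF i D)"
| "perform (Query i) D = queryCF i D"

definition state_after :: "operation list \<Rightarrow> nat \<Rightarrow> forest" where
  "state_after ops t = fold (\<lambda>p D. fst (snd (perform p D))) (take t ops) empty_forest"

definition answer :: "operation list \<Rightarrow> nat \<Rightarrow> bool" where
  "answer ops t = fst (perform (ops ! t) (state_after ops t))"

definition time :: "operation list \<Rightarrow> nat \<Rightarrow> nat" where
  "time ops t = snd (snd (perform (ops ! t) (state_after ops t)))"

text \<open>The amortised bounds, up to the constant factor, for the operation \<open>ops ! t\<close>, the size \<open>n\<close>
  being that of the set after it.  The offset in \<open>log 2 (n + 2)\<close> only matters for \<open>n \<le> 1\<close>, where
  the logarithm would not be positive; \<open>max 1\<close> only matters if all sets are empty.\<close>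

definition amortised_bound :: "operation list \<Rightarrow> nat \<Rightarrow> real" where
  "amortised_bound ops t =
    (let lg = log 2 (real (card (set_after ops (Suc t))) + 2) in
     case ops ! t of
       Query _ \<Rightarrow> lg
     | _ \<Rightarrow> real (max 1 (depth ops)) * lg ^ 2)"

end

theory Submission
  imports Defs "HOL-Library.Multiset"
begin

text \<open>Every solid path is a chain of edges of the compatibility forest; after exposing the least
  interval, the path containing it ends in a root and hence is the greedy set.

  The amortised analysis adds to the potential of the splay trees \<open>16 log (n + 2)\<close> times the number
  of dashed heavy edges, where an edge is heavy if it leads to a node with less than twice as many
  descendants.  An iteration of expose along a heavy edge removes such an edge, and there are at
  most \<open>log n\<close> light edges on a path.  Inserting or removing \<open>i\<close> only changes the edges into the at
  most \<open>d + 2\<close> nodes that contain \<open>fin i\<close>, are next after \<open>i\<close> without covering it, or are right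
  compatible with \<open>i\<close>; this creates \<open>O(d log n)\<close> heavy edges.  In the interval tree, the intervals
  stored at a node share its split point, so there are at most \<open>d\<close> of them and a rotation moves
  them in time \<open>O(d log n)\<close>.\<close>

section \<open>Balanced search trees\<close>

text \<open>One insertion can redirect linearly many edges, so counting changed edges would give
  nothing. Changes are counted by target instead: the changed edges have few targets, and every node
  has at most one heavy incoming edge. The factor \<open>lg I\<close> of the potential changes with
  \<open>I\<close> as well; this is affordable because there are at most \<open>card I\<close>
  edges, while the logarithm grows by at most \<open>2 / (card I + 2)\<close>. The potential of a
  splay tree sees only the size of its own path and not the subtrees hanging from it, so every step
  of an exposure is charged a full logarithm; hence the square. Costs inside the interval tree are
  natural numbers, with an integer \<open>w\<close> in place of the logarithm, and are converted to
  \<open>lg\<close> in \<open>insertCF_correct\<close> and \<open>removeCF_correct\<close>. In the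
  middle of an insertion the paths already contain the new interval but still follow old edges;
  therefore the path invariant takes the edge relation as an argument of its own.\<close>

fun avl_inorder :: "avl \<Rightarrow> (real \<times> real) list" where
  "avl_inorder Tip = []"
| "avl_inorder (Bin l a h m r) = avl_inorder l @ a # avl_inorder r"

abbreviation avl_set :: "avl \<Rightarrow> (real \<times> real) set" where
  "avl_set t \<equiv> set (avl_inorder t)"

fun balanced_avl :: "avl \<Rightarrow> bool" where
  "balanced_avl Tip = True"
| "balanced_avl (Bin l a h m r) \<longleftrightarrow>
     balanced_avl l \<and> balanced_avl r \<and> h = max (ht l) (ht r) + 1 \<and> ht l \<le> ht r + 1 \<and> ht r \<le> ht l + 1"

text \<open>A local condition: the pointer is whatever \<open>bin\<close> would compute. That it
  designates the least finishing time is derived in \<open>least_correct\<close>.\<close>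

fun pointers_ok :: "avl \<Rightarrow> bool" where
  "pointers_ok Tip = True"
| "pointers_ok (Bin l a h m r) \<longleftrightarrow> pointers_ok l \<and> pointers_ok r \<and> m = lower l (lower r a)"

definition search_tree :: "avl \<Rightarrow> bool" where
  "search_tree t \<longleftrightarrow> balanced_avl t \<and> pointers_ok t \<and> sorted_wrt (<) (avl_inorder t)"

section \<open>Rebalancing, insertion and deletion in AVL trees\<close>

lemma inorder_bin [simp]: "avl_inorder (bin l a r) = avl_inorder l @ a # avl_inorder r"
  by (simp add: bin_def)

lemma inorder_balL [simp]: "avl_inorder (balL l a r) = avl_inorder l @ a # avl_inorder r"
  by (auto simp: balL_def split: avl.splits)

lemma inorder_balR [simp]: "avl_inorder (balR l a r) = avl_inorder l @ a # avl_inorder r"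
  by (auto simp: balR_def split: avl.splits)

lemma pointers_bin [simp]: "pointers_ok (bin l a r) \<longleftrightarrow> pointers_ok l \<and> pointers_ok r"
  by (simp add: bin_def)

lemma pointers_balL: "pointers_ok l \<Longrightarrow> pointers_ok r \<Longrightarrow> pointers_ok (balL l a r)"
  by (auto simp: balL_def split: avl.splits)

lemma pointers_balR: "pointers_ok l \<Longrightarrow> pointers_ok r \<Longrightarrow> pointers_ok (balR l a r)"
  by (auto simp: balR_def split: avl.splits)

lemma ht_bin [simp]: "ht (bin l a r) = max (ht l) (ht r) + 1"
  by (simp add: bin_def)

lemma balanced_bin [simp]:
  "balanced_avl (bin l a r) \<longleftrightarrow>
     balanced_avl l \<and> balanced_avl r \<and> ht l \<le> ht r + 1 \<and> ht r \<le> ht l + 1"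
  by (simp add: bin_def)

text \<open>The left subtree may be two levels too high, as after an insertion on the left or a
  deletion on the right. Besides balance, the callers need that the repair lowers the node by at
  most one level, and by none if there was nothing to repair.\<close>

lemma balanced_balL:
  assumes "balanced_avl l" "balanced_avl r" "ht l \<le> ht r + 2" "ht r \<le> ht l + 1"
  shows "balanced_avl (balL l a r) \<and> ht (balL l a r) \<le> max (ht l) (ht r) + 1 \<and>
    max (ht l) (ht r) \<le> ht (balL l a r) \<and>
    (ht l \<le> ht r + 1 \<longrightarrow> ht (balL l a r) = max (ht l) (ht r) + 1)"
proof (cases l)
  case (Bin A b h m B)
  then show ?thesis using assms by (cases B; simp add: balL_def; arith)
qed (use assms in \<open>auto simp: balL_def\<close>)

lemma balanced_balR:
  assumes "balanced_avl l" "balanced_avl r" "ht r \<le> ht l + 2" "ht l \<le> ht r + 1"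
  shows "balanced_avl (balR l a r) \<and> ht (balR l a r) \<le> max (ht l) (ht r) + 1 \<and>
    max (ht l) (ht r) \<le> ht (balR l a r) \<and>
    (ht r \<le> ht l + 1 \<longrightarrow> ht (balR l a r) = max (ht l) (ht r) + 1)"
proof (cases r)
  case (Bin A b h m B)
  then show ?thesis using assms by (cases A; simp add: balR_def; arith)
qed (use assms in \<open>auto simp: balR_def\<close>)

lemma balanced_insert:
  "balanced_avl t \<Longrightarrow> avl_insert x t = (t', c) \<Longrightarrow>
     balanced_avl t' \<and> ht t \<le> ht t' \<and> ht t' \<le> ht t + 1 \<and> c \<le> ht t + 1"
proof (induction t arbitrary: t' c)
  case Tip
  then show ?case by auto
next
  case (Bin l a h m r)
  consider "x = a" | "x \<noteq> a" "x < a" | "x \<noteq> a" "\<not> x < a" by blast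
  then show ?case
  proof cases
    case 1
    then show ?thesis using Bin.prems by auto
  next
    case 2
    obtain l' c' where l': "avl_insert x l = (l', c')" by fastforce
    have "t' = balL l' a r" "c = c' + 1" using Bin.prems(2) 2 l' by auto
    then show ?thesis
      using Bin.IH(1)[OF _ l'] Bin.prems(1) balanced_balL[of l' r a] by (simp; arith)
  next
    case 3
    obtain r' c' where r': "avl_insert x r = (r', c')" by fastforce
    have "t' = balR l a r'" "c = c' + 1" using Bin.prems(2) 3 r' by auto
    then show ?thesis
      using Bin.IH(2)[OF _ r'] Bin.prems(1) balanced_balR[of l r' a] by (simp; arith)
  qed
qed

lemma pointers_insert:
  "pointers_ok t \<Longrightarrow> pointers_ok (fst (avl_insert x t))"
  by (induction t) (auto simp: pointers_balL pointers_balR Let_def case_prod_beta)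

lemma avl_set_insert:
  "avl_set (fst (avl_insert x t)) = insert x (avl_set t)"
  by (induction t) (auto simp: Let_def case_prod_beta)

lemma sorted_insert:
  "sorted_wrt (<) (avl_inorder t) \<Longrightarrow> sorted_wrt (<) (avl_inorder (fst (avl_insert x t)))"
proof (induction t)
  case Tip
  then show ?case by simp
next
  case (Bin l a h m r)
  then show ?case
    using avl_set_insert[of x l] avl_set_insert[of x r]
    by (auto simp: sorted_wrt_append Let_def case_prod_beta)
qed

lemma search_tree_insert:
  assumes "search_tree t" "avl_insert x t = (t', c)"
  shows "search_tree t'" "avl_set t' = insert x (avl_set t)" "c \<le> ht t + 1"
  using assms balanced_insert[of t x t' c] pointers_insert[of t x] avl_set_insert[of x t] sorted_insert[of t x]
  by (auto simp: search_tree_def)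

lemma inorder_split_max:
  "split_max l a r = ((t', y), c) \<Longrightarrow> avl_inorder t' @ [y] = avl_inorder l @ a # avl_inorder r"
  by (induction l a r arbitrary: t' y c rule: split_max.induct) (auto split: prod.splits)

lemma pointers_split_max:
  "pointers_ok l \<Longrightarrow> pointers_ok r \<Longrightarrow> split_max l a r = ((t', y), c) \<Longrightarrow> pointers_ok t'"
  by (induction l a r arbitrary: t' y c rule: split_max.induct) (auto simp: pointers_balL split: prod.splits)

text \<open>The arguments stand for a node of height \<open>max (ht l) (ht r) + 1\<close>, so
  removing its maximum loses at most one level, which is what \<open>balR\<close> can repair in
  \<open>balanced_delete\<close>.\<close>

lemma balanced_split_max:
  "balanced_avl l \<Longrightarrow> balanced_avl r \<Longrightarrow> ht l \<le> ht r + 1 \<Longrightarrow> ht r \<le> ht l + 1 \<Longrightarrow>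
   split_max l a r = ((t', y), c) \<Longrightarrow>
     balanced_avl t' \<and> ht t' \<le> max (ht l) (ht r) + 1 \<and> max (ht l) (ht r) \<le> ht t' \<and>
     c \<le> ht r + 1"
proof (induction l a r arbitrary: t' y c rule: split_max.induct)
  case (1 l a)
  then show ?case by auto
next
  case (2 l a rl b h m rr)
  obtain r' x c' where r': "split_max rl b rr = ((r', x), c')" by (metis prod.collapse)
  have "t' = balL l a r'" "c = c' + 1" using 2 r' by auto
  then show ?case
    using 2(1)[OF _ _ _ _ r'] 2 balanced_balL[of l r' a] by (simp; arith)
qed

lemma balanced_delete:
  "balanced_avl t \<Longrightarrow> avl_delete x t = (t', c) \<Longrightarrow>
     balanced_avl t' \<and> ht t' \<le> ht t \<and> ht t \<le> ht t' + 1 \<and> c \<le> ht t + 1"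
proof (induction t arbitrary: t' c)
  case Tip
  then show ?case by auto
next
  case (Bin l a h m r)
  consider "x = a" "l = Tip" | ll b k n lr where "x = a" "l = Bin ll b k n lr"
    | "x \<noteq> a" "x < a" | "x \<noteq> a" "\<not> x < a"
    by (metis avl.exhaust)
  then show ?case
  proof cases
    case 1
    then show ?thesis using Bin.prems by auto
  next
    case 2
    obtain l' y c' where l': "split_max ll b lr = ((l', y), c')" by (metis prod.collapse)
    have "t' = balR l' y r" "c = c' + 1" using Bin.prems(2) 2 l' by auto
    then show ?thesis
      using balanced_split_max[OF _ _ _ _ l'] Bin.prems(1) 2 balanced_balR[of l' r y]
      by (simp; arith)
  next
    case 3
    obtain l' c' where l': "avl_delete x l = (l', c')" by fastforce
    have "t' = balR l' a r" "c = c' + 1" using Bin.prems(2) 3 l' by auto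
    then show ?thesis
      using Bin.IH(1)[OF _ l'] Bin.prems(1) balanced_balR[of l' r a] by (simp; arith)
  next
    case 4
    obtain r' c' where r': "avl_delete x r = (r', c')" by fastforce
    have "t' = balL l a r'" "c = c' + 1" using Bin.prems(2) 4 r' by auto
    then show ?thesis
      using Bin.IH(2)[OF _ r'] Bin.prems(1) balanced_balL[of l r' a] by (simp; arith)
  qed
qed

lemma pointers_delete:
  "pointers_ok t \<Longrightarrow> pointers_ok (fst (avl_delete x t))"
proof (induction t)
  case Tip
  then show ?case by simp
next
  case (Bin l a h m r)
  then show ?case
  proof (cases l)
    case Tip
    then show ?thesis using Bin by (auto simp: pointers_balR pointers_balL Let_def case_prod_beta)
  next
    case l: (Bin ll b k n lr)
    obtain l' y c' where l': "split_max ll b lr = ((l', y), c')" by (metis prod.collapse)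
    then have "pointers_ok l'" using l Bin.prems pointers_split_max[OF _ _ l'] by simp
    then show ?thesis using l Bin.IH Bin.prems l'
      by (auto simp: pointers_balR pointers_balL Let_def case_prod_beta)
  qed
qed

text \<open>Equality with a filter yields the new set and, by \<open>sorted_wrt_filter\<close>, the
  order at once.\<close>

lemma sorted_delete:
  "sorted_wrt (<) (avl_inorder t) \<Longrightarrow>
     avl_inorder (fst (avl_delete x t)) = filter (\<lambda>y. y \<noteq> x) (avl_inorder t)"
proof (induction t)
  case Tip
  then show ?case by simp
next
  case (Bin l a h m r)
  have less: "\<And>y. y \<in> avl_set l \<Longrightarrow> y < a" "\<And>y. y \<in> avl_set r \<Longrightarrow> a < y"
    and sub: "sorted_wrt (<) (avl_inorder l)" "sorted_wrt (<) (avl_inorder r)"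
    using Bin.prems by (auto simp: sorted_wrt_append)
  \<comment> \<open>A subtree that the search does not enter cannot contain \<open>x\<close>, so the
    filter leaves it alone.\<close>
  have keep: "filter (\<lambda>y. y \<noteq> x) (avl_inorder l) = avl_inorder l" if "a \<le> x"
    using that less(1) by (intro filter_True) force
  have keep': "filter (\<lambda>y. y \<noteq> x) (avl_inorder r) = avl_inorder r" if "x \<le> a"
    using that less(2) by (intro filter_True) force
  show ?case
  proof (cases l)
    case Tip
    then show ?thesis using Bin.IH sub keep keep' by (auto simp: Let_def case_prod_beta)
  next
    case l: (Bin ll b k n lr)
    obtain l' y c' where l': "split_max ll b lr = ((l', y), c')" by (metis prod.collapse)
    have "avl_inorder l' @ y # avl_inorder r = avl_inorder l @ avl_inorder r"
      using inorder_split_max[OF l'] l by simp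
    then show ?thesis using Bin.IH sub keep keep' l l'
      by (auto simp: Let_def case_prod_beta)
  qed
qed

lemma search_tree_delete:
  assumes "search_tree t" "avl_delete x t = (t', c)"
  shows "search_tree t'" "avl_set t' = avl_set t - {x}" "c \<le> ht t + 1"
  using assms balanced_delete[of t x t' c] pointers_delete[of t x] sorted_delete[of t x]
  by (auto simp: search_tree_def sorted_wrt_filter)

lemma avl_member_correct:
  "sorted_wrt (<) (avl_inorder t) \<Longrightarrow> balanced_avl t \<Longrightarrow> avl_member x t = (b, c) \<Longrightarrow>
     b = (x \<in> avl_set t) \<and> c \<le> ht t + 1"
proof (induction t arbitrary: b c)
  case Tip
  then show ?case by auto
next
  case (Bin l a h m r)
  then show ?case
    by (force simp: sorted_wrt_append split: if_splits prod.splits)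
qed

text \<open>A node is at most two levels above its lower subtree, and its size (plus one) is at
  least twice that of the smaller subtree, which multiplies the square by four. This replaces the
  Fibonacci bound at the price of the constant 2 before the logarithm.\<close>

lemma balanced_height:
  "balanced_avl t \<Longrightarrow> 2 ^ ht t \<le> (length (avl_inorder t) + 1)\<^sup>2"
proof (induction t)
  case Tip
  then show ?case by simp
next
  case (Bin l a h m r)
  define p where "p = length (avl_inorder l) + 1"
  define q where "q = length (avl_inorder r) + 1"
  define k where "k = min (ht l) (ht r)"
  have "(2::nat) ^ k \<le> 2 ^ ht l" "(2::nat) ^ k \<le> 2 ^ ht r" by (auto simp: k_def intro: power_increasing)
  then have "2 ^ k \<le> p\<^sup>2" "2 ^ k \<le> q\<^sup>2"
    using Bin by (auto simp: p_def q_def intro: order_trans[OF power_increasing[of k]])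
  then have "2 ^ k \<le> (min p q)\<^sup>2" by (simp add: min_def)
  then have "4 * 2 ^ k \<le> (2 * min p q)\<^sup>2" by (simp add: power_mult_distrib)
  also have "\<dots> \<le> (p + q)\<^sup>2" by (intro power_mono) auto
  finally have *: "2 ^ (k + 2) \<le> (p + q)\<^sup>2" by (simp add: power_add mult.commute)
  have "h \<le> k + 2" using Bin.prems by (auto simp: k_def)
  then have "(2::nat) ^ h \<le> 2 ^ (k + 2)" by (intro power_increasing) auto
  with * show ?case by (simp add: p_def q_def)
qed

lemma search_tree_height:
  assumes "search_tree t"
  shows "real (ht t) \<le> 2 * log 2 (real (card (avl_set t)) + 1)"
proof -
  have "distinct (avl_inorder t)"
    using assms by (auto simp: search_tree_def strict_sorted_iff)
  then have card: "card (avl_set t) = length (avl_inorder t)" by (rule distinct_card)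
  have "(2::real) ^ ht t \<le> (real (card (avl_set t)) + 1)\<^sup>2"
    using balanced_height[of t] assms unfolding card search_tree_def
    by (metis (mono_tags) of_nat_1 of_nat_add of_nat_le_iff of_nat_numeral of_nat_power)
  then have "log 2 ((2::real) ^ ht t) \<le> log 2 ((real (card (avl_set t)) + 1)\<^sup>2)"
    by (subst log_le_cancel_iff) auto
  then show ?thesis by (simp add: log_nat_power)
qed

section \<open>Finding intervals of least finishing time\<close>

lemma least_fin_trans:
  assumes "least_fin (insert y A) z" "least_fin B y"
  shows "least_fin (A \<union> B) z"
proof -
  have "z \<in> A \<union> B" "fin z \<le> fin y" using assms by (auto simp: least_fin_def)
  moreover have "fin z \<le> fin j" if "j \<in> A \<union> B" for j
    using that assms \<open>fin z \<le> fin y\<close> unfolding least_fin_def by (meson Un_iff insertI2 order_trans)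
  ultimately show ?thesis by (simp add: least_fin_def)
qed

text \<open>The premise is phrased as the induction hypothesis of \<open>least_correct\<close>, so
  that the lemma can be used inside that induction.\<close>

lemma lower_least:
  assumes "\<And>m. least t = Some m \<Longrightarrow> least_fin (avl_set t) m"
  shows "least_fin (insert x (avl_set t)) (lower t x)"
proof (cases t)
  case Tip
  then show ?thesis by (simp add: least_fin_def)
next
  case (Bin l a h m r)
  then have "least_fin (avl_set t) m" using assms by simp
  moreover have "lower t x = (if snd m < snd x then m else x)" using Bin by simp
  ultimately show ?thesis by (fastforce simp: least_fin_def)
qed

lemma least_correct:
  "pointers_ok t \<Longrightarrow> least t = Some m \<Longrightarrow> least_fin (avl_set t) m"
proof (induction t arbitrary: m)
  case Tip
  then show ?case by simp
next
  case (Bin l a h n r)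
  have "least_fin (insert a (avl_set r)) (lower r a)"
    by (rule lower_least) (use Bin in auto)
  moreover have "least_fin (insert (lower r a) (avl_set l)) (lower l (lower r a))"
    by (rule lower_least) (use Bin in auto)
  moreover have "m = lower l (lower r a)" using Bin.prems by simp
  moreover have "avl_set (Bin l a h n r) = avl_set l \<union> insert a (avl_set r)" by auto
  ultimately show ?case
    using least_fin_trans by metis
qed

lemma least_eq_None: "least t = None \<longleftrightarrow> avl_set t = {}"
  by (cases t) auto

lemma lower_correct:
  "pointers_ok t \<Longrightarrow> least_fin (insert x (avl_set t)) (lower t x)"
  by (intro lower_least least_correct)

text \<open>If \<open>a\<close> starts after \<open>x\<close>, so does all of \<open>r\<close>, and
  its pointer answers for it; otherwise nothing in \<open>l\<close> starts after \<open>x\<close>.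
  Either way only one subtree is entered. The lexicographic order gives only \<open>\<le>\<close>
  between starts, which suffices in both cases.\<close>

lemma first_after_correct:
  "sorted_wrt (<) (avl_inorder t) \<Longrightarrow> pointers_ok t \<Longrightarrow> balanced_avl t \<Longrightarrow> first_after x t = (b, c) \<Longrightarrow>
     (case b of None \<Rightarrow> \<forall>k\<in>avl_set t. \<not> x < start k | Some j \<Rightarrow> least_fin {k \<in> avl_set t. x < start k} j) \<and>
     c \<le> ht t + 1"
proof (induction t arbitrary: b c)
  case Tip
  then show ?case by auto
next
  case (Bin l a h m r)
  have less: "\<And>y. y \<in> avl_set l \<Longrightarrow> start y \<le> start a" "\<And>y. y \<in> avl_set r \<Longrightarrow> start a \<le> start y"
    using Bin.prems(1) by (force simp: sorted_wrt_append less_prod_def)+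
  show ?case
  proof (cases "x < start a")
    case True
    obtain b' c' where l: "first_after x l = (b', c')" by fastforce
    have IH: "case b' of None \<Rightarrow> \<forall>k\<in>avl_set l. \<not> x < start k | Some j \<Rightarrow> least_fin {k \<in> avl_set l. x < start k} j"
      "c' \<le> ht l + 1"
      using Bin.IH(1)[OF _ _ _ l] Bin.prems by (auto simp: sorted_wrt_append)
    let ?y = "case b' of None \<Rightarrow> a | Some k \<Rightarrow> if fin k < fin a then k else a"
    have y: "least_fin (insert a {k \<in> avl_set l. x < start k}) ?y"
      using IH(1) by (fastforce simp: least_fin_def split: option.splits)
    have z: "least_fin (insert ?y (avl_set r)) (lower r ?y)"
      by (rule lower_correct) (use Bin.prems in auto)
    have eq: "{k \<in> avl_set (Bin l a h m r). x < start k} = avl_set r \<union> insert a {k \<in> avl_set l. x < start k}"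
      using less(2) True by force
    have "least_fin {k \<in> avl_set (Bin l a h m r). x < start k} (lower r ?y)"
      unfolding eq using least_fin_trans[OF z y] .
    then show ?thesis using Bin.prems l True IH(2) by auto
  next
    case False
    obtain b' c' where r: "first_after x r = (b', c')" by fastforce
    have IH: "case b' of None \<Rightarrow> \<forall>k\<in>avl_set r. \<not> x < start k | Some j \<Rightarrow> least_fin {k \<in> avl_set r. x < start k} j"
      "c' \<le> ht r + 1"
      using Bin.IH(2)[OF _ _ _ r] Bin.prems by (auto simp: sorted_wrt_append)
    have eq: "{k \<in> avl_set (Bin l a h m r). x < start k} = {k \<in> avl_set r. x < start k}"
      using less(1) False by force
    show ?thesis
      using Bin.prems r False IH less(1) unfolding eq by (fastforce split: option.splits)
  qed
qed

lemma right_compatible_correct: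
  assumes "search_tree T" "right_compatible i T = (b, c)"
  shows "b = None \<Longrightarrow> k \<in> avl_set T \<Longrightarrow> \<not> fin i < start k"
    and "b = Some j \<Longrightarrow> least_fin {k \<in> avl_set T. fin i < start k} j"
    and "c \<le> ht T + 1"
  using first_after_correct[of T "fin i" b c] assms by (auto simp: search_tree_def right_compatible_def)

text \<open>The cost bound counts all nodes and leaves of the tree, whatever the output. That is
  enough because the trees to be listed are stores, which hold at most \<open>D\<close>
  intervals.\<close>

lemma elems_le_correct:
  "elems_le x t = (js, c) \<Longrightarrow> sorted_wrt (<) (avl_inorder t) \<Longrightarrow>
     set js = {k \<in> avl_set t. fst k \<le> x} \<and> length js \<le> length (avl_inorder t) \<and>
     c \<le> 2 * length (avl_inorder t) + 1"
proof (induction t arbitrary: js c)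
  case Tip
  then show ?case by auto
next
  case (Bin l a h m r)
  have less: "\<And>y. y \<in> avl_set r \<Longrightarrow> fst a \<le> fst y"
    using Bin.prems(2) by (force simp: sorted_wrt_append less_prod_def)+
  obtain js1 c1 where l: "elems_le x l = (js1, c1)" by fastforce
  obtain js2 c2 where r: "elems_le x r = (js2, c2)" by fastforce
  show ?case
    using Bin.prems Bin.IH(1)[OF l] Bin.IH(2)[OF r] less
    by (force simp: l r sorted_wrt_append split: if_splits)
qed

lemma elems_ge_correct:
  "elems_ge x t = (js, c) \<Longrightarrow> sorted_wrt (<) (avl_inorder t) \<Longrightarrow>
     set js = {k \<in> avl_set t. x \<le> fst k} \<and> length js \<le> length (avl_inorder t) \<and>
     c \<le> 2 * length (avl_inorder t) + 1"
proof (induction t arbitrary: js c)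
  case Tip
  then show ?case by auto
next
  case (Bin l a h m r)
  have less: "\<And>y. y \<in> avl_set l \<Longrightarrow> fst y \<le> fst a"
    using Bin.prems(2) by (force simp: sorted_wrt_append less_prod_def)+
  obtain js1 c1 where l: "elems_ge x l = (js1, c1)" by fastforce
  obtain js2 c2 where r: "elems_ge x r = (js2, c2)" by fastforce
  show ?case
    using Bin.prems Bin.IH(1)[OF l] Bin.IH(2)[OF r] less
    by (force simp: l r sorted_wrt_append split: if_splits)
qed

section \<open>Interval trees\<close>

definition store_ok :: "store \<Rightarrow> bool" where
  "store_ok S \<longleftrightarrow> search_tree (fst S) \<and> search_tree (snd S) \<and> avl_set (snd S) = prod.swap ` avl_set (fst S)"

abbreviation stored :: "entry \<Rightarrow> interval set" where
  "stored e \<equiv> avl_set (fst (snd e))"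

definition contains :: "interval \<Rightarrow> real \<Rightarrow> bool" where
  "contains i x \<longleftrightarrow> start i \<le> x \<and> x \<le> fin i"

definition entry_ok :: "interval set \<Rightarrow> entry \<Rightarrow> bool" where
  "entry_ok J e \<longleftrightarrow> store_ok (snd e) \<and> stored e \<subseteq> J \<and> (\<forall>i\<in>stored e. contains i (split_point e))"

fun intervals :: "itree \<Rightarrow> interval set" where
  "intervals ILeaf = {}"
| "intervals (INode l k e r) = intervals l \<union> stored e \<union> intervals r"

fun points :: "itree \<Rightarrow> endpoint set" where
  "points ILeaf = {}"
| "points (INode l k e r) = insert (fst e) (points l \<union> points r)"

text \<open>The strict inequality for the intervals encodes that each one is stored at the highest
  node whose split point it contains: none stored in a left subtree reaches the split point of an
  ancestor \<open>x\<close>.\<close>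

definition below :: "itree \<Rightarrow> endpoint \<Rightarrow> bool" where
  "below t x \<longleftrightarrow> (\<forall>y\<in>points t. y < x) \<and> (\<forall>i\<in>intervals t. fin i < fst x)"

definition above :: "itree \<Rightarrow> endpoint \<Rightarrow> bool" where
  "above t x \<longleftrightarrow> (\<forall>y\<in>points t. x < y) \<and> (\<forall>i\<in>intervals t. fst x < start i)"

text \<open>\<open>J\<close> is an ambient set and not the set of stored intervals. It stays fixed
  while endpoints and intervals go in and out, and it is what bounds the sizes of the
  stores.\<close>

fun itree_ok :: "interval set \<Rightarrow> itree \<Rightarrow> bool" where
  "itree_ok J ILeaf = True"
| "itree_ok J (INode l k e r) \<longleftrightarrow>
     itree_ok J l \<and> itree_ok J r \<and> entry_ok J e \<and> below l (fst e) \<and> above r (fst e)"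

lemma less_fst: "x < y \<Longrightarrow> fst x \<le> fst y" for x y :: endpoint
  by (auto simp: less_prod_def)

lemma below_ILeaf [simp]: "below ILeaf x" and above_ILeaf [simp]: "above ILeaf x"
  by (auto simp: below_def above_def)

lemma below_INode [simp]:
  "below (INode l k e r) x \<longleftrightarrow>
     below l x \<and> below r x \<and> fst e < x \<and> (\<forall>i\<in>stored e. fin i < fst x)"
  by (auto simp: below_def)

lemma above_INode [simp]:
  "above (INode l k e r) x \<longleftrightarrow>
     above l x \<and> above r x \<and> x < fst e \<and> (\<forall>i\<in>stored e. fst x < start i)"
  by (auto simp: above_def)

lemma below_trans: "below t x \<Longrightarrow> x < y \<Longrightarrow> below t y"
  using less_fst[of x y] by (fastforce simp: below_def)

lemma above_trans: "above t y \<Longrightarrow> x < y \<Longrightarrow> above t x"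
  using less_fst[of x y] by (fastforce simp: above_def)

lemma itree_ok_paint [simp]: "itree_ok J (paint k t) = itree_ok J t"
  and intervals_paint [simp]: "intervals (paint k t) = intervals t"
  and points_paint [simp]: "points (paint k t) = points t"
  by (cases t; simp)+

lemma below_paint [simp]: "below (paint k t) x = below t x"
  and above_paint [simp]: "above (paint k t) x = above t x"
  by (auto simp: below_def above_def)

lemma itree_ok_mono: "itree_ok J t \<Longrightarrow> J \<subseteq> K \<Longrightarrow> itree_ok K t"
  by (induction t) (auto simp: entry_ok_def)

text \<open>Narrows the ambient set at the end of a deletion, when the deleted interval must leave
  it.\<close>

lemma itree_ok_subset: "itree_ok J t \<Longrightarrow> itree_ok (intervals t) t"
proof (induction t)
  case (INode l k e r)
  then have "itree_ok (intervals l) l" "itree_ok (intervals r) r" by auto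
  then show ?case using INode.prems by (auto simp: entry_ok_def intro: itree_ok_mono)
qed simp

lemma itree_ok_intervals: "itree_ok J t \<Longrightarrow> intervals t \<subseteq> J"
  by (induction t) (auto simp: entry_ok_def)

section \<open>Contents and cost of the interval tree operations\<close>

fun icolor :: "itree \<Rightarrow> color" where
  "icolor ILeaf = Black"
| "icolor (INode l k e r) = k"

fun iheight :: "itree \<Rightarrow> nat" where
  "iheight ILeaf = 0"
| "iheight (INode l k e r) = max (iheight l) (iheight r) + 1"

text \<open>One level of a cost recursion: \<open>a\<close> and \<open>b\<close> count levels, each
  of which costs \<open>k\<close>.\<close>

lemma step_cost: "a + 1 \<le> b \<Longrightarrow> a * k + k \<le> b * k" for a b k :: nat
  by (metis Suc_eq_plus1 add.commute mult_Suc mult_le_mono1)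

text \<open>\<open>D\<close> bounds the store of a single node, since its intervals share a split
  point. \<open>w\<close> is an integer logarithm: by \<open>balanced_height\<close> it exceeds the
  height of every store, and twice \<open>w\<close> will exceed the height of the red-black
  tree.\<close>

locale pierced =
  fixes J :: "interval set" and D w :: nat
  assumes finite_J: "finite J"
    and intervals_J: "i \<in> J \<Longrightarrow> start i < fin i"
    and pierce: "card {j \<in> J. contains j x} \<le> D"
    and card_J: "(card J + 1)\<^sup>2 < 2 ^ w"
    and D_pos: "1 \<le> D"
begin

lemma w_pos: "1 \<le> w"
  using card_J by (cases w) auto

lemma search_tree_ht:
  assumes "search_tree t" "avl_set t \<subseteq> J \<or> avl_set t \<subseteq> prod.swap ` J"
  shows "ht t + 1 \<le> w"
proof -
  have "distinct (avl_inorder t)"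
    using assms by (auto simp: search_tree_def strict_sorted_iff)
  then have "length (avl_inorder t) = card (avl_set t)" by (simp add: distinct_card)
  also have "\<dots> \<le> card J"
    using assms(2)
  proof
    assume "avl_set t \<subseteq> prod.swap ` J"
    then have "card (avl_set t) \<le> card (prod.swap ` J)" by (simp add: card_mono finite_J)
    then show ?thesis using card_image_le[OF finite_J, of prod.swap] by linarith
  qed (simp add: card_mono finite_J)
  finally have "(length (avl_inorder t) + 1)\<^sup>2 \<le> (card J + 1)\<^sup>2" by (intro power_mono) auto
  with balanced_height[of t] card_J assms(1) have "(2::nat) ^ ht t < 2 ^ w"
    unfolding search_tree_def by linarith
  then show ?thesis by simp
qed

lemma store_ht:
  assumes "store_ok S" "avl_set (fst S) \<subseteq> J"
  shows "ht (fst S) + 1 \<le> w" "ht (snd S) + 1 \<le> w"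
  using assms by (auto intro!: search_tree_ht[unfolded Suc_eq_plus1[symmetric]] simp: store_ok_def)

lemma store_insert_correct:
  assumes "store_ok S" "avl_set (fst S) \<subseteq> J" "store_insert i S = (S', c)"
  shows "store_ok S'" "avl_set (fst S') = insert i (avl_set (fst S))" "c \<le> 2 * w"
proof -
  obtain A c1 where A: "avl_insert i (fst S) = (A, c1)" by fastforce
  obtain B c2 where B: "avl_insert (prod.swap i) (snd S) = (B, c2)" by fastforce
  have S: "search_tree (fst S)" "search_tree (snd S)" "avl_set (snd S) = prod.swap ` avl_set (fst S)"
    using assms(1) by (auto simp: store_ok_def)
  have eq: "S' = (A, B)" "c = c1 + c2" using assms(3) by (auto simp: store_insert_def A B)
  show "store_ok S'" "avl_set (fst S') = insert i (avl_set (fst S))"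
    using search_tree_insert[OF S(1) A] search_tree_insert[OF S(2) B] S(3) by (auto simp: store_ok_def eq)
  show "c \<le> 2 * w"
    using search_tree_insert(3)[OF S(1) A] search_tree_insert(3)[OF S(2) B] store_ht[OF assms(1,2)] eq by linarith
qed

lemma store_delete_correct:
  assumes "store_ok S" "avl_set (fst S) \<subseteq> J" "store_delete i S = (S', c)"
  shows "store_ok S'" "avl_set (fst S') = avl_set (fst S) - {i}" "c \<le> 2 * w"
proof -
  obtain A c1 where A: "avl_delete i (fst S) = (A, c1)" by fastforce
  obtain B c2 where B: "avl_delete (prod.swap i) (snd S) = (B, c2)" by fastforce
  have S: "search_tree (fst S)" "search_tree (snd S)" "avl_set (snd S) = prod.swap ` avl_set (fst S)"
    using assms(1) by (auto simp: store_ok_def)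
  have eq: "S' = (A, B)" "c = c1 + c2" using assms(3) by (auto simp: store_delete_def A B)
  show "store_ok S'" "avl_set (fst S') = avl_set (fst S) - {i}"
    using search_tree_delete[OF S(1) A] search_tree_delete[OF S(2) B] S(3)
    by (cases i; auto simp: store_ok_def eq)+
  show "c \<le> 2 * w"
    using search_tree_delete(3)[OF S(1) A] search_tree_delete(3)[OF S(2) B] store_ht[OF assms(1,2)] eq by linarith
qed

text \<open>All intervals of an entry contain its split point, so \<open>pierce\<close> bounds their
  number by \<open>D\<close>; listing a whole store costs at most \<open>2 * D + 1\<close>.\<close>

lemma stored_at_correct:
  assumes "entry_ok J e" "stored_at x e = (js, c)"
  shows "set js = {i \<in> stored e. contains i x} \<and> length js \<le> D \<and> c \<le> 2 * D + 1"
proof -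
  obtain p A B where e: "e = (p, A, B)" by (cases e) auto
  have S: "search_tree A" "search_tree B" "avl_set B = prod.swap ` avl_set A"
    "avl_set A \<subseteq> J" "\<forall>i\<in>avl_set A. contains i (fst p)"
    using assms(1) by (auto simp: entry_ok_def store_ok_def e)
  then have dist: "distinct (avl_inorder A)" "distinct (avl_inorder B)"
    by (auto simp: search_tree_def strict_sorted_iff)
  have "card (avl_set A) \<le> card {j \<in> J. contains j (fst p)}"
    using S finite_J by (intro card_mono) auto
  then have card: "card (avl_set A) \<le> D" using pierce[of "fst p"] by linarith
  have "card (avl_set B) = card (avl_set A)" unfolding S(3) by (intro card_image) auto
  then have len: "length (avl_inorder A) \<le> D" "length (avl_inorder B) \<le> D"
    using card dist by (auto simp: distinct_card)
  show ?thesis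
  proof (cases "x \<le> fst p")
    case True
    then have "elems_le x A = (js, c)" using assms(2) by (simp add: stored_at_def e)
    from elems_le_correct[OF this] S len True
    show ?thesis
      by (auto simp: search_tree_def e contains_def)
  next
    case False
    obtain ks where ks: "elems_ge x B = (ks, c)" "js = map prod.swap ks"
      using assms(2) False by (auto simp: stored_at_def e split: prod.splits)
    have "set js = {i \<in> avl_set A. x \<le> fin i}"
      using elems_ge_correct[OF ks(1)] S ks(2) by (force simp: search_tree_def image_iff)
    then show ?thesis
      using elems_ge_correct[OF ks(1)] S len False ks(2)
      by (auto simp: search_tree_def e contains_def)
  qed
qed

text \<open>Each moved interval costs a deletion and an insertion, \<open>2 * w\<close> each, and
  the visit of its list cell.\<close>

lemma move_all_correct:
  "move_all js S S' = ((T, T'), c) \<Longrightarrow> store_ok S \<Longrightarrow> store_ok S' \<Longrightarrow> avl_set (fst S) \<subseteq> J \<Longrightarrow>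
   avl_set (fst S') \<subseteq> J \<Longrightarrow> set js \<subseteq> J \<Longrightarrow>
     store_ok T \<and> store_ok T' \<and> avl_set (fst T) = avl_set (fst S) - set js \<and>
     avl_set (fst T') = avl_set (fst S') \<union> set js \<and> c \<le> length js * (4 * w + 1) + 1"
proof (induction js arbitrary: S S' c)
  case Nil
  then show ?case by auto
next
  case (Cons j js)
  obtain S1 c1 where S1: "store_delete j S = (S1, c1)" by fastforce
  obtain S2 c2 where S2: "store_insert j S' = (S2, c2)" by fastforce
  obtain c3 where c3: "move_all js S1 S2 = ((T, T'), c3)" "c = c1 + c2 + c3 + 1"
    using Cons.prems(1) S1 S2 by (auto split: prod.splits)
  note d = store_delete_correct[OF Cons.prems(2,4) S1] and i = store_insert_correct[OF Cons.prems(3,5) S2]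
  have "store_ok T \<and> store_ok T' \<and> avl_set (fst T) = avl_set (fst S1) - set js \<and>
     avl_set (fst T') = avl_set (fst S2) \<union> set js \<and> c3 \<le> length js * (4 * w + 1) + 1"
    by (rule Cons.IH[OF c3(1) d(1) i(1)]) (use d i Cons.prems in auto)
  then show ?case using d i c3(2) by auto
qed

lemma lift_correct:
  assumes "entry_ok J b" "entry_ok J e" "lift b e = ((b', e'), c)"
  shows "fst b' = fst b \<and> fst e' = fst e \<and> entry_ok J b' \<and> entry_ok J e' \<and>
    stored b' = stored b \<union> {i \<in> stored e. contains i (split_point b)} \<and>
    stored e' = {i \<in> stored e. \<not> contains i (split_point b)} \<and>
    c \<le> D * (4 * w + 5)"
proof -
  obtain js c1 where js: "stored_at (split_point b) e = (js, c1)" by fastforce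
  obtain S S' c2 where S: "move_all js (snd e) (snd b) = ((S, S'), c2)" by (metis prod.collapse)
  have eq: "b' = (fst b, S')" "e' = (fst e, S)" "c = c1 + c2"
    using assms(3) by (auto simp: lift_def js S)
  note a = stored_at_correct[OF assms(2) js]
  have ok: "store_ok (snd e)" "store_ok (snd b)" "stored e \<subseteq> J" "stored b \<subseteq> J"
    using assms by (auto simp: entry_ok_def)
  have m: "store_ok S \<and> store_ok S' \<and> avl_set (fst S) = stored e - set js \<and>
     avl_set (fst S') = stored b \<union> set js \<and> c2 \<le> length js * (4 * w + 1) + 1"
    by (rule move_all_correct[OF S]) (use ok a in auto)
  have "length js * (4 * w + 1) \<le> D * (4 * w + 1)" using a by (intro mult_right_mono) auto
  then have "c \<le> D * (4 * w + 3) + 2" using m a eq by (simp add: algebra_simps)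
  also have "\<dots> \<le> D * (4 * w + 5)" using D_pos by (simp add: algebra_simps)
  finally show ?thesis
    using m a eq assms by (auto simp: entry_ok_def)
qed

text \<open>The cost of one rotation: two lifts at \<open>D * (4 * w + 5)\<close> each, plus the
  visit itself, which a further \<open>D\<close> absorbs because \<open>1 \<le> D\<close>.\<close>

definition R :: nat where "R = D * (8 * w + 11)"

lemma R_ge: "2 * D + 1 \<le> R" "2 * (D * (4 * w + 5)) + 1 \<le> R"
  using D_pos by (auto simp: R_def algebra_simps)

lemma R1: "1 \<le> R"
  using R_ge(1) by linarith

text \<open>An interval left at \<open>a\<close> contains the split point of \<open>a\<close> but
  not that of \<open>b\<close>, which is at least as large; so it ends before the latter. The
  situation at \<open>e\<close> is symmetric. This is what \<open>below\<close> and
  \<open>above\<close> ask for once \<open>a\<close> and \<open>e\<close> have become children of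
  \<open>b\<close>.\<close>

lemma lift2_correct:
  assumes "lift2 a b e = ((a', b', e'), c)" "entry_ok J a" "entry_ok J b" "entry_ok J e"
    and ord: "fst a < fst b" "fst b < fst e"
  shows "fst a' = fst a \<and> fst b' = fst b \<and> fst e' = fst e \<and>
    entry_ok J a' \<and> entry_ok J b' \<and> entry_ok J e' \<and>
    (\<forall>i\<in>stored a'. fin i < split_point b) \<and> (\<forall>i\<in>stored e'. split_point b < start i) \<and>
    stored a' \<subseteq> stored a \<and> stored e' \<subseteq> stored e \<and> stored a' \<union> stored b' \<union> stored e' = stored a \<union> stored b \<union> stored e \<and>
    c + 1 \<le> R"
proof -
  obtain b1 a1 c1 where 1: "lift b a = ((b1, a1), c1)" by (metis prod.collapse)
  obtain b2 e1 c2 where 2: "lift b1 e = ((b2, e1), c2)" by (metis prod.collapse)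
  note l1 = lift_correct[OF assms(3,2) 1]
  note l2 = lift_correct[OF _ assms(4) 2]
  have eq: "a' = a1" "b' = b2" "e' = e1" "c = c1 + c2" using assms(1) by (auto simp: lift2_def 1 2)
  have sa: "stored a' = {i \<in> stored a. \<not> contains i (split_point b)}" and
    se: "stored e' = {i \<in> stored e. \<not> contains i (split_point b)}"
    using l1 l2 unfolding eq by auto
  have "\<forall>i\<in>stored a'. fin i < split_point b"
    using assms(2) less_fst[OF ord(1)] unfolding sa entry_ok_def contains_def by fastforce
  moreover have "\<forall>i\<in>stored e'. split_point b < start i"
    using assms(4) less_fst[OF ord(2)] unfolding se entry_ok_def contains_def by fastforce
  moreover have "c + 1 \<le> R" using l1 l2 R_ge(2) unfolding eq by linarith
  ultimately show ?thesis using l1 l2 unfolding eq by auto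
qed

text \<open>Shape and colours are free to change. \<open>below\<close> and \<open>above\<close>
  depend only on the contents, so they carry over to the surrounding tree; see
  \<open>rebuilt_below\<close> and \<open>rebuilt_above\<close>.\<close>

definition rebuilt :: "itree \<Rightarrow> itree \<times> nat \<Rightarrow> bool" where
  "rebuilt t r \<longleftrightarrow> itree_ok J (fst r) \<and> intervals (fst r) = intervals t \<and> points (fst r) = points t"

text \<open>The tree on the left merely records the contents: before the rotation the three entries
  may be nested in any of several ways, and \<open>rebuilt\<close> cannot tell these apart. The
  order conditions are those on the four subtrees and the three entries.\<close>

lemma rotate_correct:
  assumes ok: "itree_ok J t1" "itree_ok J t2" "itree_ok J t3" "itree_ok J t4"
      "entry_ok J a" "entry_ok J b" "entry_ok J e"
    and ord: "below t1 (fst a)" "above t2 (fst a)" "below t2 (fst b)" "above t3 (fst b)"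
      "below t3 (fst e)" "above t4 (fst e)" "fst a < fst b" "fst b < fst e"
  shows "rebuilt (INode (INode t1 k a t2) k b (INode t3 k e t4)) (rotate k' t1 a t2 b t3 e t4) \<and>
    snd (rotate k' t1 a t2 b t3 e t4) \<le> R"
proof
  obtain a' b' e' c where l: "lift2 a b e = ((a', b', e'), c)" by (metis prod.collapse)
  note L = lift2_correct[OF l ok(5,6,7) ord(7,8)]
  show "rebuilt (INode (INode t1 k a t2) k b (INode t3 k e t4)) (rotate k' t1 a t2 b t3 e t4)"
    using ok ord L below_trans[OF ord(1,7)] above_trans[OF ord(6,8)]
    by (auto simp: rotate_def l rebuilt_def)
  show "snd (rotate k' t1 a t2 b t3 e t4) \<le> R"
    using L by (simp add: rotate_def l)
qed

lemma baliL_correct: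
  assumes "itree_ok J (INode l k e r)"
  shows "rebuilt (INode l k e r) (baliL l e r) \<and> snd (baliL l e r) \<le> R"
proof -
  consider t1 a t2 b t3 where "l = RNode (RNode t1 a t2) b t3" "baliL l e r = rotate Black t1 a t2 b t3 e r"
    | t1 a t2 b t3 where "l = RNode t1 a (RNode t2 b t3)" "baliL l e r = rotate Black t1 a t2 b t3 e r"
    | "baliL l e r = (BNode l e r, 1)"
    by (cases "(l, e, r)" rule: baliL.cases) auto
  then show ?thesis
  proof cases
    case (1 t1 a t2 b t3)
    then show ?thesis
      using rotate_correct[of t1 t2 t3 r a b e k Black] assms by (auto simp: rebuilt_def)
  next
    case (2 t1 a t2 b t3)
    then show ?thesis
      using rotate_correct[of t1 t2 t3 r a b e k Black] assms by (auto simp: rebuilt_def)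
  next
    case 3
    then show ?thesis using assms R_ge D_pos by (auto simp: rebuilt_def)
  qed
qed

lemma baliR_correct:
  assumes "itree_ok J (INode l k e r)"
  shows "rebuilt (INode l k e r) (baliR l e r) \<and> snd (baliR l e r) \<le> R"
proof -
  consider t2 b t3 a t4 where "r = RNode t2 b (RNode t3 a t4)" "baliR l e r = rotate Black l e t2 b t3 a t4"
    | t2 b t3 a t4 where "r = RNode (RNode t2 b t3) a t4" "baliR l e r = rotate Black l e t2 b t3 a t4"
    | "baliR l e r = (BNode l e r, 1)"
    by (cases "(l, e, r)" rule: baliR.cases) auto
  then show ?thesis
  proof cases
    case (1 t2 b t3 a t4)
    then show ?thesis
      using rotate_correct[of l t2 t3 t4 e b a k Black] assms by (auto simp: rebuilt_def)
  next
    case (2 t2 b t3 a t4)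
    then show ?thesis
      using rotate_correct[of l t2 t3 t4 e b a k Black] assms by (auto simp: rebuilt_def)
  next
    case 3
    then show ?thesis using assms R_ge D_pos by (auto simp: rebuilt_def)
  qed
qed

lemma rebuilt_below: "rebuilt t r \<Longrightarrow> below (fst r) x = below t x"
  and rebuilt_above: "rebuilt t r \<Longrightarrow> above (fst r) x = above t x"
  by (simp_all add: rebuilt_def below_def above_def)

text \<open>At most one \<open>lift2\<close> and one \<open>baliR\<close>, with cost at most
  \<open>R\<close> each.\<close>

lemma baldL_correct:
  assumes "itree_ok J (INode l k e r)"
  shows "rebuilt (INode l k e r) (baldL l e r) \<and> snd (baldL l e r) \<le> 2 * R"
proof -
  consider t1 a t2 where "l = RNode t1 a t2" "baldL l e r = (RNode (BNode t1 a t2) e r, 1)"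
    | t2 b t3 where "r = BNode t2 b t3" "baldL l e r = baliR l e (RNode t2 b t3)"
    | t2 b t3 a t4 where "r = RNode (BNode t2 b t3) a t4"
        "baldL l e r = (let ((a', b', e'), c) = lift2 e b a; (t, c') = baliR t3 e' (paint Red t4)
          in (RNode (BNode l a' t2) b' t, c + c'))"
    | "baldL l e r = (RNode l e r, 1)"
    by (cases "(l, e, r)" rule: baldL.cases) auto
  then show ?thesis
  proof cases
    case (1 t1 a t2)
    then show ?thesis using assms R_ge D_pos by (auto simp: rebuilt_def)
  next
    case (2 t2 b t3)
    then show ?thesis
      using baliR_correct[of l k e "RNode t2 b t3"] assms by (auto simp: rebuilt_def)
  next
    case (3 t2 b t3 a t4)
    obtain e' b' a' c where l: "lift2 e b a = ((e', b', a'), c)" by (metis prod.collapse)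
    obtain t c' where t: "baliR t3 a' (paint Red t4) = (t, c')" by fastforce
    have ok: "entry_ok J e" "entry_ok J b" "entry_ok J a" "fst e < fst b" "fst b < fst a"
      using assms 3 by auto
    note L = lift2_correct[OF l ok]
    have "itree_ok J (INode t3 k a' (paint Red t4))" using assms 3 L by auto
    from baliR_correct[OF this] have t': "rebuilt (INode t3 k a' t4) (t, c')" "c' \<le> R"
      by (auto simp: t rebuilt_def)
    have "above t (fst b)"
      using rebuilt_above[OF t'(1), of "fst b"] assms 3 L above_trans[OF _ ok(5), of t4] by auto
    moreover have "below l (fst b)" using assms 3 below_trans[OF _ ok(4), of l] by auto
    ultimately show ?thesis
      using t' L assms 3 by (auto simp: l t rebuilt_def)
  next
    case 4
    then show ?thesis using assms R_ge D_pos by (auto simp: rebuilt_def)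
  qed
qed

lemma baldR_correct:
  assumes "itree_ok J (INode l k e r)"
  shows "rebuilt (INode l k e r) (baldR l e r) \<and> snd (baldR l e r) \<le> 2 * R"
proof -
  consider t1 a t2 where "r = RNode t1 a t2" "baldR l e r = (RNode l e (BNode t1 a t2), 1)"
    | t1 a t2 where "l = BNode t1 a t2" "baldR l e r = baliL (RNode t1 a t2) e r"
    | t1 a t2 b t3 where "l = RNode t1 a (BNode t2 b t3)"
        "baldR l e r = (let ((a', b', e'), c) = lift2 a b e; (t, c') = baliL (paint Red t1) a' t2
          in (RNode t b' (BNode t3 e' r), c + c'))"
    | "baldR l e r = (RNode l e r, 1)"
    by (cases "(l, e, r)" rule: baldR.cases) auto
  then show ?thesis
  proof cases
    case (1 t1 a t2)
    then show ?thesis using assms R_ge D_pos by (auto simp: rebuilt_def)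
  next
    case (2 t1 a t2)
    then show ?thesis
      using baliL_correct[of "RNode t1 a t2" k e r] assms by (auto simp: rebuilt_def)
  next
    case (3 t1 a t2 b t3)
    obtain a' b' e' c where l: "lift2 a b e = ((a', b', e'), c)" by (metis prod.collapse)
    obtain t c' where t: "baliL (paint Red t1) a' t2 = (t, c')" by fastforce
    have ok: "entry_ok J a" "entry_ok J b" "entry_ok J e" "fst a < fst b" "fst b < fst e"
      using assms 3 by auto
    note L = lift2_correct[OF l ok]
    have "itree_ok J (INode (paint Red t1) k a' t2)" using assms 3 L by auto
    from baliL_correct[OF this] have t': "rebuilt (INode t1 k a' t2) (t, c')" "c' \<le> R"
      by (auto simp: t rebuilt_def)
    have "below t (fst b)"
      using rebuilt_below[OF t'(1), of "fst b"] assms 3 L below_trans[OF _ ok(4), of t1] by auto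
    moreover have "above r (fst b)" using assms 3 above_trans[OF _ ok(5), of r] by auto
    ultimately show ?thesis
      using t' L assms 3 by (auto simp: l t rebuilt_def)
  next
    case 4
    then show ?thesis using assms R_ge D_pos by (auto simp: rebuilt_def)
  qed
qed

text \<open>\<open>z\<close> is the deleted endpoint. It separates the two trees, and comparing both
  sides with it gives the order between an entry of one tree and the contents of the other. Every
  call descends in at least one of the trees and costs at most \<open>2 * R\<close>, so the sum of
  the heights bounds the number of levels.\<close>

lemma ijoin_correct:
  assumes "itree_ok J l" "itree_ok J r" "below l z" "above r z"
  shows "itree_ok J (fst (ijoin l r)) \<and> intervals (fst (ijoin l r)) = intervals l \<union> intervals r \<and>
    points (fst (ijoin l r)) = points l \<union> points r \<and>
    snd (ijoin l r) \<le> (iheight l + iheight r + 1) * (2 * R)"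
  using assms
proof (induction "size l + size r" arbitrary: l r rule: less_induct)
  case less
  consider "l = ILeaf" | "r = ILeaf"
    | k t1 a t2 t3 e t4 where "l = INode t1 k a t2" "r = INode t3 k e t4"
    | t1 a t2 t3 e t4 where "l = BNode t1 a t2" "r = RNode t3 e t4"
    | t1 a t2 t3 e t4 where "l = RNode t1 a t2" "r = BNode t3 e t4"
    by (metis color.exhaust itree.exhaust)
  then show ?case
  proof cases
    case 1
    then show ?thesis using less.prems R1 by simp
  next
    case 2
    then show ?thesis using less.prems R1 by (cases l) auto
  next
    case (3 k t1 a t2 t3 e t4)
    obtain t c where t: "ijoin t2 t3 = (t, c)" by fastforce
    have ord: "fst a < z" "z < fst e" using less.prems 3 by auto
    have "below t2 z" "above t3 z" using less.prems 3 by auto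
    with less.hyps[of t2 t3] less.prems 3 have IH:
      "itree_ok J t" "intervals t = intervals t2 \<union> intervals t3" "points t = points t2 \<union> points t3"
      "c \<le> (iheight t2 + iheight t3 + 1) * (2 * R)"
      by (auto simp: t)
    have ae: "above t (fst a)" "below t (fst e)"
      using less.prems 3 IH above_trans[OF \<open>above t3 z\<close> ord(1)] below_trans[OF \<open>below t2 z\<close> ord(2)]
      by (auto simp: above_def below_def)
    have "(iheight t2 + iheight t3 + 1) * (2 * R) + 2 * R \<le> (iheight l + iheight r + 1) * (2 * R)"
      by (rule step_cost) (use 3 in auto)
    then have cost: "c + 2 * R \<le> (iheight l + iheight r + 1) * (2 * R)" using IH(4) by linarith
    show ?thesis
    proof (cases "\<exists>u2 b u3. t = RNode u2 b u3")
      case True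
      then obtain u2 b u3 where u: "t = RNode u2 b u3" by blast
      obtain t' c' where t': "rotate k t1 a u2 b u3 e t4 = (t', c')" by fastforce
      have "ijoin l r = (t', c + c')" using 3 t u t' by (cases k) auto
      moreover have "rebuilt (INode (INode t1 k a u2) k b (INode u3 k e t4)) (t', c') \<and> c' \<le> R"
        using rotate_correct[of t1 u2 u3 t4 a b e k k] less.prems 3 IH ae by (auto simp: t' u)
      ultimately show ?thesis using IH cost 3 by (auto simp: rebuilt_def u)
    next
      case False
      have "above t4 (fst a)" using less.prems 3 above_trans[OF _ ord(1)] by simp
      \<comment> \<open>The intervals stored at \<open>e\<close> start beyond \<open>z\<close>,
        whose first component is at least the split point of \<open>a\<close>.\<close>
      moreover have "split_point a < start i" if "i \<in> stored e" for i
        using that less.prems 3 less_fst[OF ord(1)] by force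
      ultimately have node: "itree_ok J (INode t1 k a (INode t k' e t4))" for k'
        using less.prems 3 IH ae ord by simp
      show ?thesis
      proof (cases k)
        case Red
        have "ijoin l r = (RNode t1 a (RNode t e t4), c + 1)"
          using 3 t False Red by (cases t; cases "icolor t") (auto split: color.splits)
        then show ?thesis using IH cost 3 node R1 by auto
      next
        case Black
        obtain t' c' where t': "baldL t1 a (BNode t e t4) = (t', c')" by fastforce
        have "ijoin l r = (t', c + c')"
          using 3 t t' False Black by (cases t; cases "icolor t") (auto split: color.splits)
        then show ?thesis
          using baldL_correct[OF node[of Black]] IH cost 3 by (auto simp: rebuilt_def t')
      qed
    qed
  next
    case (4 t1 a t2 t3 e t4)
    obtain t c where t: "ijoin l t3 = (t, c)" by fastforce
    have IH: "itree_ok J t" "intervals t = intervals l \<union> intervals t3" "points t = points l \<union> points t3"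
      "c \<le> (iheight l + iheight t3 + 1) * (2 * R)"
      using less.hyps[of l t3] less.prems 4(2) by (auto simp: t)
    have ij: "ijoin l r = (RNode t e t4, c + 1)" using t 4 by simp
    have "below t (fst e)"
      using IH below_trans[of l z "fst e"] less.prems 4(2) by (auto simp: below_def)
    moreover have "(iheight l + iheight t3 + 1) * (2 * R) + 2 * R \<le> (iheight l + iheight r + 1) * (2 * R)"
      by (rule step_cost) (use 4(2) in auto)
    ultimately show ?thesis unfolding ij prod.sel using IH R1 less.prems 4(2)
      by (intro conjI; (linarith | auto))
  next
    case (5 t1 a t2 t3 e t4)
    obtain t c where t: "ijoin t2 r = (t, c)" by fastforce
    have IH: "itree_ok J t" "intervals t = intervals t2 \<union> intervals r" "points t = points t2 \<union> points r"
      "c \<le> (iheight t2 + iheight r + 1) * (2 * R)"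
      using less.hyps[of t2 r] less.prems 5(1) by (auto simp: t)
    have ij: "ijoin l r = (RNode t1 a t, c + 1)" using t 5 by simp
    have "above t (fst a)"
      using IH above_trans[of r z "fst a"] less.prems 5(1) by (auto simp: above_def)
    moreover have "(iheight t2 + iheight r + 1) * (2 * R) + 2 * R \<le> (iheight l + iheight r + 1) * (2 * R)"
      by (rule step_cost) (use 5(1) in auto)
    ultimately show ?thesis unfolding ij prod.sel using IH R1 less.prems 5(1)
      by (intro conjI; (linarith | auto))
  qed
qed

lemma endpoint_ins_correct:
  "itree_ok J t \<Longrightarrow> endpoint_ins x t = (t', c) \<Longrightarrow>
     itree_ok J t' \<and> intervals t' = intervals t \<and> points t' = insert x (points t) \<and>
     c \<le> (iheight t + 1) * R"
proof (induction t arbitrary: t' c)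
  case ILeaf
  then show ?case using R_ge(1) D_pos
    by (auto simp: entry_ok_def store_ok_def search_tree_def)
next
  case (INode l k e r)
  have sub: "itree_ok J l" "itree_ok J r" using INode.prems by simp_all
  consider "x = fst e" | "x \<noteq> fst e" "x < fst e" | "x \<noteq> fst e" "\<not> x < fst e" "fst e < x" by force
  then show ?case
  proof cases
    case 1
    then show ?thesis using INode.prems R1 by auto
  next
    case 2
    obtain l' c1 where l': "endpoint_ins x l = (l', c1)" by fastforce
    note IH = INode.IH(1)[OF sub(1) l']
    have ok: "itree_ok J (INode l' k e r)" using INode.prems IH 2 by (auto simp: below_def)
    obtain c2 where "rebuilt (INode l' k e r) (t', c2)" "c2 \<le> R" "c = c1 + c2"
      using baliL_correct[OF ok] INode.prems(2) 2 l' ok R1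
      by (auto simp: rebuilt_def split: if_splits prod.splits)
    moreover have "(iheight l + 1) * R + R \<le> (iheight (INode l k e r) + 1) * R"
      by (rule step_cost) simp
    ultimately show ?thesis using IH unfolding rebuilt_def by - (elim conjE, intro conjI; (linarith | auto simp: rebuilt_def))
  next
    case 3
    obtain r' c1 where r': "endpoint_ins x r = (r', c1)" by fastforce
    note IH = INode.IH(2)[OF sub(2) r']
    have ok: "itree_ok J (INode l k e r')" using INode.prems IH 3 by (auto simp: above_def)
    obtain c2 where "rebuilt (INode l k e r') (t', c2)" "c2 \<le> R" "c = c1 + c2"
      using baliR_correct[OF ok] INode.prems(2) 3 r' ok R1
      by (auto simp: rebuilt_def split: if_splits prod.splits)
    moreover have "(iheight r + 1) * R + R \<le> (iheight (INode l k e r) + 1) * R"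
      by (rule step_cost) simp
    ultimately show ?thesis using IH unfolding rebuilt_def by - (elim conjE, intro conjI; (linarith | auto simp: rebuilt_def))
  qed
qed

text \<open>Each level of the descent costs at most \<open>2 * R\<close>. At the node that is found,
  \<open>ijoin\<close> descends in both subtrees, whose heights add up; hence the factor 2 before
  \<open>iheight t\<close>.\<close>

lemma endpoint_del_correct:
  "itree_ok J t \<Longrightarrow> endpoint_del x t = ((t', js), c) \<Longrightarrow>
     itree_ok J t' \<and> intervals t' \<union> set js = intervals t \<and> points t' = points t - {x} \<and>
     length js \<le> D \<and> c \<le> (2 * iheight t + 1) * (2 * R)"
proof (induction t arbitrary: t' js c)
  case ILeaf
  then show ?case using R_ge(1) D_pos by auto
next
  case (INode l k e r)
  have sub: "itree_ok J l" "itree_ok J r" using INode.prems by simp_all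
  consider "x = fst e" | "x \<noteq> fst e" "x < fst e" | "x \<noteq> fst e" "\<not> x < fst e" "fst e < x" by force
  then show ?case
  proof cases
    case 1
    obtain u c1 where u: "ijoin l r = (u, c1)" by fastforce
    obtain ks c2 where ks: "stored_at (split_point e) e = (ks, c2)" by fastforce
    have eq: "t' = u" "js = ks" "c = c1 + c2" using INode.prems(2) 1 u ks by auto
    have e: "entry_ok J e" using INode.prems by simp
    \<comment> \<open>Asked at its own split point, an entry returns everything that it
      stores.\<close>
    have "set ks = stored e"
      using stored_at_correct[OF e ks] e by (auto simp: entry_ok_def)
    moreover have "itree_ok J u \<and> intervals u = intervals l \<union> intervals r \<and> points u = points l \<union> points r \<and>
      c1 \<le> (iheight l + iheight r + 1) * (2 * R)"
      using ijoin_correct[of l r "fst e"] INode.prems u by simp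
    moreover have "x \<notin> points l" "x \<notin> points r" using INode.prems 1 by (auto simp: below_def above_def)
    moreover have "(iheight l + iheight r + 1) * (2 * R) + R \<le> (2 * iheight (INode l k e r) + 1) * (2 * R)"
    proof -
      have "(iheight l + iheight r + 2) * (2 * R) \<le> (2 * iheight (INode l k e r) + 1) * (2 * R)"
        by (intro mult_right_mono) auto
      then show ?thesis by (simp add: algebra_simps)
    qed
    ultimately show ?thesis using stored_at_correct[OF e ks] R_ge(1) 1 by (auto simp: eq)
  next
    case 2
    obtain l' ks c1 where l': "endpoint_del x l = ((l', ks), c1)" by (metis prod.collapse)
    note IH = INode.IH(1)[OF sub(1) l']
    have ok: "itree_ok J (INode l' k e r)" using INode.prems IH 2 by (auto simp: below_def)
    obtain c2 where c2: "rebuilt (INode l' k e r) (t', c2)" "c2 \<le> 2 * R" "c = c1 + c2" "js = ks"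
      using baldL_correct[OF ok] INode.prems(2) 2 l' ok R1
      by (auto simp: rebuilt_def split: if_splits prod.splits)
    have "x \<notin> points r" using INode.prems 2 by (auto simp: above_def)
    moreover have "(2 * iheight l + 1) * (2 * R) + 2 * R \<le> (2 * iheight (INode l k e r) + 1) * (2 * R)"
      by (rule step_cost) simp
    ultimately show ?thesis using IH c2 2 unfolding rebuilt_def by - (elim conjE, intro conjI; (linarith | auto simp: rebuilt_def))
  next
    case 3
    obtain r' ks c1 where r': "endpoint_del x r = ((r', ks), c1)" by (metis prod.collapse)
    note IH = INode.IH(2)[OF sub(2) r']
    have ok: "itree_ok J (INode l k e r')" using INode.prems IH 3 by (auto simp: above_def)
    obtain c2 where c2: "rebuilt (INode l k e r') (t', c2)" "c2 \<le> 2 * R" "c = c1 + c2" "js = ks"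
      using baldR_correct[OF ok] INode.prems(2) 3 r' ok R1
      by (auto simp: rebuilt_def split: if_splits prod.splits)
    have "x \<notin> points l" using INode.prems 3 by (auto simp: below_def)
    moreover have "(2 * iheight r + 1) * (2 * R) + 2 * R \<le> (2 * iheight (INode l k e r) + 1) * (2 * R)"
      by (rule step_cost) simp
    ultimately show ?thesis using IH c2 3 unfolding rebuilt_def by - (elim conjE, intro conjI; (linarith | auto simp: rebuilt_def))
  qed
qed

text \<open>The witness \<open>x\<close> keeps the search from ending in a leaf: it stays in the
  subtree that is entered, until a split point inside \<open>i\<close> is met.\<close>

lemma place_correct:
  "itree_ok J t \<Longrightarrow> i \<in> J \<Longrightarrow> x \<in> points t \<Longrightarrow> contains i (fst x) \<Longrightarrow> place i t = (t', c) \<Longrightarrow>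
     itree_ok J t' \<and> intervals t' = insert i (intervals t) \<and> points t' = points t \<and>
     c \<le> iheight t + 2 * w + 1"
proof (induction t arbitrary: t' c)
  case ILeaf
  then show ?case by simp
next
  case (INode l k e r)
  have sub: "itree_ok J l" "itree_ok J r" using INode.prems by simp_all
  consider "fin i < split_point e" | "\<not> fin i < split_point e" "split_point e < start i"
    | "\<not> fin i < split_point e" "\<not> split_point e < start i" by blast
  then show ?case
  proof cases
    case 1
    obtain l' c1 where l': "place i l = (l', c1)" by fastforce
    have "x \<in> points l"
      using INode.prems 1 less_fst[of "fst e" x] by (auto simp: above_def contains_def)
    note IH = INode.IH(1)[OF sub(1) INode.prems(2) this INode.prems(4) l']
    then show ?thesis using INode.prems 1 l' IH by (auto simp: below_def)
  next
    case 2
    obtain r' c1 where r': "place i r = (r', c1)" by fastforce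
    have "x \<in> points r"
      using INode.prems 2 less_fst[of x "fst e"] by (auto simp: below_def contains_def)
    note IH = INode.IH(2)[OF sub(2) INode.prems(2) this INode.prems(4) r']
    then show ?thesis using INode.prems 2 r' IH by (auto simp: above_def)
  next
    case 3
    obtain S c1 where S: "store_insert i (snd e) = (S, c1)" by fastforce
    have "store_ok (snd e)" "stored e \<subseteq> J" using INode.prems by (auto simp: entry_ok_def)
    note s = store_insert_correct[OF this S]
    then show ?thesis using INode.prems 3 S by (auto simp: entry_ok_def contains_def)
  qed
qed

text \<open>\<open>below\<close> and \<open>above\<close> leave only one place for \<open>i\<close>,
  namely the first node on the way down whose split point it contains; so it has to be looked for
  nowhere else.\<close>

lemma unplace_correct:
  "itree_ok J t \<Longrightarrow> unplace i t = (t', c) \<Longrightarrow> start i < fin i \<Longrightarrow>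
     itree_ok J t' \<and> intervals t' = intervals t - {i} \<and> points t' = points t \<and>
     c \<le> iheight t + 2 * w + 1"
proof (induction t arbitrary: t' c)
  case ILeaf
  then show ?case by simp
next
  case (INode l k e r)
  have sub: "itree_ok J l" "itree_ok J r" using INode.prems by simp_all
  consider "fin i < split_point e" | "\<not> fin i < split_point e" "split_point e < start i"
    | "\<not> fin i < split_point e" "\<not> split_point e < start i" by blast
  then show ?case
  proof cases
    case 1
    obtain l' c1 where l': "unplace i l = (l', c1)" by fastforce
    note IH = INode.IH(1)[OF sub(1) l' INode.prems(3)]
    have "i \<notin> stored e" "i \<notin> intervals r"
      using INode.prems 1 by (auto simp: above_def entry_ok_def contains_def)
    then show ?thesis using INode.prems 1 l' IH by (auto simp: below_def)
  next
    case 2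
    obtain r' c1 where r': "unplace i r = (r', c1)" by fastforce
    note IH = INode.IH(2)[OF sub(2) r' INode.prems(3)]
    have "i \<notin> stored e" "i \<notin> intervals l"
      using INode.prems 2 by (auto simp: below_def entry_ok_def contains_def)
    then show ?thesis using INode.prems 2 r' IH by (auto simp: above_def)
  next
    case 3
    obtain S c1 where S: "store_delete i (snd e) = (S, c1)" by fastforce
    have "store_ok (snd e)" "stored e \<subseteq> J" using INode.prems by (auto simp: entry_ok_def)
    note s = store_delete_correct[OF this S]
    have "i \<notin> intervals r" "i \<notin> intervals l"
      using INode.prems 3 by (auto simp: below_def above_def)
    then show ?thesis using INode.prems 3 S s by (auto simp: entry_ok_def contains_def)
  qed
qed

lemma iheight_place: "place i t = (t', c) \<Longrightarrow> iheight t' = iheight t"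
  by (induction t arbitrary: t' c) (auto split: if_splits prod.splits)

lemma place_all_correct:
  "itree_ok J t \<Longrightarrow> set js \<subseteq> J \<Longrightarrow> (\<And>i. i \<in> set js \<Longrightarrow> \<exists>x\<in>points t. contains i (fst x)) \<Longrightarrow>
   place_all js t = (t', c) \<Longrightarrow>
     itree_ok J t' \<and> intervals t' = set js \<union> intervals t \<and> points t' = points t \<and>
     c \<le> length js * (iheight t + 2 * w + 2) + 1"
proof (induction js arbitrary: t t' c)
  case Nil
  then show ?case by simp
next
  case (Cons j js)
  obtain t1 c1 where t1: "place j t = (t1, c1)" by fastforce
  obtain c2 where c2: "place_all js t1 = (t', c2)" "c = c1 + c2 + 1"
    using Cons.prems(4) t1 by (auto split: prod.splits)
  obtain x where "x \<in> points t" "contains j (fst x)" using Cons.prems(3) by (meson list.set_intros(1))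
  from place_correct[OF Cons.prems(1) _ this t1] Cons.prems(2)
  have p: "itree_ok J t1 \<and> intervals t1 = insert j (intervals t) \<and> points t1 = points t \<and>
     c1 \<le> iheight t + 2 * w + 1" by simp
  have "itree_ok J t' \<and> intervals t' = set js \<union> intervals t1 \<and> points t' = points t1 \<and>
     c2 \<le> length js * (iheight t1 + 2 * w + 2) + 1"
    by (rule Cons.IH[OF _ _ _ c2(1)]) (use p Cons.prems in auto)
  then show ?case using p c2(2) iheight_place[OF t1] by auto
qed

text \<open>All intervals on the side of the split point away from \<open>x\<close> end before or
  start after the split point on that side, so a single path is followed. Each node on it costs at
  most \<open>2 * D + 2\<close>.\<close>

lemma stab_correct:
  "itree_ok J t \<Longrightarrow> stab x t = (js, c) \<Longrightarrow>
     set js = {i \<in> intervals t. contains i x} \<and> length js \<le> (iheight t + 1) * (2 * D + 2) \<and>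
     c \<le> (iheight t + 1) * (2 * D + 2)"
proof (induction t arbitrary: js c)
  case ILeaf
  then show ?case by simp
next
  case (INode l k e r)
  have sub: "itree_ok J l" "itree_ok J r" using INode.prems by simp_all
  obtain ks0 c1 where ks0: "stored_at x e = (ks0, c1)" by fastforce
  have e: "entry_ok J e" using INode.prems by simp
  note s = stored_at_correct[OF e ks0]
  consider "x < split_point e" | "\<not> x < split_point e" "split_point e < x" | "x = split_point e" by force
  then show ?case
  proof cases
    case 1
    obtain ks c2 where ks: "stab x l = (ks, c2)" by fastforce
    note IH = INode.IH(1)[OF sub(1) ks]
    have "\<not> contains i x" if "i \<in> intervals r" for i
      using that INode.prems 1 by (auto simp: above_def contains_def)
    moreover have "js = ks0 @ ks" "c = c1 + c2 + 1" using INode.prems 1 ks0 ks by auto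
    moreover have "(iheight l + 1) * (2 * D + 2) + (2 * D + 2) \<le> (iheight (INode l k e r) + 1) * (2 * D + 2)"
      by (rule step_cost) simp
    ultimately show ?thesis using s IH by auto
  next
    case 2
    obtain ks c2 where ks: "stab x r = (ks, c2)" by fastforce
    note IH = INode.IH(2)[OF sub(2) ks]
    have "\<not> contains i x" if "i \<in> intervals l" for i
      using that INode.prems 2 by (auto simp: below_def contains_def)
    moreover have "js = ks0 @ ks" "c = c1 + c2 + 1" using INode.prems 2 ks0 ks by auto
    moreover have "(iheight r + 1) * (2 * D + 2) + (2 * D + 2) \<le> (iheight (INode l k e r) + 1) * (2 * D + 2)"
      by (rule step_cost) simp
    ultimately show ?thesis using s IH by auto
  next
    case 3
    have "\<not> contains i x" if "i \<in> intervals l \<union> intervals r" for i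
      using that INode.prems 3 by (auto simp: below_def above_def contains_def)
    moreover have "js = ks0" "c = c1 + 1" using INode.prems 3 ks0 by auto
    ultimately show ?thesis using s by auto
  qed
qed

end

section \<open>Colour and black-height invariants\<close>

fun invc :: "itree \<Rightarrow> bool" where
  "invc ILeaf = True"
| "invc (INode l k e r) \<longleftrightarrow>
     (k = Red \<longrightarrow> icolor l = Black \<and> icolor r = Black) \<and> invc l \<and> invc r"

text \<open>Like \<open>invc\<close>, except that the root and one of its children may both be red.\<close>

abbreviation invc2 :: "itree \<Rightarrow> bool" where
  "invc2 t \<equiv> invc (paint Black t)"

fun black_height :: "itree \<Rightarrow> nat" where
  "black_height ILeaf = 0"
| "black_height (INode l k e r) = (if k = Black then black_height l + 1 else black_height l)"

fun invh :: "itree \<Rightarrow> bool" where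
  "invh ILeaf = True"
| "invh (INode l k e r) \<longleftrightarrow> invh l \<and> invh r \<and> black_height l = black_height r"

lemma icolor_paint_Black [simp]: "icolor (paint Black t) = Black"
  by (cases t) auto

lemma paint_paint [simp]: "paint k (paint k' t) = paint k t"
  by (cases t) auto

lemma invc2I: "invc t \<Longrightarrow> invc2 t"
  by (cases t) auto

lemma invh_paint [simp]: "invh (paint k t) = invh t"
  by (cases t) auto

text \<open>Lifting alters only the stores inside the entries. With this, the balance proof can
  treat entries as opaque and follow the usual one for red-black trees.\<close>

lemma rotate_shape:
  obtains a' b' e' where
    "fst (rotate k t1 a t2 b t3 e t4) = RNode (INode t1 k a' t2) b' (INode t3 k e' t4)"
proof -
  obtain a' b' e' c where "lift2 a b e = ((a', b', e'), c)" by (metis prod.collapse)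
  then show thesis using that by (simp add: rotate_def)
qed

lemma invc_rotate_Black:
  "invc t1 \<Longrightarrow> invc t2 \<Longrightarrow> invc t3 \<Longrightarrow> invc t4 \<Longrightarrow> invc (fst (rotate Black t1 a t2 b t3 e t4))"
  by (rule rotate_shape[of Black t1 a t2 b t3 e t4]) simp

lemma invh_rotate [simp]:
  "invh (fst (rotate k t1 a t2 b t3 e t4)) \<longleftrightarrow>
     invh t1 \<and> invh t2 \<and> invh t3 \<and> invh t4 \<and>
     black_height t1 = black_height t2 \<and> black_height t1 = black_height t3 \<and> black_height t3 = black_height t4"
  by (rule rotate_shape[of k t1 a t2 b t3 e t4]) auto

lemma black_height_rotate [simp]:
  "black_height (fst (rotate k t1 a t2 b t3 e t4)) = (if k = Black then black_height t1 + 1 else black_height t1)"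
  by (rule rotate_shape[of k t1 a t2 b t3 e t4]) auto

lemma icolor_rotate [simp]: "icolor (fst (rotate k t1 a t2 b t3 e t4)) = Red"
  by (rule rotate_shape[of k t1 a t2 b t3 e t4]) auto

lemma invc_baliL: "invc2 l \<Longrightarrow> invc r \<Longrightarrow> invc (fst (baliL l e r))"
  by (induction l e r rule: baliL.induct) (auto intro!: invc_rotate_Black)

lemma invc_baliR: "invc l \<Longrightarrow> invc2 r \<Longrightarrow> invc (fst (baliR l e r))"
  by (induction l e r rule: baliR.induct) (auto intro!: invc_rotate_Black)

lemma black_height_baliL:
  "black_height l = black_height r \<Longrightarrow> black_height (fst (baliL l e r)) = Suc (black_height l)"
  by (induction l e r rule: baliL.induct) auto

lemma black_height_baliR:
  "black_height l = black_height r \<Longrightarrow> black_height (fst (baliR l e r)) = Suc (black_height l)"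
  by (induction l e r rule: baliR.induct) auto

lemma invh_baliL:
  "invh l \<Longrightarrow> invh r \<Longrightarrow> black_height l = black_height r \<Longrightarrow> invh (fst (baliL l e r))"
  by (induction l e r rule: baliL.induct) auto

lemma invh_baliR:
  "invh l \<Longrightarrow> invh r \<Longrightarrow> black_height l = black_height r \<Longrightarrow> invh (fst (baliR l e r))"
  by (induction l e r rule: baliR.induct) auto

lemma paint_Red:
  "invh t \<Longrightarrow> icolor t = Black \<Longrightarrow> black_height (paint Red t) = black_height t - 1"
  by (cases t) auto

lemma inv_endpoint_ins:
  "invc t \<Longrightarrow> invh t \<Longrightarrow>
     invc2 (fst (endpoint_ins x t)) \<and> (icolor t = Black \<longrightarrow> invc (fst (endpoint_ins x t))) \<and>
     invh (fst (endpoint_ins x t)) \<and> black_height (fst (endpoint_ins x t)) = black_height t"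
proof (induction t)
  case (INode l k e r)
  then show ?case
    by (cases k)
      (auto simp: Let_def case_prod_beta invc_baliL invc_baliR invh_baliL invh_baliR
        black_height_baliL black_height_baliR invc2I)
qed auto

lemma inv_endpoint_insert:
  assumes "invc t" "invh t" "endpoint_insert x t = (t', c)"
  shows "invc t'" "invh t'" "icolor t' = Black"
  using inv_endpoint_ins[OF assms(1,2), of x] assms(3) by (auto simp: endpoint_insert_def split: prod.splits)

text \<open>Here \<open>l\<close> comes back from a deletion: one black level short and possibly
  with two red nodes in a row at its top. The result has the black height that the node would have
  with a red root.\<close>

lemma inv_baldL:
  "invh l \<Longrightarrow> invh r \<Longrightarrow> black_height l + 1 = black_height r \<Longrightarrow> invc2 l \<Longrightarrow> invc r \<Longrightarrow>
     invh (fst (baldL l e r)) \<and> black_height (fst (baldL l e r)) = black_height r \<and>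
     invc2 (fst (baldL l e r)) \<and> (icolor r = Black \<longrightarrow> invc (fst (baldL l e r)))"
  by (induction l e r rule: baldL.induct)
    (auto simp: invh_baliR invc_baliR black_height_baliR paint_Red invc2I Let_def case_prod_beta)

lemma inv_baldR:
  "invh l \<Longrightarrow> invh r \<Longrightarrow> black_height l = black_height r + 1 \<Longrightarrow> invc l \<Longrightarrow> invc2 r \<Longrightarrow>
     invh (fst (baldR l e r)) \<and> black_height (fst (baldR l e r)) = black_height l \<and>
     invc2 (fst (baldR l e r)) \<and> (icolor l = Black \<longrightarrow> invc (fst (baldR l e r)))"
  by (induction l e r rule: baldR.induct)
    (auto simp: invh_baliL invc_baliL black_height_baliL paint_Red invc2I Let_def case_prod_beta)

lemma invc_rotate_Red:
  "icolor t1 = Black \<Longrightarrow> icolor t2 = Black \<Longrightarrow> icolor t3 = Black \<Longrightarrow> icolor t4 = Black \<Longrightarrow>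
   invc t1 \<Longrightarrow> invc t2 \<Longrightarrow> invc t3 \<Longrightarrow> invc t4 \<Longrightarrow> invc2 (fst (rotate Red t1 a t2 b t3 e t4))"
  by (rule rotate_shape[of Red t1 a t2 b t3 e t4]) simp

lemma inv_ijoin:
  "invh l \<Longrightarrow> invh r \<Longrightarrow> black_height l = black_height r \<Longrightarrow> invc l \<Longrightarrow> invc r \<Longrightarrow>
     invh (fst (ijoin l r)) \<and> black_height (fst (ijoin l r)) = black_height l \<and>
     invc2 (fst (ijoin l r)) \<and> (icolor l = Black \<and> icolor r = Black \<longrightarrow> invc (fst (ijoin l r)))"
proof (induction l r rule: ijoin.induct)
  case (3 t1 a t2 t3 e t4)
  then show ?case
    by (cases "ijoin t2 t3")
      (auto simp: invc_rotate_Red Let_def case_prod_beta split: itree.splits color.splits)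
next
  case (4 t1 a t2 t3 e t4)
  obtain t c where t: "ijoin t2 t3 = (t, c)" by fastforce
  show ?case
  proof (cases "icolor t")
    case Red
    then obtain u2 b u3 where "t = RNode u2 b u3" by (cases t) auto
    then show ?thesis using 4 t by (auto simp: invc_rotate_Black invc2I Let_def case_prod_beta)
  next
    case Black
    then have "fst (ijoin (BNode t1 a t2) (BNode t3 e t4)) = fst (baldL t1 a (BNode t e t4))"
      using t by (cases t) (auto simp: Let_def case_prod_beta)
    moreover have "invc t" using 4 t Black by (cases t) auto
    ultimately show ?thesis using 4 t inv_baldL[of t1 "BNode t e t4" a] Black by (auto simp: invc2I)
  qed
qed (auto simp: invc2I Let_def case_prod_beta)

text \<open>Below a black root one black level goes missing and is handed on to the parent; a red
  root absorbs the missing level.\<close>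

lemma inv_endpoint_del:
  "invh t \<Longrightarrow> invc t \<Longrightarrow>
     invh (fst (fst (endpoint_del x t))) \<and>
     (icolor t = Red \<longrightarrow> black_height (fst (fst (endpoint_del x t))) = black_height t \<and>
        invc (fst (fst (endpoint_del x t)))) \<and>
     (icolor t = Black \<longrightarrow> black_height (fst (fst (endpoint_del x t))) = black_height t - 1 \<and>
        invc2 (fst (fst (endpoint_del x t))))"
proof (induction t)
  case (INode l k e r)
  consider "x = fst e" | "x \<noteq> fst e" "x < fst e" | "x \<noteq> fst e" "\<not> x < fst e" by blast
  then show ?case
  proof cases
    case 1
    then show ?thesis using INode.prems inv_ijoin[of l r] by (auto simp: Let_def case_prod_beta)
  next
    case 2
    show ?thesis
    proof (cases "black_node l")
      case True
      then have "icolor l = Black" "black_height l \<noteq> 0" by (cases l; auto)+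
      then show ?thesis
        using True 2 INode inv_baldL[of "fst (fst (endpoint_del x l))" r e]
        by (cases k) (auto simp: Let_def case_prod_beta)
    next
      case False
      then have "l = ILeaf \<or> icolor l = Red" by (cases l) (auto intro: color.exhaust)
      then show ?thesis
        using False 2 INode by (cases k) (auto simp: Let_def case_prod_beta invc2I)
    qed
  next
    case 3
    show ?thesis
    proof (cases "black_node r")
      case True
      then have "icolor r = Black" "black_height r \<noteq> 0" by (cases r; auto)+
      then show ?thesis
        using True 3 INode inv_baldR[of l "fst (fst (endpoint_del x r))" e]
        by (cases k) (auto simp: Let_def case_prod_beta)
    next
      case False
      then have "r = ILeaf \<or> icolor r = Red" by (cases r) (auto intro: color.exhaust)
      then show ?thesis
        using False 3 INode by (cases k) (auto simp: Let_def case_prod_beta invc2I)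
    qed
  qed
qed auto

text \<open>No two red nodes follow each other, so they at most double the length of a path; a red
  root can add one more.\<close>

lemma iheight_black_height:
  "invc t \<Longrightarrow> invh t \<Longrightarrow> iheight t \<le> 2 * black_height t + (if icolor t = Black then 0 else 1)"
  by (induction t) (auto split: if_splits intro: color.exhaust)

text \<open>The tagged endpoints are strictly ordered, so those of different nodes differ and the
  cardinalities of the subtrees add up.\<close>

lemma black_height_points:
  "itree_ok J t \<Longrightarrow> invh t \<Longrightarrow> 2 ^ black_height t \<le> card (points t) + 1 \<and> finite (points t)"
proof (induction t)
  case (INode l k e r)
  have "points l \<inter> points r = {}" "fst e \<notin> points l \<union> points r"
    using INode.prems by (fastforce simp: below_def above_def)+
  then have "card (points (INode l k e r)) = card (points l) + card (points r) + 1"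
    using INode by (simp add: card_Un_disjoint)
  then show ?case using INode by auto
qed auto

lemma place_colors:
  "place i t = (t', c) \<Longrightarrow> icolor t' = icolor t \<and> black_height t' = black_height t \<and> invc t' = invc t \<and> invh t' = invh t"
  by (induction t arbitrary: t' c) (fastforce split: if_splits prod.splits)+

lemma unplace_colors:
  "unplace i t = (t', c) \<Longrightarrow> icolor t' = icolor t \<and> black_height t' = black_height t \<and> invc t' = invc t \<and> invh t' = invh t"
  by (induction t arbitrary: t' c) (fastforce split: if_splits prod.splits)+

lemma place_all_colors:
  "place_all js t = (t', c) \<Longrightarrow> icolor t' = icolor t \<and> invc t' = invc t \<and> invh t' = invh t"
  by (induction js arbitrary: t t' c) (auto dest!: place_colors split: prod.splits)

section \<open>Insertion, deletion and stabbing in complete interval trees\<close>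

definition endpoints :: "interval set \<Rightarrow> endpoint set" where
  "endpoints I = (\<lambda>i. (start i, i)) ` I \<union> (\<lambda>i. (fin i, i)) ` I"

lemma mem_endpoints: "(x, i) \<in> endpoints I \<longleftrightarrow> i \<in> I \<and> (x = start i \<or> x = fin i)"
  by (auto simp: endpoints_def)

lemma endpoints_remove: "endpoints (I - {i}) = endpoints I - {(start i, i)} - {(fin i, i)}"
  unfolding set_eq_iff split_paired_All mem_endpoints Diff_iff singleton_iff prod.inject by blast

definition red_black :: "itree \<Rightarrow> bool" where
  "red_black t \<longleftrightarrow> invc t \<and> invh t \<and> icolor t = Black"

definition interval_tree :: "interval set \<Rightarrow> itree \<Rightarrow> bool" where
  "interval_tree I t \<longleftrightarrow> itree_ok I t \<and> red_black t \<and> intervals t = I \<and> points t = endpoints I"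

context pierced
begin

text \<open>There are at most \<open>2 * card J\<close> endpoints, and \<open>2 * card J + 1\<close>
  is at most the square of \<open>card J + 1\<close>. So the \<open>w\<close> chosen for the stores
  also bounds the black height.\<close>

lemma red_black_height:
  assumes "red_black t" "itree_ok J t" "points t \<subseteq> endpoints J"
  shows "iheight t + 1 \<le> 2 * w"
proof -
  have "card (endpoints J) \<le> card J + card J"
    unfolding endpoints_def by (intro order_trans[OF card_Un_le] add_mono card_image_le finite_J)
  moreover have "card (points t) \<le> card (endpoints J)"
    using assms(3) finite_J by (intro card_mono) (auto simp: endpoints_def)
  ultimately have "2 ^ black_height t \<le> 2 * card J + 1"
    using black_height_points[OF assms(2)] assms(1) by (auto simp: red_black_def)
  also have "\<dots> \<le> (card J + 1)\<^sup>2" by (simp add: power2_eq_square)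
  also have "\<dots> < 2 ^ w" by (rule card_J)
  finally have "black_height t < w" by simp
  then show ?thesis using iheight_black_height[of t] assms(1) by (auto simp: red_black_def)
qed

lemma R_le: "R \<le> 19 * D * w"
  using w_pos by (simp add: R_def algebra_simps)

lemma endpoint_insert_correct:
  assumes "itree_ok J t" "red_black t" "points t \<subseteq> endpoints J" "endpoint_insert x t = (t', c)"
  shows "itree_ok J t'" "red_black t'" "intervals t' = intervals t" "points t' = insert x (points t)"
    "c \<le> 2 * w * R"
proof -
  obtain u where u: "endpoint_ins x t = (u, c)" "t' = paint Black u"
    using assms(4) by (auto simp: endpoint_insert_def split: prod.splits)
  note e = endpoint_ins_correct[OF assms(1) u(1)]
  show "itree_ok J t'" "intervals t' = intervals t" "points t' = insert x (points t)"
    using e by (auto simp: u)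
  show "red_black t'"
    using inv_endpoint_insert[OF _ _ assms(4)] assms(2) by (simp add: red_black_def)
  have "(iheight t + 1) * R \<le> 2 * w * R"
    by (intro mult_right_mono red_black_height assms) simp
  then show "c \<le> 2 * w * R" using e by linarith
qed

text \<open>By the assumption \<open>place\<close>, every stored interval contains a remaining
  endpoint, so those displaced with the deleted node find a new one.\<close>

lemma endpoint_delete_correct:
  assumes "itree_ok J t" "red_black t" "points t \<subseteq> endpoints J" "endpoint_delete x t = (t', c)"
    and place: "\<And>i. i \<in> intervals t \<Longrightarrow> \<exists>y\<in>points t - {x}. contains i (fst y)"
  shows "itree_ok J t'" "red_black t'" "intervals t' = intervals t" "points t' = points t - {x}"
    "c \<le> 8 * w * R + 4 * D * w + 1"
proof -
  obtain u js c1 where u: "endpoint_del x t = ((u, js), c1)" by (metis prod.collapse)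
  obtain c2 where c2: "place_all js (paint Black u) = (t', c2)" "c = c1 + c2"
    using assms(4) u by (auto simp: endpoint_delete_def split: prod.splits)
  note d = endpoint_del_correct[OF assms(1) u]
  have sub: "intervals t \<subseteq> J" by (rule itree_ok_intervals[OF assms(1)])
  have "\<exists>y\<in>points (paint Black u). contains i (fst y)" if "i \<in> set js" for i
  proof -
    have "i \<in> intervals t" using that d by blast
    from place[OF this] d show ?thesis by simp
  qed
  with sub have p: "itree_ok J t' \<and> intervals t' = set js \<union> intervals (paint Black u) \<and>
      points t' = points (paint Black u) \<and> c2 \<le> length js * (iheight (paint Black u) + 2 * w + 2) + 1"
    by (intro place_all_correct[OF _ _ _ c2(1)]) (use d in auto)
  show "itree_ok J t'" "intervals t' = intervals t" "points t' = points t - {x}"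
    using d p by auto
  have rb: "red_black (paint Black u)"
    using inv_endpoint_del[of t x] assms(2) by (auto simp: red_black_def u)
  then show "red_black t'" using place_all_colors[OF c2(1)] by (auto simp: red_black_def)
  have "iheight (paint Black u) + 1 \<le> 2 * w"
    by (rule red_black_height[OF rb]) (use d assms in auto)
  then have "length js * (iheight (paint Black u) + 2 * w + 2) \<le> D * (4 * w + 1)"
    using d by (intro mult_mono) auto
  moreover have "(2 * iheight t + 1) * (2 * R) \<le> (4 * w - 1) * (2 * R)"
    using red_black_height[OF assms(2,1,3)] by (intro mult_right_mono) auto
  moreover have "(4 * w - 1) * (2 * R) + 2 * R = 8 * w * R"
    using w_pos by (cases w) (auto simp: algebra_simps)
  moreover have "D * (4 * w + 1) = 4 * D * w + D" by (simp add: algebra_simps)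
  ultimately show "c \<le> 8 * w * R + 4 * D * w + 1"
    using d p c2(2) R_ge(1) by linarith
qed

lemma red_black_place: "red_black t \<Longrightarrow> place i t = (t', c) \<Longrightarrow> red_black t'"
  using place_colors[of i t t' c] by (auto simp: red_black_def)

lemma red_black_unplace: "red_black t \<Longrightarrow> unplace i t = (t', c) \<Longrightarrow> red_black t'"
  using unplace_colors[of i t t' c] by (auto simp: red_black_def)

text \<open>Both endpoints are inserted before the interval is placed, so the node of
  \<open>(start i, i)\<close> is there to receive it.\<close>

lemma itree_insert_correct:
  assumes t: "interval_tree I t" and J: "J = insert i I" and ins: "itree_insert i t = (t', c)"
  shows "interval_tree J t'" "c \<le> 90 * D * w\<^sup>2"
proof -
  obtain t1 c1 where t1: "endpoint_insert (start i, i) t = (t1, c1)" by fastforce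
  obtain t2 c2 where t2: "endpoint_insert (fin i, i) t1 = (t2, c2)" by fastforce
  obtain t3 c3 where t3: "place i t2 = (t3, c3)" by fastforce
  have eq: "t' = t3" "c = c1 + c2 + c3" using ins by (auto simp: itree_insert_def t1 t2 t3)
  have ok: "itree_ok J t" "red_black t" "intervals t = I" "points t = endpoints I"
    using t J by (auto simp: interval_tree_def intro: itree_ok_mono)
  then have "points t \<subseteq> endpoints J" by (auto simp: J endpoints_def)
  note e1 = endpoint_insert_correct[OF ok(1,2) this t1]
  have "points t1 \<subseteq> endpoints J" using e1 ok by (auto simp: J endpoints_def)
  note e2 = endpoint_insert_correct[OF e1(1,2) this t2]
  have pts: "points t2 = endpoints J" using e1 e2 ok by (auto simp: J endpoints_def)
  have i: "start i < fin i" "i \<in> J" using intervals_J J by auto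
  have p: "itree_ok J t3 \<and> intervals t3 = insert i (intervals t2) \<and> points t3 = points t2 \<and>
      c3 \<le> iheight t2 + 2 * w + 1"
    by (rule place_correct[OF e2(1) i(2) _ _ t3, of "(start i, i)"])
      (use i pts in \<open>auto simp: endpoints_def contains_def\<close>)
  then show "interval_tree J t'"
    using red_black_place[OF e2(2) t3] e1 e2 ok pts by (auto simp: interval_tree_def eq J)
  have "iheight t2 + 1 \<le> 2 * w" by (rule red_black_height) (use e2 pts in auto)
  with p e1 e2 eq have "c \<le> 4 * (w * R) + 4 * w" by (simp add: algebra_simps)
  moreover have "w * R \<le> 19 * D * w\<^sup>2"
    using mult_left_mono[OF R_le, of w] by (simp add: power2_eq_square algebra_simps)
  moreover have "w \<le> D * w\<^sup>2"
    using D_pos w_pos mult_mono[of 1 "D * w" w w] by (simp add: power2_eq_square)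
  ultimately show "c \<le> 90 * D * w\<^sup>2" by (simp add: algebra_simps)
qed

text \<open>\<open>i\<close> is taken out before its endpoints are deleted, and every other interval
  contains its own starting point, which stays in the tree. Thus no interval is ever left without a
  node.\<close>

lemma itree_delete_correct:
  assumes t: "interval_tree J t" and i: "i \<in> J" and del: "itree_delete i t = (t', c)"
  shows "interval_tree (J - {i}) t'" "c \<le> 400 * D * w\<^sup>2"
proof -
  obtain t1 c1 where t1: "unplace i t = (t1, c1)" by fastforce
  obtain t2 c2 where t2: "endpoint_delete (start i, i) t1 = (t2, c2)" by fastforce
  obtain t3 c3 where t3: "endpoint_delete (fin i, i) t2 = (t3, c3)" by fastforce
  have eq: "t' = t3" "c = c1 + c2 + c3" using del by (auto simp: itree_delete_def t1 t2 t3)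
  have ok: "itree_ok J t" "red_black t" "intervals t = J" "points t = endpoints J"
    using t by (auto simp: interval_tree_def)
  have "start i < fin i" using intervals_J i by auto
  note u = unplace_correct[OF ok(1) t1 this]
  have rb1: "red_black t1" by (rule red_black_unplace[OF ok(2) t1])
  have own: "contains j (start j)" if "j \<in> J" for j using intervals_J[OF that] by (simp add: contains_def)
  have keep: "\<exists>y\<in>endpoints J - {(start i, i)} - {(fin i, i)}. contains j (fst y)" if "j \<in> J - {i}" for j
    by (rule bexI[of _ "(start j, j)"]) (use that own in \<open>auto simp: endpoints_def\<close>)
  have pl1: "\<exists>y\<in>points t1 - {(start i, i)}. contains j (fst y)" if "j \<in> intervals t1" for j
    using keep[of j] that u ok by auto
  have ok1: "itree_ok J t1" "points t1 \<subseteq> endpoints J" using u ok by simp_all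
  note e1 = endpoint_delete_correct[OF ok1(1) rb1 ok1(2) t2 pl1]
  have p2: "points t2 = endpoints J - {(start i, i)}" using e1(4) u ok by simp
  then have ok2: "itree_ok J t2" "points t2 \<subseteq> endpoints J" using e1(1) by auto
  have pl2: "\<exists>y\<in>points t2 - {(fin i, i)}. contains j (fst y)" if "j \<in> intervals t2" for j
    using keep[of j] that u ok e1(3) p2 by simp
  note e2 = endpoint_delete_correct[OF ok2(1) e1(2) ok2(2) t3 pl2]
  have "points t3 = endpoints J - {(start i, i)} - {(fin i, i)}" using e2(4) p2 by simp
  then have pts: "points t3 = endpoints (J - {i})" by (simp only: endpoints_remove)
  have int: "intervals t3 = J - {i}" using e2(3) e1(3) u ok(3) by simp
  have "itree_ok (J - {i}) t3" using itree_ok_subset[OF e2(1)] int by simp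
  then show "interval_tree (J - {i}) t'" using e2(2) pts int by (simp add: interval_tree_def eq)
  have "w * R \<le> 19 * D * w\<^sup>2"
    using mult_left_mono[OF R_le, of w] by (simp add: power2_eq_square algebra_simps)
  moreover have "D * w \<le> D * w\<^sup>2" "w \<le> D * w" "1 \<le> w"
    using D_pos w_pos by (simp_all add: power2_eq_square)
  moreover have "c1 \<le> 4 * w" using u red_black_height[OF ok(2,1)] ok by simp
  moreover have "c2 \<le> 8 * (w * R) + 4 * (D * w) + 1" "c3 \<le> 8 * (w * R) + 4 * (D * w) + 1"
    using e1(5) e2(5) by (simp_all add: mult.assoc)
  \<comment> \<open>304 is \<open>16 * 19\<close> from the two deletions of endpoints; 14 collects
    \<open>4 * w\<close>, twice \<open>4 * (D * w)\<close>, and 2.\<close>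
  ultimately have "c \<le> 304 * (D * w\<^sup>2) + 14 * (D * w\<^sup>2)" unfolding eq by linarith
  then show "c \<le> 400 * D * w\<^sup>2" by simp
qed

lemma stab_interval_tree:
  assumes "interval_tree J t" "stab x t = (js, c)"
  shows "set js = {i \<in> J. contains i x}" "length js \<le> 8 * D * w" "c \<le> 8 * D * w"
proof -
  have ok: "itree_ok J t" "red_black t" "intervals t = J" "points t = endpoints J"
    using assms by (auto simp: interval_tree_def)
  note s = stab_correct[OF ok(1) assms(2)]
  have "(iheight t + 1) * (2 * D + 2) \<le> 2 * w * (4 * D)"
    using red_black_height[OF ok(2,1)] ok D_pos by (intro mult_mono) auto
  then show "set js = {i \<in> J. contains i x}" "length js \<le> 8 * D * w" "c \<le> 8 * D * w"
    using s ok by (auto simp: mult.commute mult.left_commute)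
qed

end

section \<open>Amortised cost of splaying\<close>

abbreviation rank :: "stree \<Rightarrow> real" where
  "rank t \<equiv> log 2 (real (size1 t))"

text \<open>The potential of Sleator and Tarjan with unit weights, where sizes count the leaves of
  the tree so that no logarithm is negative.\<close>

fun splay_potential :: "stree \<Rightarrow> real" where
  "splay_potential Leaf = 0"
| "splay_potential (Node l a r) = splay_potential l + splay_potential r + rank (Node l a r)"

definition fin_sorted :: "interval list \<Rightarrow> bool" where
  "fin_sorted xs \<longleftrightarrow> sorted_wrt (\<lambda>a b. fin a < fin b) xs"

text \<open>The inequality of arithmetic and geometric means. The summand 2 is what pays for a
  double rotation.\<close>

lemma log_sum: "0 < x \<Longrightarrow> 0 < y \<Longrightarrow> log 2 x + log 2 y + 2 \<le> 2 * log 2 (x + y)" for x y :: real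
proof -
  assume xy: "0 < x" "0 < y"
  have "log 2 x + log 2 y + 2 = log 2 (4 * (x * y))"
    using xy log_pow_cancel[of 2 2] by (simp add: log_mult_pos)
  also have "\<dots> \<le> log 2 ((x + y)\<^sup>2)"
    using xy sum_squares_bound[of x y] by (intro log_mono) (auto simp: power2_eq_square algebra_simps)
  also have "\<dots> = 2 * log 2 (x + y)" using xy by (simp add: log_nat_power)
  finally show ?thesis .
qed

lemma size1_pos: "0 < real (size1 t)"
  by (simp add: size1_size)

lemma rank_nonneg [simp]: "0 \<le> rank t"
  by (simp add: size1_size)

lemma potential_nonneg: "0 \<le> splay_potential t"
proof (induction t)
  case (Node l a r)
  then show ?case using rank_nonneg[of "Node l a r"] by simp
qed simp

text \<open>The variables are the sizes and potentials of the subtrees involved; the last assumption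
  is the induction hypothesis for the subtree of size \<open>n\<close>. The rank of the whole tree
  occurs before and after the rotation and has been cancelled.\<close>

lemma zig_zig_cost:
  fixes a1 a2 n b r c pa pa' :: real
  assumes "0 < a1" "0 < a2" "0 < b" "0 < r" "n = a1 + a2"
    and "c + (pa' + log 2 n) \<le> pa + 3 * log 2 n + 1"
  shows "c + 1 + (pa' + log 2 (b + r) + log 2 (a2 + (b + r))) \<le>
    pa + log 2 (n + b) + 3 * log 2 (n + b + r) + 1"
proof -
  have "log 2 (a2 + (b + r)) \<le> log 2 (n + b + r)" "log 2 n \<le> log 2 (n + b)"
    using assms by (auto intro!: log_mono)
  moreover have "log 2 n + log 2 (b + r) + 2 \<le> 2 * log 2 (n + b + r)"
    using log_sum[of n "b + r"] assms by (simp add: algebra_simps)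
  ultimately show ?thesis using assms(6) by linarith
qed

lemma zig_zag_cost:
  fixes a b1 b2 n r c pb pb' :: real
  assumes "0 < b1" "0 < b2" "0 < a" "0 < r" "n = b1 + b2"
    and "c + (pb' + log 2 n) \<le> pb + 3 * log 2 n + 1"
  shows "c + 1 + (pb' + log 2 (a + b1) + log 2 (b2 + r)) \<le>
    pb + log 2 (a + n) + 3 * log 2 (a + n + r) + 1"
proof -
  have "log 2 n \<le> log 2 (a + n + r)" "log 2 n \<le> log 2 (a + n)"
    using assms by (auto intro!: log_mono)
  moreover have "log 2 (a + b1) + log 2 (b2 + r) + 2 \<le> 2 * log 2 (a + n + r)"
    using log_sum[of "a + b1" "b2 + r"] assms by (simp add: algebra_simps)
  ultimately show ?thesis using assms(6) by linarith
qed

lemma zig_cost: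
  fixes a b r :: real
  assumes "1 \<le> a" "1 \<le> b" "1 \<le> r"
  shows "2 + log 2 (b + r) \<le> log 2 (a + b) + 3 * log 2 (a + b + r) + 1"
proof -
  have "log 2 (b + r) \<le> log 2 (a + b + r)" "0 \<le> log 2 (a + b)" "log 2 2 \<le> log 2 (a + b + r)"
    using assms by (auto intro!: log_mono)
  then show ?thesis by simp
qed

lemma size1_ge_1: "1 \<le> real (size1 t)"
  by (simp add: size1_size)

lemma splay_size1: "splay x t = (t', c) \<Longrightarrow> size1 t' = size1 t"
  using size_splay[of x t] by (simp add: size1_size)

text \<open>The access lemma. The recursion passes over two levels at a time, hence the induction on
  the size.\<close>

lemma splay_amortised:
  "splay x t = (t', c) \<Longrightarrow> real c + splay_potential t' \<le> splay_potential t + 3 * rank t + 1"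
proof (induction "size t" arbitrary: t t' c rule: less_induct)
  case less
  note pos = size1_pos and ge = size1_ge_1
  show ?case
  proof (cases t)
    case Leaf
    then show ?thesis using less.prems by auto
  next
    case t: (Node L b R)
    \<comment> \<open>No rotation, then zig, zig-zig and zig-zag on the left, and their mirror
      images. A zig also arises when the inner call meets a leaf, at a cost of 2.\<close>
    consider "t' = t" "c = 1"
      | A a B where "L = Node A a B" "fin x < fin b" "t' = Node A a (Node B b R)" "c \<le> 2"
      | A a B A1 y A2 k where "L = Node A a B" "splay x A = (Node A1 y A2, k)" "c = k + 1"
          "t' = Node A1 y (Node A2 a (Node B b R))"
      | A a B B1 y B2 k where "L = Node A a B" "splay x B = (Node B1 y B2, k)" "c = k + 1"
          "t' = Node (Node A a B1) y (Node B2 b R)"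
      | A a B where "R = Node A a B" "t' = Node (Node L b A) a B" "c \<le> 2"
      | A a B A1 y A2 k where "R = Node A a B" "splay x A = (Node A1 y A2, k)" "c = k + 1"
          "t' = Node (Node L b A1) y (Node A2 a B)"
      | A a B B1 y B2 k where "R = Node A a B" "splay x B = (Node B1 y B2, k)" "c = k + 1"
          "t' = Node (Node (Node L b A) a B1) y B2"
    proof -
      have leaf: "k \<le> 1" if "splay x A = (Leaf, k)" for A k
        using that splay_eq_Leaf[of x A] by (metis fst_conv order_refl prod.inject splay.simps(1))
      show thesis
        using less.prems that unfolding t
        by (auto split: if_splits tree.splits prod.splits dest: leaf)
    qed
    note cases = this
    have IH: "real k + (splay_potential A1 + splay_potential A2 + rank A) \<le> splay_potential A + 3 * rank A + 1"
      if "splay x A = (Node A1 y A2, k)" "size A < size t" for A A1 y A2 k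
      using less.hyps[OF that(2,1)] unfolding splay_potential.simps splay_size1[OF that(1)] by simp
    have sz: "real (size1 A) = real (size1 A1) + real (size1 A2)"
      if "splay x A = (Node A1 y A2, k)" for A A1 y A2 k
      using arg_cong[OF splay_size1[OF that], of real] by simp
    from cases show ?thesis
    proof cases
      case 1
      then show ?thesis using rank_nonneg[of t] by simp
    next
      case (2 A a B)
      have "real c \<le> 2" using 2 by simp
      then show ?thesis
        using zig_cost[OF ge[of A] ge[of B] ge[of R]] 2 t by (simp add: add_ac)
    next
      case (3 A a B A1 y A2 k)
      then have "size A < size t" by (simp add: t)
      note IH = IH[OF 3(2) this]
      from zig_zig_cost[OF pos[of A1] pos[of A2] pos[of B] pos[of R]
          sz[OF 3(2)] IH]
      show ?thesis using 3 t sz[OF 3(2)] by (simp add: add_ac)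
    next
      case (4 A a B B1 y B2 k)
      then have "size B < size t" by (simp add: t)
      note IH = IH[OF 4(2) this]
      from zig_zag_cost[OF pos[of B1] pos[of B2] pos[of A] pos[of R]
          sz[OF 4(2)] IH]
      show ?thesis using 4 t sz[OF 4(2)] by (simp add: add_ac)
    next
      case (5 A a B)
      have "real c \<le> 2" using 5 by simp
      then show ?thesis
        using zig_cost[OF ge[of B] ge[of A] ge[of L]] 5 t by (simp add: add_ac)
    next
      \<comment> \<open>The mirror images use the same inequalities, with the two parts of the
        splayed subtree exchanged.\<close>
      case (6 A a B A1 y A2 k)
      then have "size A < size t" by (simp add: t)
      note IH = IH[OF 6(2) this]
      from zig_zag_cost[OF pos[of A2] pos[of A1] pos[of B] pos[of L]
          sz[OF 6(2), unfolded add.commute[of "real (size1 A1)"]] IH]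
      show ?thesis using 6 t sz[OF 6(2)] by (simp add: add_ac)
    next
      case (7 A a B B1 y B2 k)
      then have "size B < size t" by (simp add: t)
      note IH = IH[OF 7(2) this]
      from zig_zig_cost[OF pos[of B2] pos[of B1] pos[of A] pos[of L]
          sz[OF 7(2), unfolded add.commute[of "real (size1 B1)"]] IH]
      show ?thesis using 7 t sz[OF 7(2)] by (simp add: add_ac)
    qed
  qed
qed

section \<open>Maximum, split, join and predecessor in splay trees\<close>

lemma inorder_splay: "inorder (fst (splay x t)) = inorder t"
  by (induction x t rule: splay.induct) (auto split: tree.split prod.split)

lemma inorder_splay_max: "inorder (fst (splay_max t)) = inorder t"
  by (induction t rule: splay_max.induct) (auto split: tree.splits prod.splits)

lemma splay_max_size1: "splay_max t = (t', c) \<Longrightarrow> size1 t' = size1 t"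
  using inorder_splay_max[of t] by (metis fst_conv length_inorder size1_size)

lemma splay_max_right: "splay_max t = (Node l a r, c) \<Longrightarrow> r = Leaf"
  by (induction t arbitrary: l a r c rule: splay_max.induct) (auto split: tree.splits prod.splits)

lemma splay_max_Leaf: "splay_max t = (Leaf, c) \<Longrightarrow> t = Leaf \<and> c = 1"
  using inorder_splay_max[of t] by (metis fst_conv inorder.simps(1) eq_inorder_Nil prod.inject splay_max.simps(1))

text \<open>Along the right spine only zig-zig steps occur, followed by at most one zig at the
  bottom.\<close>

lemma splay_max_amortised:
  "splay_max t = (t', c) \<Longrightarrow> real c + splay_potential t' \<le> splay_potential t + 3 * rank t + 1"
proof (induction t arbitrary: t' c rule: splay_max.induct)
  case 1
  then show ?case by auto
next
  case (2 A a)
  then show ?case using rank_nonneg[of "Node A a Leaf"] by auto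
next
  case (3 A a B b R)
  note pos = size1_pos and ge = size1_ge_1
  obtain u k where u: "splay_max R = (u, k)" by fastforce
  show ?case
  proof (cases u)
    case Leaf
    then have "R = Leaf" "k = 1" using splay_max_Leaf u by auto
    then have "t' = Node (Node A a B) b Leaf" "c = 2" using 3 u by auto
    then show ?thesis
      using zig_cost[of 1 "real (size1 B)" "real (size1 A)"] ge[of B] ge[of A] \<open>R = Leaf\<close> by (simp add: add_ac)
  next
    case u': (Node C y D)
    have eq: "t' = Node (Node (Node A a B) b C) y D" "c = k + 1" using 3 u u' by auto
    have s: "real (size1 R) = real (size1 C) + real (size1 D)" using splay_max_size1[OF u] u' by simp
    have "real k + (splay_potential C + splay_potential D + rank R) \<le> splay_potential R + 3 * rank R + 1"
      using "3.IH"[OF u] s u' by simp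
    from zig_zig_cost[OF pos[of D] pos[of C] pos[of B] pos[of A]
        s[unfolded add.commute[of "real (size1 C)"]] this]
    show ?thesis using eq s by (simp add: add_ac)
  qed
qed

lemma splay_root:
  "fin_sorted (inorder t) \<Longrightarrow> x \<in> set_tree t \<Longrightarrow> \<exists>l r. fst (splay x t) = Node l x r"
proof (induction "size t" arbitrary: t rule: less_induct)
  case less
  then obtain L b R where t: "t = Node L b R" by (cases t) auto
  have ord: "\<And>y. y \<in> set_tree L \<Longrightarrow> fin y < fin b" "\<And>y. y \<in> set_tree R \<Longrightarrow> fin b < fin y"
    and sub: "fin_sorted (inorder L)" "fin_sorted (inorder R)"
    using less.prems by (auto simp: t fin_sorted_def sorted_wrt_append)
  consider "x = b" | "x \<in> set_tree L" | "x \<in> set_tree R" using less.prems t by auto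
  then show ?case
  proof cases
    case 1
    then show ?thesis by (simp add: t)
  next
    case 2
    then obtain A a B where L: "L = Node A a B" by (cases L) auto
    have ord': "\<And>y. y \<in> set_tree A \<Longrightarrow> fin y < fin a" "\<And>y. y \<in> set_tree B \<Longrightarrow> fin a < fin y"
      and sub': "fin_sorted (inorder A)" "fin_sorted (inorder B)"
      using sub(1) by (auto simp: L fin_sorted_def sorted_wrt_append)
    have "x = a \<or> x \<in> set_tree A \<and> (\<exists>l r. fst (splay x A) = Node l x r) \<or>
      x \<in> set_tree B \<and> (\<exists>l r. fst (splay x B) = Node l x r)"
      using less.hyps[of A] less.hyps[of B] sub' 2 by (auto simp: t L)
    then show ?thesis
      using ord(1)[OF 2] ord'(1)[of x] ord'(2)[of x] by (auto simp: t L split: prod.splits)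
  next
    case 3
    then obtain A a B where R: "R = Node A a B" by (cases R) auto
    have ord': "\<And>y. y \<in> set_tree A \<Longrightarrow> fin y < fin a" "\<And>y. y \<in> set_tree B \<Longrightarrow> fin a < fin y"
      and sub': "fin_sorted (inorder A)" "fin_sorted (inorder B)"
      using sub(2) by (auto simp: R fin_sorted_def sorted_wrt_append)
    have "x = a \<or> x \<in> set_tree A \<and> (\<exists>l r. fst (splay x A) = Node l x r) \<or>
      x \<in> set_tree B \<and> (\<exists>l r. fst (splay x B) = Node l x r)"
      using less.hyps[of A] less.hyps[of B] sub' 3 by (auto simp: t R)
    then show ?thesis
      using ord(2)[OF 3] ord'(1)[of x] ord'(2)[of x] by (auto simp: t R split: prod.splits)
  qed
qed

lemma split_at_correct:
  assumes "split_at x t = ((l, r), c)"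
  shows "inorder l @ inorder r = inorder t"
    and "fin_sorted (inorder t) \<Longrightarrow> x \<in> set_tree t \<Longrightarrow> \<exists>B. r = Node Leaf x B"
    and "real c + splay_potential l + splay_potential r \<le> splay_potential t + 3 * rank t + 1"
proof -
  obtain u where u: "splay x t = (u, c)" using assms by (auto simp: split_at_def split: prod.splits tree.splits)
  show "inorder l @ inorder r = inorder t"
    using assms u inorder_splay[of x t] by (auto simp: split_at_def split: tree.splits)
  show "\<exists>B. r = Node Leaf x B" if "fin_sorted (inorder t)" "x \<in> set_tree t"
    using assms u splay_root[OF that] by (auto simp: split_at_def)
  show "real c + splay_potential l + splay_potential r \<le> splay_potential t + 3 * rank t + 1"
  proof (cases u)
    case Leaf
    then show ?thesis using assms u splay_amortised[OF u] by (auto simp: split_at_def)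
  next
    case (Node A y B)
    have "rank (Node Leaf y B) \<le> rank (Node A y B)"
      using size1_ge_1[of A] size1_ge_1[of B] by (auto intro!: log_mono)
    then show ?thesis using assms u Node splay_amortised[OF u] by (auto simp: split_at_def)
  qed
qed

text \<open>After splaying its maximum, \<open>t\<close> has a root without right child. Hanging
  \<open>u\<close> there changes the rank of this root only, which accounts for
  \<open>rank v\<close>.\<close>

lemma join_correct:
  assumes "join t u = (v, c)"
  shows "inorder v = inorder t @ inorder u"
    and "real c + splay_potential v \<le> splay_potential t + splay_potential u + 3 * rank t + rank v + 1"
proof -
  obtain s where s: "splay_max t = (s, c)" using assms by (auto simp: join_def split: prod.splits tree.splits)
  show "inorder v = inorder t @ inorder u"
    using assms s inorder_splay_max[of t] splay_max_right[of t]
    by (auto simp: join_def split: tree.splits)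
  show "real c + splay_potential v \<le> splay_potential t + splay_potential u + 3 * rank t + rank v + 1"
  proof (cases s)
    case Leaf
    then show ?thesis using assms s splay_max_Leaf[of t c] rank_nonneg[of v] by (auto simp: join_def)
  next
    case (Node A y B)
    then have v: "v = Node A y u" "B = Leaf" using assms s splay_max_right[of t] by (auto simp: join_def)
    have "0 \<le> rank (Node A y Leaf)" by (rule rank_nonneg)
    then show ?thesis using splay_max_amortised[OF s] unfolding Node v splay_potential.simps
      by linarith
  qed
qed

text \<open>The second splay takes place in the left subtree of the first result, whose rank is at
  most \<open>rank t\<close>; so the access lemma is paid twice. An empty prefix \<open>as\<close>
  means that \<open>x\<close> is first on its path.\<close>

lemma predecessor_correct:
  assumes "predecessor x t = (p, u, c)"
  shows "inorder u = inorder t \<and> (fin_sorted (inorder t) \<longrightarrow> x \<in> set_tree t \<longrightarrow>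
      (\<exists>as bs. inorder t = as @ x # bs \<and> p = (if as = [] then None else Some (last as)))) \<and>
    real c + splay_potential u \<le> splay_potential t + 6 * rank t + 2"
proof -
  obtain s k where s: "splay x t = (s, k)" by fastforce
  note in_s = inorder_splay[of x t]
  show ?thesis
  proof (cases s)
    case Leaf
    then have "t = Leaf" using splay_eq_Leaf[of x t] s by simp
    then show ?thesis using assms by (auto simp: predecessor_def)
  next
    case s': (Node A y B)
    obtain A' k' where A': "splay_max A = (A', k')" by fastforce
    have in_A: "inorder A' = inorder A" using inorder_splay_max[of A] A' by simp
    have c: "c = k + k'" and u: "u = Node A' y B" and
      p: "p = (case A' of Leaf \<Rightarrow> None | Node A1 j A2 \<Rightarrow> Some j)"
      using assms s s' A' splay_max_Leaf[of A k']
      by (auto simp: predecessor_def split: tree.splits)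
    have p': "p = (if inorder A = [] then None else Some (last (inorder A)))"
    proof (cases A')
      case Leaf
      then show ?thesis using p in_A by simp
    next
      case (Node A1 j A2)
      then have "inorder A = inorder A1 @ [j]" using in_A splay_max_right[of A] A' by auto
      then show ?thesis using p Node by simp
    qed
    have root: "y = x" if "fin_sorted (inorder t)" "x \<in> set_tree t"
      using splay_root[OF that] s s' by simp
    have rA: "rank A \<le> rank t"
      using splay_size1[OF s] s' size1_ge_1[of A] by (intro log_mono) auto
    have "rank (Node A' y B) = rank (Node A y B)" using splay_max_size1[OF A'] by simp
    then have "real c + splay_potential u \<le> splay_potential t + 6 * rank t + 2"
      using rA splay_amortised[OF s] splay_max_amortised[OF A'] unfolding c u s' splay_potential.simps
      by linarith
    moreover have "inorder t = inorder A @ x # inorder B" if "fin_sorted (inorder t)" "x \<in> set_tree t"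
      using in_s s s' root[OF that] by simp
    moreover have "inorder u = inorder t" using in_s s s' in_A u by simp
    ultimately show ?thesis using p' by blast
  qed
qed

section \<open>Heavy edges of a forest\<close>

definition forest_rel :: "('a \<times> 'a) set \<Rightarrow> bool" where
  "forest_rel E \<longleftrightarrow> finite E \<and> single_valued E \<and> acyclic E"

text \<open>Edges point towards the root, so this is the size of the subtree below \<open>p\<close>,
  including \<open>p\<close>.\<close>

definition weight :: "('a \<times> 'a) set \<Rightarrow> 'a \<Rightarrow> nat" where
  "weight E p = card {v. (v, p) \<in> E\<^sup>*}"

text \<open>The heavy edges of Sleator and Tarjan: at most one child holds more than half of the
  descendants.\<close>

definition heavy :: "('a \<times> 'a) set \<Rightarrow> ('a \<times> 'a) set" where
  "heavy E = {(v, p) \<in> E. weight E p < 2 * weight E v}"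

lemma finite_descendants: "finite E \<Longrightarrow> finite {v. (v, p) \<in> E\<^sup>*}"
  by (rule finite_subset[of _ "insert p (Domain E)"]) (auto elim: converse_rtranclE simp: finite_Domain)

lemma weight_pos: "finite E \<Longrightarrow> 1 \<le> weight E p"
  using finite_descendants[of E p] unfolding weight_def
  by (metis (mono_tags, lifting) One_nat_def Suc_leI card_gt_0_iff empty_iff mem_Collect_eq rtrancl.rtrancl_refl)

lemma weight_mono: "finite E \<Longrightarrow> (v, p) \<in> E\<^sup>* \<Longrightarrow> weight E v \<le> weight E p"
  unfolding weight_def by (intro card_mono finite_descendants) (auto intro: rtrancl_trans)

lemma single_valued_confluent:
  assumes "single_valued E" "(x, y) \<in> E\<^sup>*" "(x, z) \<in> E\<^sup>*"
  shows "(y, z) \<in> E\<^sup>* \<or> (z, y) \<in> E\<^sup>*"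
  using assms(2,3)
proof (induction arbitrary: z rule: converse_rtrancl_induct)
  case base
  then show ?case by blast
next
  case (step x x')
  from step.prems step.hyps(1) show ?case
  proof (cases rule: converse_rtranclE)
    case base
    then show ?thesis using step.hyps by (meson converse_rtrancl_into_rtrancl)
  next
    case (step u)
    then have "u = x'" using assms(1) \<open>(x, x') \<in> E\<close> by (auto dest: single_valuedD)
    then show ?thesis using step \<open>\<And>z. (x', z) \<in> E\<^sup>* \<Longrightarrow> (y, z) \<in> E\<^sup>* \<or> (z, y) \<in> E\<^sup>*\<close> by blast
  qed
qed

text \<open>The edge out of \<open>v\<close> is unique, so a path from \<open>v\<close> to
  \<open>u\<close> would pass through \<open>p\<close> and close a cycle.\<close>

lemma sibling_not_ancestor:
  assumes "forest_rel E" "(v, p) \<in> E" "(u, p) \<in> E" "v \<noteq> u"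
  shows "(v, u) \<notin> E\<^sup>*"
proof
  assume "(v, u) \<in> E\<^sup>*"
  then obtain w where "(v, w) \<in> E" "(w, u) \<in> E\<^sup>*" using assms(4) by (auto elim: converse_rtranclE)
  then have "(p, u) \<in> E\<^sup>*" using assms by (auto simp: forest_rel_def dest: single_valuedD)
  then have "(p, p) \<in> E\<^sup>+" using assms(3) by (meson rtrancl_into_trancl1)
  then show False using assms(1) by (auto simp: forest_rel_def acyclic_def)
qed

lemma weight_siblings:
  assumes "forest_rel E" "(v, p) \<in> E" "(u, p) \<in> E" "v \<noteq> u"
  shows "weight E v + weight E u \<le> weight E p"
proof -
  have fin: "finite E" using assms by (simp add: forest_rel_def)
  have "{x. (x, v) \<in> E\<^sup>*} \<inter> {x. (x, u) \<in> E\<^sup>*} = {}"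
    using single_valued_confluent[of E _ v u] sibling_not_ancestor[OF assms]
      sibling_not_ancestor[OF assms(1,3,2)] assms(1,4) by (auto simp: forest_rel_def)
  then have "weight E v + weight E u = card ({x. (x, v) \<in> E\<^sup>*} \<union> {x. (x, u) \<in> E\<^sup>*})"
    using finite_descendants[OF fin] by (simp add: weight_def card_Un_disjoint)
  also have "\<dots> \<le> weight E p"
    unfolding weight_def using assms(2,3)
    by (intro card_mono finite_descendants fin) (auto intro: rtrancl_into_rtrancl)
  finally show ?thesis .
qed

lemma heavy_unique:
  assumes "forest_rel E" "(v, p) \<in> heavy E" "(u, p) \<in> heavy E"
  shows "v = u"
  using weight_siblings[of E v p u] assms by (fastforce simp: heavy_def)

text \<open>Every light edge at least doubles the weight. Keeping the factor
  \<open>weight E v\<close> makes this an induction from the roots downwards.\<close>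

lemma light_edges_on_path:
  assumes "forest_rel E" and N: "\<And>p. weight E p \<le> N"
  shows "2 ^ card {(a, b) \<in> E - heavy E. (v, a) \<in> E\<^sup>*} * weight E v \<le> N"
proof -
  have fin: "finite E" using assms by (simp add: forest_rel_def)
  have "wf (E\<inverse>)" using assms by (simp add: forest_rel_def finite_acyclic_wf_converse)
  then show ?thesis
  proof (induction v rule: wf_induct_rule)
    case (less v)
    let ?L = "\<lambda>v. {(a, b) \<in> E - heavy E. (v, a) \<in> E\<^sup>*}"
    have finL: "finite (?L v)" for v by (rule finite_subset[OF _ fin]) auto
    show ?case
    proof (cases "v \<in> Domain E")
      case False
      then have "?L v = {}" using False Not_Domain_rtrancl[OF False] by (auto simp: Domain_iff)
      then have "card (?L v) = 0" by (simp only: card.empty)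
      then show ?thesis using N[of v] by simp
    next
      case True
      then obtain p where p: "(v, p) \<in> E" by blast
      have sv: "single_valued E" using assms(1) by (simp add: forest_rel_def)
      have IH: "2 ^ card (?L p) * weight E p \<le> N" using less p by simp
      have step: "(v, a) \<in> E\<^sup>* \<longleftrightarrow> a = v \<or> (p, a) \<in> E\<^sup>*" for a
        using p sv by (metis converse_rtrancl_into_rtrancl converse_rtranclE rtrancl.rtrancl_refl single_valuedD)
      show ?thesis
      proof (cases "(v, p) \<in> heavy E")
        case True
        have "?L v \<subseteq> ?L p"
          using step p sv True by (auto dest: single_valuedD)
        then have "card (?L v) \<le> card (?L p)" by (intro card_mono finL)
        then have "2 ^ card (?L v) * weight E v \<le> 2 ^ card (?L p) * weight E p"
          using weight_mono[OF fin, of v p] p by (intro mult_mono power_increasing) auto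
        then show ?thesis using IH by linarith
      next
        case False
        have "?L v \<subseteq> insert (v, p) (?L p)"
          using step p sv by (auto dest: single_valuedD)
        then have "card (?L v) \<le> card (insert (v, p) (?L p))" by (intro card_mono finite.insertI finL)
        also have "\<dots> \<le> Suc (card (?L p))" using finL by (simp add: card_insert_if)
        finally have "2 ^ card (?L v) * weight E v \<le> 2 ^ Suc (card (?L p)) * weight E v"
          by (intro mult_right_mono power_increasing) auto
        also have "\<dots> = 2 ^ card (?L p) * (2 * weight E v)" by simp
        also have "\<dots> \<le> 2 ^ card (?L p) * weight E p"
          using False p by (intro mult_left_mono) (auto simp: heavy_def)
        finally show ?thesis using IH by linarith
      qed
    qed
  qed
qed

lemma card_light_edges_above:
  assumes "forest_rel E" "\<And>p. weight E p \<le> N" "finite C"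
  shows "real (card {(a, b) \<in> E - heavy E. a \<in> E\<^sup>* `` C}) \<le> real (card C) * log 2 (real N)"
proof -
  have fin: "finite E" using assms by (simp add: forest_rel_def)
  let ?L = "\<lambda>v. {(a, b) \<in> E - heavy E. (v, a) \<in> E\<^sup>*}"
  have finL: "finite (?L v)" for v by (rule finite_subset[OF _ fin]) auto
  have one: "real (card (?L v)) \<le> log 2 (real N)" for v
  proof -
    have "2 ^ card (?L v) * 1 \<le> 2 ^ card (?L v) * weight E v"
      using weight_pos[OF fin] by (intro mult_left_mono) auto
    then have "(2::nat) ^ card (?L v) \<le> N"
      using light_edges_on_path[OF assms(1,2), of v] by linarith
    then have "real (2 ^ card (?L v)) \<le> real N" by (rule of_nat_mono)
    then have "(2::real) ^ card (?L v) \<le> real N" by simp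
    then show ?thesis using weight_pos[OF fin, of v] assms(2)[of v] by (subst le_log_iff) (auto simp: powr_realpow)
  qed
  have "{(a, b) \<in> E - heavy E. a \<in> E\<^sup>* `` C} = (\<Union>v\<in>C. ?L v)" by auto
  then have "card {(a, b) \<in> E - heavy E. a \<in> E\<^sup>* `` C} \<le> (\<Sum>v\<in>C. card (?L v))"
    by (simp only:) (rule card_UN_le[OF assms(3)])
  then have "real (card {(a, b) \<in> E - heavy E. a \<in> E\<^sup>* `` C}) \<le> real (\<Sum>v\<in>C. card (?L v))"
    by (rule of_nat_mono)
  also have "\<dots> = (\<Sum>v\<in>C. real (card (?L v)))" by (rule of_nat_sum)
  also have "\<dots> \<le> real (card C) * log 2 (real N)" by (intro sum_bounded_above one)
  finally show ?thesis .
qed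

text \<open>If two forests differ only in the edges into \<open>C\<close>, then they have the same ancestors of
  \<open>C\<close>, and no other subtree changes its size.  A newly heavy edge into a proper ancestor of \<open>C\<close>
  either was a light edge on a path from \<open>C\<close>, or it now has a light sibling on such a path.\<close>

lemma new_heavy_edges:
  assumes E: "forest_rel E" "\<And>p. weight E p \<le> N" and E': "forest_rel E'" "\<And>p. weight E' p \<le> N"
    and C: "finite C" and eq: "\<And>v p. p \<notin> C \<Longrightarrow> (v, p) \<in> E \<longleftrightarrow> (v, p) \<in> E'"
  shows "real (card (heavy E' - heavy E)) \<le> real (card C) * (1 + 2 * log 2 (real N))"
proof -
  let ?A = "E\<^sup>* `` C"
  \<comment> \<open>Follow a path from \<open>C\<close>: an edge into \<open>C\<close> lets it start
    afresh at its target, and any other edge belongs to both relations.\<close>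
  have sub: "G\<^sup>* `` C \<subseteq> H\<^sup>* `` C" if "\<And>v p. p \<notin> C \<Longrightarrow> (v, p) \<in> G \<Longrightarrow> (v, p) \<in> H" for G H
  proof -
    have "a \<in> H\<^sup>* `` C" if "(c, a) \<in> G\<^sup>*" "c \<in> C" for c a
      using that
    proof (induction rule: rtrancl_induct)
      case base
      then show ?case by blast
    next
      case (step y z)
      then show ?case using \<open>\<And>v p. p \<notin> C \<Longrightarrow> (v, p) \<in> G \<Longrightarrow> (v, p) \<in> H\<close>
        by (cases "z \<in> C") (auto intro: rtrancl_into_rtrancl)
    qed
    then show ?thesis by auto
  qed
  have A: "?A = E'\<^sup>* `` C" using sub[of E E'] sub[of E' E] eq by blast
  \<comment> \<open>A path to a node that is not above \<open>C\<close> never enters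
    \<open>C\<close>, so all its edges are shared.\<close>
  have desc: "(v, p) \<in> H\<^sup>*" if "(v, p) \<in> G\<^sup>*" "p \<notin> G\<^sup>* `` C"
    "\<And>v p. p \<notin> C \<Longrightarrow> (v, p) \<in> G \<Longrightarrow> (v, p) \<in> H" for G H v p
    using that(1)
  proof (induction rule: converse_rtrancl_induct)
    case base
    then show ?case by blast
  next
    case (step y z)
    then have "z \<notin> C" using that(2) by auto
    then show ?case using step that(3) by (meson converse_rtrancl_into_rtrancl)
  qed
  have weight: "weight E p = weight E' p" if "p \<notin> ?A" for p
  proof -
    have "{v. (v, p) \<in> E\<^sup>*} = {v. (v, p) \<in> E'\<^sup>*}"
      using desc[of _ p E E'] desc[of _ p E' E] that A eq by blast
    then show ?thesis by (simp add: weight_def)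
  qed
  define T where "T = heavy E' - heavy E"
  define L where "L = {(a, b) \<in> E - heavy E. a \<in> ?A}"
  define L' where "L' = {(a, b) \<in> E' - heavy E'. a \<in> E'\<^sup>* `` C}"
  have fin: "finite L" "finite L'" "finite T"
    using E(1) E'(1) by (auto simp: L_def L'_def T_def heavy_def forest_rel_def intro: finite_subset)
  have sub: "snd ` T \<subseteq> C \<union> snd ` L \<union> snd ` L'"
  proof
    fix p assume "p \<in> snd ` T"
    then obtain v where v: "(v, p) \<in> heavy E'" "(v, p) \<notin> heavy E" by (auto simp: T_def)
    then have vE': "(v, p) \<in> E'" by (auto simp: heavy_def)
    show "p \<in> C \<union> snd ` L \<union> snd ` L'"
    proof (cases "p \<in> C")
      case False
      then have vE: "(v, p) \<in> E" using vE' eq by blast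
      show ?thesis
      proof (cases "v \<in> ?A")
        case True
        then have "(v, p) \<in> L" using vE v by (auto simp: L_def)
        then show ?thesis by force
      next
        case vA: False
        have "p \<in> ?A"
        proof (rule ccontr)
          assume "p \<notin> ?A"
          then have "(v, p) \<in> heavy E" using v(1) vE vA weight by (auto simp: heavy_def)
          then show False using v by blast
        qed
        then obtain c where "c \<in> C" "(c, p) \<in> E'\<^sup>*" using A by auto
        \<comment> \<open>\<open>q\<close> is the last node before \<open>p\<close> on a path from
          \<open>C\<close>. It lies above \<open>C\<close> while \<open>v\<close> does not, so it is
          a different child of \<open>p\<close>, and its edge is the light sibling.\<close>
        then obtain q where q: "(q, p) \<in> E'" "q \<in> E'\<^sup>* `` C" using False by (auto elim: rtranclE)
        then have "(q, p) \<notin> heavy E'" using heavy_unique[OF E'(1) v(1)] vA A by blast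
        then have "(q, p) \<in> L'" using q by (auto simp: L'_def)
        then show ?thesis by force
      qed
    qed simp
  qed
  \<comment> \<open>Heavy edges have distinct targets, so it was enough to locate the
    targets.\<close>
  have "inj_on snd T" using heavy_unique[OF E'(1)] by (force simp: inj_on_def T_def)
  then have "card T = card (snd ` T)" by (simp add: card_image)
  also have "\<dots> \<le> card (C \<union> snd ` L \<union> snd ` L')" using sub fin C by (intro card_mono) auto
  also have "\<dots> \<le> card C + card (snd ` L) + card (snd ` L')"
    by (intro order_trans[OF card_Un_le] add_mono card_Un_le order_refl)
  also have "\<dots> \<le> card C + card L + card L'" by (intro add_mono card_image_le fin order_refl)
  finally have "real (card T) \<le> real (card C) + real (card L) + real (card L')" by linarith
  also have "\<dots> \<le> real (card C) * (1 + 2 * log 2 (real N))"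
    using card_light_edges_above[OF E C] card_light_edges_above[OF E' C]
    by (simp add: L_def L'_def algebra_simps)
  finally show ?thesis by (simp add: T_def)
qed

section \<open>The graph of the compatibility forest\<close>

definition valid :: "interval set \<Rightarrow> bool" where
  "valid I \<longleftrightarrow> finite I \<and> (\<forall>i\<in>I. start i < fin i) \<and> inj_on fin I"

text \<open>For intervals, starting after \<open>fin i\<close> amounts to finishing later and being
  compatible, by \<open>compatible_after\<close>; this form matches
  \<open>right_compatible\<close>.\<close>

definition edges :: "interval set \<Rightarrow> (interval \<times> interval) set" where
  "edges I = {(i, j). i \<in> I \<and> least_fin {k \<in> I. fin i < start k} j}"

lemma valid_subset: "valid I \<Longrightarrow> J \<subseteq> I \<Longrightarrow> valid J"
  by (auto simp: valid_def intro: finite_subset inj_on_subset)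

lemma least_fin_unique: "inj_on fin I \<Longrightarrow> A \<subseteq> I \<Longrightarrow> least_fin A i \<Longrightarrow> least_fin A j \<Longrightarrow> i = j"
  by (metis inj_on_contraD least_fin_def order_antisym subsetD)

lemma edges_in: "(v, p) \<in> edges I \<Longrightarrow> v \<in> I \<and> p \<in> I \<and> fin v < start p"
  by (auto simp: edges_def least_fin_def)

lemma edges_fin: "valid I \<Longrightarrow> (v, p) \<in> edges I \<Longrightarrow> fin v < fin p"
  using edges_in[of v p I] by (force simp: valid_def)

lemma forest_edges: "valid I \<Longrightarrow> forest_rel (edges I)"
proof -
  assume I: "valid I"
  have "edges I \<subseteq> I \<times> I" using edges_in by auto
  then have "finite (edges I)" using I by (auto simp: valid_def intro: finite_subset)
  moreover have "single_valued (edges I)"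
    using I least_fin_unique[of I] unfolding single_valued_def edges_def valid_def
    by (smt (verit) case_prodD mem_Collect_eq subsetI)
  moreover have "acyclic (edges I)"
  proof -
    have "fin v < fin p" if "(v, p) \<in> (edges I)\<^sup>+" for v p
      using that by (induction rule: trancl_induct) (auto dest: edges_fin[OF I])
    then show ?thesis by (force simp: acyclic_def)
  qed
  ultimately show ?thesis by (simp add: forest_rel_def)
qed

lemma reachable_in: "(v, p) \<in> (edges I)\<^sup>* \<Longrightarrow> v = p \<or> v \<in> I \<and> p \<in> I"
  by (induction rule: rtrancl_induct) (auto dest: edges_in)

lemma weight_edges: "valid I \<Longrightarrow> weight (edges I) p \<le> card I + 1"
proof -
  assume I: "valid I"
  have "weight (edges I) p \<le> card (insert p I)"
    unfolding weight_def using reachable_in[of _ p I] I by (intro card_mono) (auto simp: valid_def)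
  also have "\<dots> \<le> card I + 1" using I by (simp add: valid_def card_insert_if)
  finally show ?thesis .
qed

lemma compatible_after:
  "start i < fin i \<Longrightarrow> start k < fin k \<Longrightarrow> fin i < fin k \<and> compatible i k \<longleftrightarrow> fin i < start k"
  by (auto simp: compatible_def)

lemma greedy_reachable:
  assumes I: "valid I" and m: "least_fin I m"
  shows "greedy I = (edges I)\<^sup>* `` {m}"
proof -
  have step: "i \<in> I \<Longrightarrow> {j \<in> I. fin i < fin j \<and> compatible i j} = {k \<in> I. fin i < start k}" for i
    using I compatible_after[of i] by (auto simp: valid_def)
  have "i \<in> I \<and> i \<in> (edges I)\<^sup>* `` {m}" if "i \<in> greedy I" for i
    using that
  proof (induction rule: greedy.induct)
    case (greedy_first i)
    then have "i = m" using I m least_fin_unique[of I I] by (simp add: valid_def)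
    then show ?case using greedy_first by (auto simp: least_fin_def)
  next
    case (greedy_next i j)
    then have "(i, j) \<in> edges I" using step by (simp add: edges_def)
    then show ?case using greedy_next edges_in by (auto intro: rtrancl_into_rtrancl)
  qed
  moreover have "i \<in> greedy I" if "(m, i) \<in> (edges I)\<^sup>*" for i
    using that
  proof (induction rule: rtrancl_induct)
    case base
    show ?case using m by (rule greedy.greedy_first)
  next
    case (step y z)
    then have "least_fin {j \<in> I. fin y < fin j \<and> compatible y j} z"
      using \<open>\<And>i. i \<in> I \<Longrightarrow> _\<close>[of y] by (simp add: edges_def)
    then show ?case using step.IH by (rule greedy.greedy_next[rotated])
  qed
  ultimately show ?thesis by blast
qed

section \<open>Edges that change when an interval is inserted\<close>

definition covering :: "interval \<Rightarrow> interval set \<Rightarrow> interval set" where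
  "covering i I = {k \<in> I. start k \<le> start i \<and> fin i \<le> fin k}"

definition noncovering_after :: "interval \<Rightarrow> interval set \<Rightarrow> interval set" where
  "noncovering_after i I = {k \<in> I. start i < start k \<and> fin i < fin k}"

lemma edges_remove:
  "(v, p) \<in> edges I \<Longrightarrow> v \<noteq> i \<Longrightarrow> p \<noteq> i \<Longrightarrow> (v, p) \<in> edges (I - {i})"
  by (auto simp: edges_def least_fin_def)

text \<open>The edge is lost because \<open>i\<close> starts after \<open>v\<close> and finishes
  before \<open>p\<close>. If \<open>p\<close> does not cover \<open>i\<close>, then every interval
  that comes after \<open>i\<close> without covering it also starts after \<open>v\<close> finishes,
  hence competes for the edge out of \<open>v\<close>, and \<open>p\<close> must be the first of
  them. This is why \<open>insertCF\<close> inspects just these nodes.\<close>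

lemma edges_insert_lost:
  assumes I: "valid (insert i I)" "i \<notin> I" and vp: "(v, p) \<in> edges I" "(v, p) \<notin> edges (insert i I)"
  shows "compatible v i" "p \<in> covering i I \<or> least_fin (noncovering_after i I) p"
proof -
  have p: "least_fin {k \<in> I. fin v < start k} p" "v \<in> I" using vp by (auto simp: edges_def)
  have "\<not> least_fin {k \<in> insert i I. fin v < start k} p" using vp p by (simp add: edges_def)
  with p have i: "fin v < start i" "fin i < fin p" by (auto simp: least_fin_def)
  then show "compatible v i" by (simp add: compatible_def)
  show "p \<in> covering i I \<or> least_fin (noncovering_after i I) p"
  proof (cases "start p \<le> start i")
    case True
    then show ?thesis using p i by (auto simp: covering_def least_fin_def)
  next
    case False
    have "fin p \<le> fin k" if "k \<in> noncovering_after i I" for k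
      using that p(1) less_trans[OF i(1), of "start k"] unfolding noncovering_after_def least_fin_def by blast
    then have "least_fin (noncovering_after i I) p"
      using False p(1) i(2) by (simp add: noncovering_after_def least_fin_def)
    then show ?thesis by blast
  qed
qed

lemma card_least_fin:
  assumes "inj_on fin I" "A \<subseteq> I"
  shows "card {j. least_fin A j} \<le> 1 \<and> finite {j. least_fin A j}"
proof (cases "\<exists>x. least_fin A x")
  case True
  then obtain x where "least_fin A x" by blast
  then have "{j. least_fin A j} = {x}" using least_fin_unique[OF assms] by blast
  then show ?thesis by simp
next
  case False
  then have "{j. least_fin A j} = {}" by blast
  then show ?thesis by (simp only:) simp
qed

text \<open>Lost edges lead into \<open>covering i I\<close> or into the next noncovering interval.
  A new edge either leads into \<open>i\<close> or leaves it for its right compatible interval. The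
  covering intervals and \<open>i\<close> itself all contain \<open>fin i\<close>, so together they
  number at most \<open>D\<close>.\<close>

lemma edges_insert:
  assumes I: "valid (insert i I)" "i \<notin> I"
    and D: "\<And>x. card {j \<in> insert i I. contains j x} \<le> D"
  obtains C where "finite C" "card C \<le> D + 2"
    "\<And>v p. p \<notin> C \<Longrightarrow> (v, p) \<in> edges I \<longleftrightarrow> (v, p) \<in> edges (insert i I)"
proof -
  let ?J = "insert i I"
  define A where "A = {j \<in> ?J. contains j (fin i)}"
  define B where "B = {j. least_fin (noncovering_after i I) j}"
  define P where "P = {j. least_fin {k \<in> ?J. fin i < start k} j}"
  have inj: "inj_on fin ?J" "finite ?J" "start i < fin i" using I by (auto simp: valid_def)
  have "finite A" "card A \<le> D" using inj D by (auto simp: A_def)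
  moreover have "finite B" "card B \<le> 1" "finite P" "card P \<le> 1"
    using card_least_fin[OF inj(1), of "noncovering_after i I"]
      card_least_fin[OF inj(1), of "{k \<in> ?J. fin i < start k}"]
    by (auto simp: B_def P_def noncovering_after_def)
  ultimately have C: "finite (A \<union> B \<union> P)" "card (A \<union> B \<union> P) \<le> D + 2"
    using card_Un_le[of A B] card_Un_le[of "A \<union> B" P] by auto
  have cov: "covering i I \<subseteq> A" "i \<in> A"
    using inj(3) by (auto simp: covering_def A_def contains_def)
  have eq: "(v, p) \<in> edges I \<longleftrightarrow> (v, p) \<in> edges ?J" if p: "p \<notin> A \<union> B \<union> P" for v p
  proof
    assume "(v, p) \<in> edges I"
    then show "(v, p) \<in> edges ?J" using edges_insert_lost[OF I, of v p] cov p by (auto simp: B_def)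
  next
    assume vp: "(v, p) \<in> edges ?J"
    then have "v \<noteq> i" "p \<noteq> i" using p cov by (auto simp: P_def edges_def)
    then show "(v, p) \<in> edges I" using edges_remove[OF vp, of i] I by simp
  qed
  show thesis by (rule that[OF C]) (rule eq)
qed

section \<open>Solid paths\<close>

fun pairs :: "'a list \<Rightarrow> ('a \<times> 'a) set" where
  "pairs (x # y # zs) = insert (x, y) (pairs (y # zs))"
| "pairs _ = {}"

lemma pairs_append:
  "xs \<noteq> [] \<Longrightarrow> ys \<noteq> [] \<Longrightarrow> pairs (xs @ ys) = pairs xs \<union> insert (last xs, hd ys) (pairs ys)"
proof (induction xs rule: pairs.induct)
  case ("2_2" x)
  then show ?case by (cases ys) auto
qed auto

text \<open>As inclusions these hold for empty lists, too: the unspecified \<open>last []\<close> or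
  \<open>hd []\<close> then only adds some pair to the larger side.\<close>

lemma pairs_split:
  "pairs xs \<union> pairs (y # ys) \<subseteq> pairs (xs @ y # ys)"
  "pairs (xs @ y # ys) \<subseteq> insert (last xs, y) (pairs xs \<union> pairs (y # ys))"
  "pairs ys \<subseteq> pairs (y # ys)" "pairs (y # ys) \<subseteq> insert (y, hd ys) (pairs ys)"
proof -
  have "pairs (xs @ y # ys) = pairs xs \<union> insert (last xs, y) (pairs (y # ys))" if "xs \<noteq> []"
    using pairs_append[OF that, of "y # ys"] by simp
  then show "pairs xs \<union> pairs (y # ys) \<subseteq> pairs (xs @ y # ys)"
    "pairs (xs @ y # ys) \<subseteq> insert (last xs, y) (pairs xs \<union> pairs (y # ys))"
    by (cases "xs = []"; simp; blast)+
  show "pairs ys \<subseteq> pairs (y # ys)" "pairs (y # ys) \<subseteq> insert (y, hd ys) (pairs ys)"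
    by (cases ys; simp; blast)+
qed

lemma pairs_in: "(a, b) \<in> pairs xs \<Longrightarrow> a \<in> set xs \<and> b \<in> set (tl xs)"
  by (induction xs rule: pairs.induct) auto

lemma pairs_in_set: "(a, b) \<in> pairs xs \<Longrightarrow> a \<in> set xs \<and> b \<in> set xs"
  by (induction xs rule: pairs.induct) auto

lemma pairs_fin_sorted:
  "pairs xs \<subseteq> E \<Longrightarrow> (\<And>a b. (a, b) \<in> E \<Longrightarrow> fin a < fin b) \<Longrightarrow> fin_sorted xs"
proof (induction xs rule: pairs.induct)
  case (1 x y zs)
  then have "fin_sorted (y # zs)" "fin x < fin y" by auto
  then show ?case by (auto simp: fin_sorted_def dest: less_trans)
qed (auto simp: fin_sorted_def)

lemma pairs_reachable:
  "pairs (x # xs) \<subseteq> E \<Longrightarrow> y \<in> set (x # xs) \<Longrightarrow> (x, y) \<in> E\<^sup>*"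
proof (induction xs arbitrary: x)
  case (Cons z zs)
  then show ?case by (auto intro: converse_rtrancl_into_rtrancl)
qed auto

text \<open>Outgoing edges are unique, so the path cannot be left on the way, and it cannot be
  prolonged at its end.\<close>

lemma maximal_path_reachable:
  "pairs (x # xs) \<subseteq> E \<Longrightarrow> single_valued E \<Longrightarrow> last (x # xs) \<notin> Domain E \<Longrightarrow> E\<^sup>* `` {x} = set (x # xs)"
proof (induction xs arbitrary: x)
  case Nil
  then show ?case using Not_Domain_rtrancl[of x E] by auto
next
  case (Cons z zs)
  then have "(x, z) \<in> E" by auto
  then have "E\<^sup>* `` {x} = insert x (E\<^sup>* `` {z})"
    using Cons.prems(2) by (auto elim: converse_rtranclE dest: single_valuedD intro: converse_rtrancl_into_rtrancl)
  then show ?case using Cons by auto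
qed

section \<open>Families of solid paths\<close>

definition elems :: "stree list \<Rightarrow> interval list" where
  "elems F = concat (map inorder F)"

definition solid :: "stree list \<Rightarrow> (interval \<times> interval) set" where
  "solid F = (\<Union>t\<in>set F. pairs (inorder t))"

definition paths_potential :: "stree list \<Rightarrow> real" where
  "paths_potential F = sum_list (map splay_potential F)"

text \<open>\<open>E\<close> and \<open>I\<close> are independent, since an insertion passes through
  a stage in which the elements are new and the edges old.\<close>

definition paths_ok :: "(interval \<times> interval) set \<Rightarrow> interval set \<Rightarrow> stree list \<Rightarrow> bool" where
  "paths_ok E I F \<longleftrightarrow> distinct (elems F) \<and> set (elems F) = I \<and> solid F \<subseteq> E"

lemma elems_Cons [simp]: "elems (t # F) = inorder t @ elems F"
  and solid_Cons [simp]: "solid (t # F) = pairs (inorder t) \<union> solid F"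
  and paths_potential_Cons [simp]: "paths_potential (t # F) = splay_potential t + paths_potential F"
  by (auto simp: elems_def solid_def paths_potential_def)

lemma elems_add_tree [simp]: "elems (add_tree t F) = inorder t @ elems F"
  and solid_add_tree [simp]: "solid (add_tree t F) = pairs (inorder t) \<union> solid F"
  and paths_potential_add_tree [simp]:
    "paths_potential (add_tree t F) = splay_potential t + paths_potential F"
  by (auto simp: add_tree_def)

lemma solid_in: "(a, b) \<in> solid F \<Longrightarrow> a \<in> set (elems F) \<and> b \<in> set (elems F)"
  by (induction F) (auto simp: elems_def solid_def dest: pairs_in_set)

lemma paths_potential_nonneg: "0 \<le> paths_potential F"
  unfolding paths_potential_def by (intro sum_list_nonneg) (auto simp: potential_nonneg)

lemma mset_elems: "mset F = mset G \<Longrightarrow> mset (elems F) = mset (elems G)"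
proof -
  have "mset (elems F) = (\<Sum>t\<in>#mset F. mset (inorder t))" for F
    by (induction F) (auto simp: elems_def)
  then show "mset F = mset G \<Longrightarrow> mset (elems F) = mset (elems G)" by simp
qed

lemma paths_potential_mset: "mset F = mset G \<Longrightarrow> paths_potential F = paths_potential G"
proof -
  have "paths_potential F = (\<Sum>t\<in>#mset F. splay_potential t)" for F
    by (induction F) (auto simp: paths_potential_def)
  then show "mset F = mset G \<Longrightarrow> paths_potential F = paths_potential G" by simp
qed

lemma solid_mset: "mset F = mset G \<Longrightarrow> solid F = solid G"
  by (auto simp: solid_def dest: mset_eq_setD)

lemma tree_of_split:
  assumes "i \<in> set (elems F)"
  shows "i \<in> set_tree (tree_of i F)" "mset F = mset (tree_of i F # without i F)"
proof -
  obtain t where t: "find (\<lambda>t. i \<in> set_tree t) F = Some t"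
    using assms by (cases "find (\<lambda>t. i \<in> set_tree t) F") (auto simp: elems_def find_None_iff)
  then have "i \<in> set_tree t" by (auto simp: find_Some_iff)
  then show i: "i \<in> set_tree (tree_of i F)" by (simp add: tree_of_def t)
  then have "tree_of i F \<noteq> Leaf" by auto
  then show "mset F = mset (tree_of i F # without i F)"
    using tree_of_in[of i F] by (simp add: without_def)
qed

lemma tree_of_unique:
  assumes "distinct (elems F)" "u \<in> set F" "i \<in> set_tree u"
  shows "tree_of i F = u"
  using assms
proof (induction F)
  case (Cons t F)
  then show ?case
    by (cases "i \<in> set_tree t") (fastforce simp: tree_of_def elems_def)+
qed simp

lemma paths_ok_split:
  assumes "paths_ok E I F" "i \<in> I"
  shows "i \<in> set_tree (tree_of i F)" "paths_ok E I (tree_of i F # without i F)"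
    "solid F = solid (tree_of i F # without i F)"
    "paths_potential F = paths_potential (tree_of i F # without i F)"
proof -
  have "i \<in> set (elems F)" using assms by (simp add: paths_ok_def)
  note s = tree_of_split[OF this]
  show "i \<in> set_tree (tree_of i F)" by (rule s)
  show "solid F = solid (tree_of i F # without i F)" by (rule solid_mset[OF s(2)])
  then show "paths_ok E I (tree_of i F # without i F)"
    using assms(1) mset_eq_setD[OF mset_elems[OF s(2)]] mset_eq_imp_distinct_iff[OF mset_elems[OF s(2)]]
    by (simp add: paths_ok_def)
  show "paths_potential F = paths_potential (tree_of i F # without i F)"
    by (rule paths_potential_mset[OF s(2)])
qed

section \<open>Exposing and cutting paths\<close>

definition lg :: "interval set \<Rightarrow> real" where
  "lg I = log 2 (real (card I) + 2)"

lemma lg_ge_1: "1 \<le> lg I"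
  unfolding lg_def by (subst one_le_log_cancel_iff) auto

lemma rank_le_lg:
  assumes "paths_ok E I (t # F)" "finite I"
  shows "rank t \<le> lg I"
proof -
  have "size t = card (set_tree t)"
    using assms(1) distinct_card[of "inorder t"] by (simp add: paths_ok_def)
  also have "\<dots> \<le> card I" using assms by (intro card_mono) (auto simp: paths_ok_def)
  finally show ?thesis unfolding lg_def by (intro log_mono) (auto simp: size1_size)
qed

lemma paths_ok_fin_sorted:
  assumes "paths_ok E I (t # F)" "\<And>a b. (a, b) \<in> E \<Longrightarrow> fin a < fin b"
  shows "fin_sorted (inorder t)"
  using assms pairs_fin_sorted[of "inorder t" E] by (auto simp: paths_ok_def)

lemma fin_sorted_last:
  "fin_sorted xs \<Longrightarrow> x \<in> set xs \<Longrightarrow> fin x \<le> fin (last xs)"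
proof (induction xs)
  case (Cons a xs)
  then show ?case by (cases "xs = []") (auto simp: fin_sorted_def intro: less_imp_le)
qed simp

text \<open>In an exposure, \<open>q\<close> is the end of the path after joining. Its logarithmic
  weight grows by at least one with every light edge that is made solid.\<close>

lemma weight_step:
  assumes E: "forest_rel E" and vp: "(v, p) \<in> E" and pq: "(p, q) \<in> E\<^sup>*"
  shows "log 2 (real (weight E v)) + (if (v, p) \<in> heavy E then 0 else 1) \<le> log 2 (real (weight E q))"
proof -
  have fin: "finite E" using E by (simp add: forest_rel_def)
  have pos: "1 \<le> weight E v" by (rule weight_pos[OF fin])
  have q: "weight E p \<le> weight E q" by (rule weight_mono[OF fin pq])
  have p: "weight E v \<le> weight E p" by (rule weight_mono[OF fin]) (use vp in auto)
  show ?thesis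
  proof (cases "(v, p) \<in> heavy E")
    case True
    then show ?thesis using pos p q by (auto intro!: log_mono)
  next
    case False
    then have "2 * weight E v \<le> weight E q" using vp q by (auto simp: heavy_def)
    then have "log 2 (2 * real (weight E v)) \<le> log 2 (real (weight E q))"
      using pos by (intro log_mono) auto
    then show ?thesis using False pos by (simp add: log_mult_pos)
  qed
qed

text \<open>Since a node has at most one heavy child, giving \<open>p\<close> the solid child \<open>j\<close> costs a heavy solid
  edge only if the edge from \<open>j\<close> is light.\<close>

lemma dashed_heavy_switch:
  assumes E: "forest_rel E" and jp: "(j, p) \<in> E" "(j, p) \<notin> S"
    and S': "(j, p) \<in> S'" "S \<subseteq> insert (x, p) S'"
  shows "real (card (heavy E - S')) + 1 \<le> real (card (heavy E - S)) + (if (j, p) \<in> heavy E then 0 else 2)"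
proof -
  have fin: "finite (heavy E)"
    using E by (auto simp: forest_rel_def heavy_def intro: finite_subset)
  show ?thesis
  proof (cases "(j, p) \<in> heavy E")
    case True
    have "heavy E - S' \<subseteq> (heavy E - S) - {(j, p)}"
      using heavy_unique[OF E True, of x] S' by auto
    then have "card (heavy E - S') \<le> card ((heavy E - S) - {(j, p)})" using fin by (intro card_mono) auto
    also have "\<dots> < card (heavy E - S)" using fin True jp by (intro card_Diff1_less) auto
    finally show ?thesis using True by simp
  next
    case False
    \<comment> \<open>Only the former solid edge into \<open>p\<close> can have become dashed. With
      the unit on the left-hand side of the claim this makes 2.\<close>
    have "heavy E - S' \<subseteq> insert (x, p) (heavy E - S)" using S' by auto
    then have "card (heavy E - S') \<le> card (insert (x, p) (heavy E - S))" using fin by (intro card_mono) auto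
    also have "\<dots> \<le> Suc (card (heavy E - S))" using fin by (simp add: card_insert_if)
    finally show ?thesis using False by simp
  qed
qed

definition exposed :: "interval set \<Rightarrow> stree list \<Rightarrow> bool" where
  "exposed I F \<longleftrightarrow>
     (\<forall>m. least_fin I m \<longrightarrow> (\<exists>u\<in>set F. m \<in> set_tree u \<and> last (inorder u) \<notin> Domain (edges I)))"

text \<open>The factor \<open>16 * lg I\<close> pays for one iteration of
  \<open>expose_loop\<close>, which costs at most \<open>13 * lg I + 3\<close>.\<close>

definition potential :: "interval set \<Rightarrow> stree list \<Rightarrow> real" where
  "potential I F = paths_potential F + 16 * lg I * real (card (heavy (edges I) - solid F))"

locale schedule =
  fixes I :: "interval set" and T :: avl
  assumes valid_I: "valid I" and T: "search_tree T" "avl_set T = I"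
begin

abbreviation E :: "(interval \<times> interval) set" where "E \<equiv> edges I"

lemma finite_I: "finite I" and forest_E: "forest_rel E"
  using valid_I forest_edges by (auto simp: valid_def)

lemma single_valued_E: "single_valued E" and finite_E: "finite E"
  using forest_E by (auto simp: forest_rel_def)

lemma ht_T: "real (ht T) + 1 \<le> 3 * lg I"
proof -
  have "log 2 (real (card I) + 1) \<le> lg I" unfolding lg_def by (intro log_mono) auto
  then show ?thesis using search_tree_height[OF T(1)] lg_ge_1[of I] unfolding T(2) by linarith
qed

lemma log_weight_le: "log 2 (real (weight E p)) \<le> lg I"
  unfolding lg_def using weight_edges[OF valid_I, of p] weight_pos[OF finite_E, of p] by (intro log_mono) auto

lemma right_compatible_edges:
  assumes "right_compatible j T = (r, c)" "j \<in> I"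
  shows "r = None \<Longrightarrow> j \<notin> Domain E" "r = Some p \<Longrightarrow> (j, p) \<in> E" "real c \<le> 3 * lg I"
  using right_compatible_correct[OF T(1) assms(1)] assms(2) ht_T
  by (auto simp: edges_def least_fin_def T(2))

text \<open>In units of \<open>16 * lg I\<close>: an iteration along a heavy edge is paid by a
  dashed heavy edge that becomes solid. One along a light edge costs a unit and may create one
  dashed heavy edge; both are paid by the doubled weight at the end of the path, whence the factor
  2. The remaining unit pays for the last iteration, which finds no edge. The induction is on the
  total size outside \<open>t\<close>, as the number of trees need not shrink.\<close>

lemma expose_loop_correct:
  "expose_loop T t F = (F', c) \<Longrightarrow> paths_ok E I (t # F) \<Longrightarrow> t \<noteq> Leaf \<Longrightarrow>
    paths_ok E I F' \<and> (\<exists>u\<in>set F'. set_tree t \<subseteq> set_tree u \<and> last (inorder u) \<notin> Domain E) \<and>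
    real c + potential I F' \<le> potential I (t # F) +
      16 * lg I * (1 + 2 * (lg I - log 2 (real (weight E (last (inorder t))))))"
proof (induction "sum_list (map size F)" arbitrary: t F F' c rule: less_induct)
  case less
  note ok = less.prems(2)
  define M where "M = 16 * lg I"
  have M: "16 \<le> M" "M = 16 * lg I" using lg_ge_1[of I] by (auto simp: M_def)
  obtain s c0 where s: "splay_max t = (s, c0)" by fastforce
  have in_s: "inorder s = inorder t" using inorder_splay_max[of t] s by simp
  obtain A j B where s': "s = Node A j B"
    using in_s less.prems(3) by (cases s) auto
  have "B = Leaf" using splay_max_right s s' by auto
  then have in_t: "inorder t = inorder A @ [j]" using in_s s' by simp
  have "j \<in> I" using ok in_t by (auto simp: paths_ok_def)
  obtain r c1 where r: "right_compatible j T = (r, c1)" by fastforce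
  note rc = right_compatible_edges[OF r \<open>j \<in> I\<close>]
  have cost0: "real c0 + splay_potential s \<le> splay_potential t + 3 * lg I + 1"
    using splay_max_amortised[OF s] rank_le_lg[OF ok finite_I] by linarith
  show ?case
  proof (cases r)
    case None
    then have eq: "F' = s # F" "c = c0 + c1"
      using less.prems(1) r s s' by (subst (asm) expose_loop.simps; simp)+
    have "0 \<le> M * (2 * (lg I - log 2 (real (weight E (last (inorder t))))))"
      using M(1) log_weight_le[of "last (inorder t)"] by (intro mult_nonneg_nonneg) auto
    then have "real c0 + splay_potential s + real c1 \<le> splay_potential t +
        M * (1 + 2 * (lg I - log 2 (real (weight E (last (inorder t))))))"
      using cost0 rc(3) lg_ge_1[of I] M(2) by (simp add: distrib_left)
    moreover have "paths_ok E I (s # F)" "solid (s # F) = solid (t # F)"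
      using ok by (simp_all add: paths_ok_def in_s)
    moreover have "set_tree t = set_tree s" by (metis in_s set_inorder)
    moreover have "last (inorder s) \<notin> Domain E" using rc(1)[OF None] in_t in_s by simp
    ultimately show ?thesis unfolding eq M_def[symmetric] potential_def by simp
  next
    case (Some p)
    have jp: "(j, p) \<in> E" by (rule rc(2)[OF Some])
    then have p: "p \<in> I" "fin j < fin p" using edges_in[OF jp] edges_fin[OF valid_I jp] by auto
    have sorted: "fin_sorted (inorder t)"
      by (rule paths_ok_fin_sorted[OF ok]) (rule edges_fin[OF valid_I])
    \<comment> \<open>\<open>j\<close> finishes last on the current path and \<open>p\<close>
      finishes later still, so the edge leaves the path.\<close>
    have "p \<notin> set_tree t"
      using fin_sorted_last[OF sorted, of p] p(2) in_t by (metis last_snoc not_le set_inorder)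
    then have pF: "p \<in> set (elems F)" using ok p by (auto simp: paths_ok_def)
    have "paths_ok E (set (elems F)) F" using ok by (simp add: paths_ok_def)
    define v where "v = tree_of p F"
    define G where "G = without p F"
    note sp = paths_ok_split[OF \<open>paths_ok E (set (elems F)) F\<close> pF, folded v_def G_def]
    have solF: "solid F = pairs (inorder v) \<union> solid G" and
      potF: "paths_potential F = splay_potential v + paths_potential G" and vne: "v \<noteq> Leaf"
      using sp by auto
    have dist: "distinct (inorder t @ inorder v @ elems G)" and setI: "set (inorder t @ inorder v @ elems G) = I"
      using ok sp(2) by (auto simp: paths_ok_def)
    obtain l r' c2 where sa: "split_at p v = ((l, r'), c2)" by (metis prod.collapse)
    obtain t' c3 where jn: "join s r' = (t', c3)" by fastforce
    obtain c4 where el: "expose_loop T t' (add_tree l G) = (F', c4)" "c = c0 + c1 + c2 + c3 + c4"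
      using less.prems(1) r s s' Some sa jn vne unfolding v_def G_def
      by (subst (asm) expose_loop.simps) (auto split: prod.splits)
    have okv: "paths_ok E I (v # t # G)"
      using dist setI ok solF by (auto simp: paths_ok_def)
    have sorted_v: "fin_sorted (inorder v)"
      by (rule paths_ok_fin_sorted[OF okv]) (rule edges_fin[OF valid_I])
    obtain B' where r': "r' = Node Leaf p B'" using split_at_correct(2)[OF sa sorted_v sp(1)] by blast
    have in_v: "inorder v = inorder l @ inorder r'" using split_at_correct(1)[OF sa] by simp
    have in_t': "inorder t' = inorder t @ inorder r'" using join_correct(1)[OF jn] in_s by simp
    have pairs_t': "pairs (inorder t') = pairs (inorder t) \<union> insert (j, p) (pairs (inorder r'))"
      using pairs_append[of "inorder t" "inorder r'"] in_t r' unfolding in_t' by simp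
    have pairs_v: "pairs (inorder l) \<union> pairs (inorder r') \<subseteq> pairs (inorder v)"
      "pairs (inorder v) \<subseteq> insert (last (inorder l), p) (pairs (inorder l) \<union> pairs (inorder r'))"
      using pairs_split(1,2)[of "inorder l" p "inorder B'"] unfolding in_v r' by simp_all
    have ok': "paths_ok E I (t' # add_tree l G)"
    proof -
      have el': "elems (t' # add_tree l G) = inorder t @ inorder r' @ inorder l @ elems G"
        by (simp add: in_t')
      have "distinct (elems (t' # add_tree l G))" "set (elems (t' # add_tree l G)) = I"
        using dist setI unfolding el' in_v by auto
      moreover have "solid (t' # add_tree l G) \<subseteq> E"
        using ok jp pairs_v(1) unfolding paths_ok_def solid_Cons solid_add_tree pairs_t' solF by blast
      ultimately show ?thesis by (simp add: paths_ok_def)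
    qed
    have "t' \<noteq> Leaf" using in_t' in_t by (metis Nil_is_append_conv append_is_Nil_conv inorder.simps(1) not_Cons_self2)
    have smaller: "sum_list (map size (add_tree l G)) < sum_list (map size F)"
      using size_without[of p F] size_split_at[OF sa vne] vne unfolding v_def G_def
      by (simp add: add_tree_def)
    note IH = less.hyps[OF smaller el(1) ok' \<open>t' \<noteq> Leaf\<close>]
    define w where "w = log 2 (real (weight E j))"
    define w' where "w' = log 2 (real (weight E (last (inorder t'))))"
    have "last (inorder t') = last (p # inorder B')" by (simp add: in_t' r')
    then have "last (inorder t') \<in> set (p # inorder B')" using last_in_set by (metis list.discI)
    moreover have "pairs (p # inorder B') \<subseteq> E" using ok' r' by (simp add: paths_ok_def pairs_t')
    ultimately have "(p, last (inorder t')) \<in> E\<^sup>*"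
      by (intro pairs_reachable)
    from weight_step[OF forest_E jp this]
    have ww: "w + (if (j, p) \<in> heavy E then 0 else 1) \<le> w'" by (simp add: w_def w'_def)
    define h where "h = real (card (heavy E - solid (t # F)))"
    define h' where "h' = real (card (heavy E - solid (t' # add_tree l G)))"
    have "(j, p) \<notin> solid (t # F)"
    proof
      assume "(j, p) \<in> solid (t # F)"
      then have "(j, p) \<in> pairs (inorder t) \<or> (j, p) \<in> solid F" by simp
      moreover have "p \<notin> set (inorder t)" using \<open>p \<notin> set_tree t\<close> by simp
      moreover have "j \<notin> set (elems F)" using ok in_t by (auto simp: paths_ok_def)
      ultimately show False
        using pairs_in_set[of j p "inorder t"] solid_in[of j p F] by blast
    qed
    then have "h' + 1 \<le> h + (if (j, p) \<in> heavy E then 0 else 2)"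
      unfolding h_def h'_def
      by (rule dashed_heavy_switch[OF forest_E jp, where x = "last (inorder l)"])
        (use pairs_v pairs_t' solF in auto)
    \<comment> \<open>A heavy edge lowers \<open>h\<close> by one. A light one raises it by at most
      one, and then \<open>w'\<close> exceeds \<open>w\<close> by at least one.\<close>
    then have key: "1 + h' + (1 + 2 * (lg I - w')) \<le> h + (1 + 2 * (lg I - w))"
      using ww by (auto split: if_splits)
    have "M * (1 + h' + (1 + 2 * (lg I - w'))) \<le> M * (h + (1 + 2 * (lg I - w)))"
      using key M(1) by (intro mult_left_mono) auto
    then have key': "M + M * h' + M * (1 + 2 * (lg I - w')) \<le> M * h + M * (1 + 2 * (lg I - w))"
      by (simp only: distrib_left mult_1_right)
    have "rank v \<le> lg I" "rank t' \<le> lg I" "rank s \<le> lg I"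
      using rank_le_lg[OF okv finite_I] rank_le_lg[OF ok' finite_I] rank_le_lg[OF ok finite_I]
        splay_max_size1[OF s] by auto
    \<comment> \<open>The four steps sum up to at most \<open>13 * lg I + 3\<close>: three from each
      of the two splays for maxima, the search and the split, and one from the rank of the joined
      tree.\<close>
    then have "real (c0 + c1 + c2 + c3) + paths_potential (t' # add_tree l G) \<le> paths_potential (t # F) + M"
      using cost0 rc(3) split_at_correct(3)[OF sa] join_correct(2)[OF jn] lg_ge_1[of I] M(2)
      by (simp add: potF)
    moreover have "real c4 + potential I F' \<le>
      paths_potential (t' # add_tree l G) + M * h' + M * (1 + 2 * (lg I - w'))"
      using IH by (simp add: M_def h'_def w'_def potential_def)
    moreover have "c = (c0 + c1 + c2 + c3) + c4" using el(2) by simp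
    ultimately have cost: "real c + potential I F' \<le>
      paths_potential (t # F) + M * h + M * (1 + 2 * (lg I - w))"
      using key' by (simp only: of_nat_add)
    have "last (inorder t) = j" by (simp add: in_t)
    moreover have "set_tree t \<subseteq> set_tree t'" using arg_cong[OF in_t', of set] by auto
    ultimately show ?thesis using IH cost unfolding M_def h_def w_def potential_def[of I "t # F"] by blast
  qed
qed

lemma expose_least_correct:
  assumes "paths_ok E I (paths D)" "search D = T" "expose_least D = (D', c)"
  shows "paths_ok E I (paths D') \<and> exposed I (paths D') \<and> search D' = T \<and> ivals D' = ivals D \<and>
    real c + potential I (paths D') \<le> potential I (paths D) + 60 * (lg I)\<^sup>2"
proof -
  have L: "1 \<le> lg I" "lg I \<le> (lg I)\<^sup>2"
    using lg_ge_1[of I] by (auto simp: power2_eq_square)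
  show ?thesis
  proof (cases "least T")
    case None
    then have "I = {}" using least_eq_None[of T] T by simp
    then have "exposed I F" for F unfolding exposed_def least_fin_def by blast
    moreover have "D' = D" "c = 1" using assms None by (auto simp: expose_least_def)
    moreover have "1 \<le> 60 * (lg I)\<^sup>2" using L by linarith
    ultimately show ?thesis using assms by simp
  next
    case (Some m)
    have m: "least_fin I m" using least_correct[OF _ Some] T by (simp add: search_tree_def)
    then have "m \<in> I" by (simp add: least_fin_def)
    define u where "u = tree_of m (paths D)"
    define G where "G = without m (paths D)"
    note sp = paths_ok_split[OF assms(1) \<open>m \<in> I\<close>, folded u_def G_def]
    obtain t c1 where t: "splay m u = (t, c1)" by fastforce
    obtain F' c2 where F': "expose_loop T t G = (F', c2)" by fastforce
    have eq: "D' = D\<lparr>paths := F'\<rparr>" "c = c1 + c2"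
      using assms Some t F' by (auto simp: expose_least_def expose_def u_def G_def)
    have in_t: "inorder t = inorder u" using inorder_splay[of m u] t by simp
    then have set_t: "set_tree t = set_tree u" by (metis set_inorder)
    have ok: "paths_ok E I (t # G)" using sp(2) by (simp add: paths_ok_def in_t)
    have "t \<noteq> Leaf" using sp(1) set_t by auto
    note loop = expose_loop_correct[OF F' ok this]
    have "exposed I F'"
      unfolding exposed_def
    proof (intro allI impI)
      fix m' assume "least_fin I m'"
      then have "m' = m" using m valid_I least_fin_unique[of I I] by (auto simp: valid_def)
      then show "\<exists>u\<in>set F'. m' \<in> set_tree u \<and> last (inorder u) \<notin> Domain E"
        using loop sp(1) set_t by blast
    qed
    have "real c1 + paths_potential (t # G) \<le> paths_potential (paths D) + 4 * lg I"
      using splay_amortised[OF t] rank_le_lg[OF sp(2) finite_I] L sp(4) by simp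
    moreover have "16 * lg I * (1 + 2 * (lg I - log 2 (real (weight E (last (inorder t)))))) \<le>
        16 * lg I * (1 + 2 * lg I)"
      using L weight_pos[OF finite_E, of "last (inorder t)"] by (intro mult_left_mono) auto
    moreover have "16 * lg I * (1 + 2 * lg I) = 16 * lg I + 32 * (lg I)\<^sup>2"
      by (simp add: power2_eq_square distrib_left)
    moreover have "solid (t # G) = solid (paths D)" using sp(3) in_t by simp
    ultimately have "real c + potential I F' \<le> potential I (paths D) + 60 * (lg I)\<^sup>2"
      using loop L eq(2) by (simp only: of_nat_add potential_def) linarith
    then show ?thesis using loop \<open>exposed I F'\<close> assms(2) by (simp add: eq(1))
  qed
qed

end

text \<open>The only solid edge into \<open>c\<close> comes from its predecessor on the path, so
  testing that one settles all \<open>v\<close>. At most the single edge \<open>e\<close> is given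
  up, and thus at most one more heavy edge becomes dashed.\<close>

lemma cut_correct:
  assumes cut: "cut i c F = (F', n)" and ok: "paths_ok E J F" and c: "c \<in> J" and J: "finite J"
    and E: "\<And>a b. (a, b) \<in> E \<Longrightarrow> fin a < fin b"
  shows "paths_ok E J F' \<and> solid F' \<subseteq> solid F \<and> (\<forall>v. (v, c) \<in> solid F' \<longrightarrow> \<not> compatible v i) \<and>
    (\<exists>e. solid F \<subseteq> insert e (solid F')) \<and> real n + paths_potential F' \<le> paths_potential F + 12 * lg J"
proof -
  define u where "u = tree_of c F"
  define G where "G = without c F"
  note sp = paths_ok_split[OF ok c, folded u_def G_def]
  have sorted: "fin_sorted (inorder u)" by (rule paths_ok_fin_sorted[OF sp(2) E])
  obtain p t k where p: "predecessor c u = (p, t, k)" by (metis prod_cases3)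
  have P: "inorder t = inorder u" "real k + splay_potential t \<le> splay_potential u + 6 * rank u + 2"
    using predecessor_correct[OF p] by simp_all
  obtain as bs where as: "inorder u = as @ c # bs" "p = (if as = [] then None else Some (last as))"
    using predecessor_correct[OF p] sorted sp(1) by blast
  have dist: "distinct (inorder u @ elems G)" using sp(2) by (simp add: paths_ok_def)
  have okt: "paths_ok E J (t # G)" using sp(2) by (simp add: paths_ok_def P(1))
  have L: "1 \<le> lg J" by (rule lg_ge_1)
  have cost: "real k + paths_potential (t # G) \<le> paths_potential F + 8 * lg J"
    using P(2) rank_le_lg[OF sp(2) J] sp(4) L by simp
  have solF: "solid F = pairs (inorder t) \<union> solid G" using sp(3) by (simp add: P(1))
  \<comment> \<open>All elements are distinct, so \<open>c\<close> occurs at one place only and has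
    at most one neighbour before it.\<close>
  have into: "as \<noteq> [] \<and> v = last as" if "(v, c) \<in> solid F" for v
  proof -
    have "c \<notin> set (elems G)" "c \<notin> set as" "c \<notin> set bs" using dist by (auto simp: as(1))
    then have "(v, c) \<in> pairs (as @ c # bs)" "c \<notin> set as" "c \<notin> set bs"
      using that solid_in[of v c G] by (auto simp: solF P(1) as(1))
    then show ?thesis
      using pairs_append[of as "c # bs"] pairs_in[of v c "c # bs"] pairs_in_set[of v c as]
      by (cases "as = []") auto
  qed
  show ?thesis
  proof (cases "as \<noteq> [] \<and> compatible (last as) i")
    case False
    then have eq: "F' = add_tree t G" "n = k"
      using cut p as(2) by (auto simp: cut_def u_def[symmetric] G_def[symmetric] split: if_splits)
    have "paths_ok E J F'" using okt by (simp add: paths_ok_def eq)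
    moreover have "\<not> compatible v i" if "(v, c) \<in> solid F'" for v
      using into[of v] that False by (auto simp: eq solF)
    ultimately show ?thesis using cost L by (auto simp: eq solF)
  next
    case True
    obtain l r k' where s: "split_at c t = ((l, r), k')" by (metis prod.collapse)
    have eq: "F' = add_tree l (add_tree r G)" "n = k + k'"
      using cut p as(2) True s by (auto simp: cut_def u_def[symmetric] G_def[symmetric])
    have "c \<in> set_tree t" using sp(1) P(1) by (metis set_inorder)
    then obtain B where r: "r = Node Leaf c B" using split_at_correct(2)[OF s] sorted P(1) by auto
    have in_t: "inorder t = inorder l @ inorder r" using split_at_correct(1)[OF s] by simp
    have sub: "pairs (inorder l) \<union> pairs (inorder r) \<subseteq> pairs (inorder t)"
      "pairs (inorder t) \<subseteq> insert (last (inorder l), c) (pairs (inorder l) \<union> pairs (inorder r))"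
      using pairs_split(1,2)[of "inorder l" c "inorder B"] unfolding in_t r by simp_all
    have "paths_ok E J F'" using okt sub(1) by (auto simp: paths_ok_def eq in_t)
    moreover have "(v, c) \<notin> solid F'" for v
    proof
      assume "(v, c) \<in> solid F'"
      moreover have "c \<notin> set (inorder l)" "c \<notin> set (elems G)" "c \<notin> set (inorder B)"
        using dist by (auto simp: P(1)[symmetric] in_t r)
      ultimately show False
        using pairs_in_set[of v c "inorder l"] pairs_in[of v c "inorder r"] solid_in[of v c G]
        by (auto simp: eq r)
    qed
    moreover have "real k' + splay_potential l + splay_potential r \<le> splay_potential t + 4 * lg J"
      using split_at_correct(3)[OF s] rank_le_lg[OF okt J] L by linarith
    then have "real n + paths_potential F' \<le> paths_potential F + 12 * lg J"
      using cost by (simp add: eq)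
    moreover have "solid F \<subseteq> insert (last (inorder l), c) (solid F')" "solid F' \<subseteq> solid F"
      using sub by (auto simp: eq solF)
    ultimately show ?thesis by blast
  qed
qed

lemma card_diff_insert:
  "finite H \<Longrightarrow> S \<subseteq> insert e S' \<Longrightarrow> card (H - S') \<le> card (H - S) + 1"
proof -
  assume H: "finite H" "S \<subseteq> insert e S'"
  then have "card (H - S') \<le> card (insert e (H - S))" by (intro card_mono) auto
  also have "\<dots> \<le> card (H - S) + 1" using H by (simp add: card_insert_if)
  finally show ?thesis .
qed

text \<open>\<open>H\<close> is arbitrary because the cuts are made on paths that follow the old
  edges, whereas the heavy edges to be counted are those of the new set.\<close>

lemma cut_all_correct:
  assumes J: "finite J" and E: "\<And>a b. (a, b) \<in> E \<Longrightarrow> fin a < fin b" and H: "finite H"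
  shows "cut_all i cs F = (F', n) \<Longrightarrow> paths_ok E J F \<Longrightarrow> set cs \<subseteq> J \<Longrightarrow>
    paths_ok E J F' \<and> solid F' \<subseteq> solid F \<and>
    (\<forall>c\<in>set cs. \<forall>v. (v, c) \<in> solid F' \<longrightarrow> \<not> compatible v i) \<and>
    card (H - solid F') \<le> card (H - solid F) + length cs \<and>
    real n + paths_potential F' \<le> paths_potential F + real (length cs) * (13 * lg J) + 1"
proof (induction cs arbitrary: F n)
  case Nil
  then show ?case by simp
next
  case (Cons c cs)
  obtain F1 n1 where F1: "cut i c F = (F1, n1)" by fastforce
  obtain n2 where n2: "cut_all i cs F1 = (F', n2)" "n = n1 + n2 + 1"
    using Cons.prems(1) F1 by (auto split: prod.splits)
  have "c \<in> J" using Cons.prems by simp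
  note C = cut_correct[OF F1 Cons.prems(2) this J E]
  have "paths_ok E J F1" "set cs \<subseteq> J" using C Cons.prems by auto
  note IH = Cons.IH[OF n2(1) this]
  obtain e where "solid F \<subseteq> insert e (solid F1)" using C by blast
  from card_diff_insert[OF H this] have "card (H - solid F') \<le> card (H - solid F) + length (c # cs)"
    using IH by simp
  moreover have "real n + paths_potential F' \<le> paths_potential F + real (length (c # cs)) * (13 * lg J) + 1"
    using C IH n2(2) lg_ge_1[of J] by (simp add: algebra_simps)
  ultimately show ?case using C IH by auto
qed

section \<open>The operations\<close>

definition forest_inv :: "interval set \<Rightarrow> forest \<Rightarrow> bool" where
  "forest_inv I D \<longleftrightarrow> valid I \<and> search_tree (search D) \<and> avl_set (search D) = I \<and>
     interval_tree I (ivals D) \<and> paths_ok (edges I) I (paths D) \<and> exposed I (paths D)"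

lemma potential_ge_0: "0 \<le> potential I F"
  unfolding potential_def using paths_potential_nonneg lg_ge_1[of I] by (intro add_nonneg_nonneg) auto

lemma forest_inv_schedule: "forest_inv I D \<Longrightarrow> schedule I (search D)"
  by unfold_locales (auto simp: forest_inv_def)

lemma member_cost:
  assumes "forest_inv I D" "avl_member i (search D) = (b, c)"
  shows "b \<longleftrightarrow> i \<in> I" "real c \<le> 3 * lg I"
  using avl_member_correct[OF _ _ assms(2)] assms(1) schedule.ht_T[OF forest_inv_schedule[OF assms(1)]]
  by (auto simp: forest_inv_def search_tree_def)

lemma queryCF_correct:
  assumes inv: "forest_inv I D" and q: "queryCF i D = (b, D', c)"
  shows "(b \<longleftrightarrow> i \<in> greedy I) \<and> forest_inv I D' \<and> real c + potential I (paths D') \<le> potential I (paths D) + 8 * lg I"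
proof -
  interpret schedule I "search D" by (rule forest_inv_schedule[OF inv])
  have L: "1 \<le> lg I" by (rule lg_ge_1)
  have ok: "paths_ok E I (paths D)" "exposed I (paths D)" using inv by (auto simp: forest_inv_def)
  show ?thesis
  proof (cases "least (search D)")
    case None
    then have "I = {}" using least_eq_None[of "search D"] T by simp
    moreover have "j \<notin> greedy {}" for j
    proof
      assume "j \<in> greedy {}"
      then show False by (induction rule: greedy.induct) (auto simp: least_fin_def)
    qed
    moreover have "b = False" "D' = D" "c = 1" using q None by (auto simp: queryCF_def)
    ultimately show ?thesis using inv L by auto
  next
    case (Some m)
    have m: "least_fin I m" using least_correct[OF _ Some] T by (simp add: search_tree_def)
    then have "m \<in> I" by (simp add: least_fin_def)
    define u where "u = tree_of m (paths D)"
    define G where "G = without m (paths D)"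
    note sp = paths_ok_split[OF ok(1) \<open>m \<in> I\<close>, folded u_def G_def]
    obtain t c1 where t: "splay m u = (t, c1)" by fastforce
    obtain t' c2 where t': "splay i t = (t', c2)" by fastforce
    have eq: "b = (case t' of Leaf \<Rightarrow> False | Node l j r \<Rightarrow> j = i)" "D' = D\<lparr>paths := add_tree t' G\<rparr>"
      "c = c1 + c2"
      using q Some t t' by (auto simp: queryCF_def u_def G_def)
    have in_t: "inorder t = inorder u" using inorder_splay[of m u] t by simp
    have in_t': "inorder t' = inorder u" using inorder_splay[of i t] t' in_t by simp
    have set_t': "set_tree t = set_tree u" "set_tree t' = set_tree u" by (metis in_t in_t' set_inorder)+
    have sorted: "fin_sorted (inorder u)" by (rule paths_ok_fin_sorted[OF sp(2)]) (rule edges_fin[OF valid_I])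
    obtain u0 where u0: "u0 \<in> set (paths D)" "m \<in> set_tree u0" "last (inorder u0) \<notin> Domain E"
      using ok(2) m unfolding exposed_def by blast
    then have "u = u0" using tree_of_unique[OF _ u0(1,2)] ok(1) by (simp add: u_def paths_ok_def)
    then have last: "last (inorder u) \<notin> Domain E" using u0 by simp
    obtain x xs where x: "inorder u = x # xs" using sp(1) by (cases "inorder u") auto
    have "m \<in> set (x # xs)" using sp(1) x by (metis set_inorder)
    moreover have "x \<in> I" using sp(2) x by (auto simp: paths_ok_def)
    \<comment> \<open>The path is sorted by finishing time and contains the least interval, so it
      begins there; being maximal, it is everything reachable from \<open>m\<close>.\<close>
    ultimately have "x = m" using m sorted valid_I unfolding x fin_sorted_def least_fin_def valid_def
      by (metis leD set_ConsD sorted_wrt.simps(2))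
    moreover have "pairs (x # xs) \<subseteq> E" using sp(2) x by (simp add: paths_ok_def)
    ultimately have "set_tree u = E\<^sup>* `` {m}"
      using maximal_path_reachable[of x xs E] single_valued_E last x by (metis set_inorder)
    then have greedy: "greedy I = set_tree u" using greedy_reachable[OF valid_I m] by simp
    have "b \<longleftrightarrow> i \<in> set_tree u"
    proof
      assume b
      then show "i \<in> set_tree u" using eq(1) set_t'(2) by (cases t') auto
    next
      assume "i \<in> set_tree u"
      then show b using splay_root[of t i] sorted in_t set_t'(1) t' eq(1) by auto
    qed
    moreover have "t' \<noteq> Leaf" using set_t'(2) sp(1) by auto
    have "exposed I (add_tree t' G)"
      unfolding exposed_def
    proof (intro allI impI)
      fix m' assume "least_fin I m'"
      then have "m' = m" using m valid_I least_fin_unique[of I I] by (auto simp: valid_def)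
      then show "\<exists>u\<in>set (add_tree t' G). m' \<in> set_tree u \<and> last (inorder u) \<notin> Domain E"
        using sp(1) set_t' last \<open>t' \<noteq> Leaf\<close> in_t' by (auto simp: add_tree_def)
    qed
    moreover have "paths_ok E I (add_tree t' G)" using sp(2) by (simp add: paths_ok_def in_t')
    ultimately have "(b \<longleftrightarrow> i \<in> greedy I) \<and> forest_inv I D'"
      using inv greedy by (simp add: forest_inv_def eq(2))
    moreover have "solid (add_tree t' G) = solid (paths D)" using sp(3) by (simp add: in_t')
    moreover have "rank u \<le> lg I" "rank t = rank u"
      using rank_le_lg[OF sp(2) finite_I] splay_size1[OF t] by simp_all
    then have "real c + paths_potential (add_tree t' G) \<le> paths_potential (paths D) + 8 * lg I"
      using splay_amortised[OF t] splay_amortised[OF t'] sp(4) L by (simp add: eq(3))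
    ultimately show ?thesis by (simp add: potential_def eq(2))
  qed
qed

text \<open>\<open>w\<close> is the least natural number above
  \<open>2 * log 2 (card J + 1)\<close>.\<close>

lemma pierced_exists:
  assumes J: "valid J" and d: "\<And>x. card {j \<in> J. contains j x} \<le> d" "1 \<le> d"
  obtains w where "pierced J d w" "real w \<le> 3 * lg J"
proof -
  define y where "y = 2 * log 2 (real (card J) + 1)"
  define w where "w = nat (\<lfloor>y\<rfloor> + 1)"
  have y: "0 \<le> y" by (simp add: y_def)
  then have w: "y < real w" "real w \<le> y + 1" unfolding w_def by (auto simp: floor_le_iff; linarith)+
  have "log 2 (real (card J) + 1) \<le> lg J" unfolding lg_def by (intro log_mono) auto
  then have "real w \<le> 3 * lg J" using w lg_ge_1[of J] unfolding y_def by linarith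
  moreover have "(card J + 1)\<^sup>2 < 2 ^ w"
  proof -
    have "log 2 ((real (card J) + 1)\<^sup>2) < real w" using w(1) by (simp add: y_def log_nat_power)
    then have "(real (card J) + 1)\<^sup>2 < 2 powr real w" by (subst (asm) log_less_iff) auto
    then have "real ((card J + 1)\<^sup>2) < real (2 ^ w)" by (simp add: powr_realpow add.commute)
    then show ?thesis by (simp only: of_nat_less_iff)
  qed
  then have "pierced J d w" using J d by unfold_locales (auto simp: valid_def)
  ultimately show thesis using that by blast
qed

lemma cost_scale:
  fixes L :: real and d w :: nat
  assumes "1 \<le> d" "1 \<le> L" "real w \<le> 3 * L"
  shows "L \<le> real d * L" "real d * L \<le> real d * L\<^sup>2" "L\<^sup>2 \<le> real d * L\<^sup>2"
    "real d * real w \<le> 3 * (real d * L)" "real d * (real w)\<^sup>2 \<le> 9 * (real d * L\<^sup>2)"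
proof -
  have d: "1 \<le> real d" using assms by simp
  show "L \<le> real d * L" "real d * L \<le> real d * L\<^sup>2" "L\<^sup>2 \<le> real d * L\<^sup>2"
    using d assms(2) by (simp_all add: power2_eq_square)
  show "real d * real w \<le> 3 * (real d * L)"
    using mult_left_mono[OF assms(3), of "real d"] by simp
  have "(real w)\<^sup>2 \<le> (3 * L)\<^sup>2" using assms(3) by (intro power_mono) auto
  then have "real d * (real w)\<^sup>2 \<le> real d * (9 * L\<^sup>2)"
    by (intro mult_left_mono) (auto simp: power_mult_distrib)
  then show "real d * (real w)\<^sup>2 \<le> 9 * (real d * L\<^sup>2)" by simp
qed

lemma lg_mono: "finite J \<Longrightarrow> I \<subseteq> J \<Longrightarrow> lg I \<le> lg J"
  unfolding lg_def using card_mono[of J I] by (intro log_mono) auto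

text \<open>The first part bounds the rise of the potential when its factor \<open>lg\<close> moves
  to the larger set: at most \<open>card I\<close> edges, each gaining about
  \<open>1 / (card I + 2)\<close>. The second part turns a bound in the size before a removal into
  one in the size after it.\<close>

lemma lg_insert:
  assumes "finite I" "i \<notin> I"
  shows "(lg (insert i I) - lg I) * real (card I) \<le> 2" "lg (insert i I) \<le> 2 * lg I"
proof -
  define n where "n = real (card I)"
  have n: "0 \<le> n" by (simp add: n_def)
  have lgs: "lg (insert i I) = log 2 (n + 3)" "lg I = log 2 (n + 2)"
    using assms by (simp_all add: lg_def n_def add.commute)
  have "lg (insert i I) - lg I = log 2 (1 + 1 / (n + 2))"
  proof -
    have "1 + 1 / (n + 2) = (n + 3) / (n + 2)" using n by (simp add: field_simps)
    then show ?thesis using n unfolding lgs by (simp add: log_divide_pos)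
  qed
  also have "\<dots> = ln (1 + 1 / (n + 2)) / ln 2" by (simp add: log_def)
  also have "\<dots> \<le> (1 / (n + 2)) / ln 2"
    using n by (intro divide_right_mono ln_add_one_self_le_self) auto
  also have "\<dots> \<le> (1 / (n + 2)) / (1 / 2)"
  proof (rule divide_left_mono)
    \<comment> \<open>The quadratic bound on the exponential gives \<open>1 + 1/2 + 1/4\<close>
      here.\<close>
    have "exp (1 / 2 :: real) \<le> 2" using exp_bound[of "1 / 2 :: real"] by (simp add: power2_eq_square)
    then show "1 / 2 \<le> ln (2 :: real)" by (subst ln_ge_iff) auto
  qed (use n in auto)
  finally have le: "lg (insert i I) - lg I \<le> 2 / (n + 2)" by simp
  have "(lg (insert i I) - lg I) * n \<le> 2 / (n + 2) * n" using le n by (intro mult_right_mono) auto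
  also have "\<dots> \<le> 2" using n by (simp add: field_simps)
  finally show "(lg (insert i I) - lg I) * real (card I) \<le> 2" by (simp add: n_def)
  have "2 / (n + 2) \<le> 1" using n by (simp add: field_simps)
  then show "lg (insert i I) \<le> 2 * lg I" using le lg_ge_1[of I] by linarith
qed

text \<open>An edge is determined by its source.\<close>

lemma card_heavy_edges:
  assumes "valid I"
  shows "card (heavy (edges I) - S) \<le> card I"
proof -
  have fin: "finite I" using assms by (simp add: valid_def)
  have "inj_on fst (edges I)"
    using forest_edges[OF assms] by (auto simp: forest_rel_def inj_on_def dest: single_valuedD)
  then have "inj_on fst (heavy (edges I) - S)" by (rule inj_on_subset) (auto simp: heavy_def)
  moreover have "fst ` (heavy (edges I) - S) \<subseteq> I" by (auto simp: heavy_def dest: edges_in)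
  ultimately show ?thesis using card_inj_on_le fin by blast
qed

text \<open>Symmetric in the two sets, so that it serves both insertion and removal.\<close>

lemma dashed_heavy_change:
  assumes J: "valid (insert i I)" "i \<notin> I" and d: "\<And>x. card {j \<in> insert i I. contains j x} \<le> d" "1 \<le> d"
  defines "b \<equiv> 9 * real d * lg (insert i I)"
  shows "real (card (heavy (edges (insert i I)) - S)) \<le> real (card (heavy (edges I) - S)) + b"
    and "real (card (heavy (edges I) - S)) \<le> real (card (heavy (edges (insert i I)) - S)) + b"
proof -
  let ?J = "insert i I"
  have I: "valid I" by (rule valid_subset[OF J(1)]) auto
  have fin: "finite I" using I by (simp add: valid_def)
  obtain C where C: "finite C" "card C \<le> d + 2"
    "\<And>v p. p \<notin> C \<Longrightarrow> (v, p) \<in> edges I \<longleftrightarrow> (v, p) \<in> edges ?J"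
    using edges_insert[OF J d(1)] by metis
  have wI: "weight (edges I) p \<le> card ?J + 1" for p
    using weight_edges[OF I, of p] J fin by simp
  have wJ: "weight (edges ?J) p \<le> card ?J + 1" for p by (rule weight_edges[OF J(1)])
  have "log 2 (real (card ?J + 1)) \<le> lg ?J" unfolding lg_def by (intro log_mono) auto
  \<comment> \<open>\<open>d + 2 \<le> 3 * d\<close> as \<open>1 \<le> d\<close>, and
    \<open>1 + 2 * log\<close> is at most \<open>3 * lg\<close>; the product is the 9 in
    \<open>b\<close>.\<close>
  then have "real (card C) * (1 + 2 * log 2 (real (card ?J + 1))) \<le> (3 * real d) * (3 * lg ?J)"
    using C(2) d(2) lg_ge_1[of ?J] by (intro mult_mono) auto
  then have b: "real (card C) * (1 + 2 * log 2 (real (card ?J + 1))) \<le> b" by (simp add: b_def)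
  have fh: "finite (heavy (edges I))" "finite (heavy (edges ?J))"
    using forest_edges[OF I] forest_edges[OF J(1)] by (auto simp: forest_rel_def heavy_def intro: finite_subset)
  have step: "card (A - S) \<le> card (B - S) + card (A - B)" if "finite A" "finite B" for A B :: "(interval \<times> interval) set"
  proof -
    have "card (A - S) \<le> card ((B - S) \<union> (A - B))" using that by (intro card_mono) auto
    also have "\<dots> \<le> card (B - S) + card (A - B)" by (rule card_Un_le)
    finally show ?thesis .
  qed
  have "real (card (heavy (edges ?J) - heavy (edges I))) \<le> b"
    using new_heavy_edges[OF forest_edges[OF I] wI forest_edges[OF J(1)] wJ C(1) C(3)] b by linarith
  then show "real (card (heavy (edges ?J) - S)) \<le> real (card (heavy (edges I) - S)) + b"
    using step[OF fh(2,1)] by linarith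
  have "real (card (heavy (edges I) - heavy (edges ?J))) \<le> b"
    using new_heavy_edges[OF forest_edges[OF J(1)] wJ forest_edges[OF I] wI C(1) C(3)[symmetric]] b by linarith
  then show "real (card (heavy (edges I) - S)) \<le> real (card (heavy (edges ?J) - S)) + b"
    using step[OF fh] by linarith
qed

section \<open>Correctness and cost of insertion and removal\<close>

lemma least_of_correct:
  "(least_of r js = None \<longrightarrow> r = None \<and> js = []) \<and>
   (\<forall>k. least_of r js = Some k \<longrightarrow> least_fin (set_option r \<union> set js) k)"
proof (induction js arbitrary: r)
  case Nil
  then show ?case by (cases r) (auto simp: least_fin_def)
next
  case (Cons j js)
  show ?case
  proof (cases r)
    case None
    then show ?thesis using Cons[of "Some j"] by simp
  next
    case (Some k)
    define m where "m = (if fin j < fin k then j else k)"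
    have "least_fin {j, k} m" by (auto simp: m_def least_fin_def)
    moreover have eq: "least_of r (j # js) = least_of (Some m) js" by (simp add: Some m_def)
    moreover have "least_fin (set js \<union> {j, k}) x" if "least_of (Some m) js = Some x" for x
      using Cons[of "Some m"] that least_fin_trans[OF _ \<open>least_fin {j, k} m\<close>] by simp
    moreover have "least_of (Some m) js \<noteq> None" using Cons[of "Some m"] by blast
    moreover have "set_option r \<union> set (j # js) = set js \<union> {j, k}" using Some by auto
    ultimately show ?thesis by simp
  qed
qed

lemma next_noncovering_correct:
  assumes "pierced J d w" "schedule J T" "interval_tree J V" "i \<in> J" "next_noncovering i T V = (r, c)"
  shows "r = None \<Longrightarrow> noncovering_after i J = {}"
    and "r = Some k \<Longrightarrow> least_fin (noncovering_after i J) k"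
    and "real c \<le> 3 * lg J + 16 * real d * real w"
proof -
  interpret pierced J d w by fact
  interpret schedule J T by fact
  obtain r0 c0 where r0: "right_compatible i T = (r0, c0)" by fastforce
  obtain js c1 where js: "stab (fin i) V = (js, c1)" by fastforce
  define ks where "ks = filter (\<lambda>j. start i < start j \<and> fin i < fin j) js"
  have r: "r = least_of r0 ks" "c = c0 + c1 + length js"
    using assms(5) by (auto simp: next_noncovering_def r0 js ks_def)
  note s = stab_interval_tree[OF assms(3) js]
  have i: "start i < fin i" using intervals_J assms(4) by simp
  let ?A = "{k \<in> J. fin i < start k}"
  have split: "noncovering_after i J = ?A \<union> set ks"
  proof (rule set_eqI)
    fix k
    have "k \<in> set ks \<longleftrightarrow> (k \<in> J \<and> start k \<le> fin i \<and> fin i \<le> fin k) \<and> start i < start k \<and> fin i < fin k"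
      by (simp only: ks_def set_filter s(1) contains_def mem_Collect_eq)
    then show "k \<in> noncovering_after i J \<longleftrightarrow> k \<in> ?A \<union> set ks"
      using i intervals_J[of k] unfolding noncovering_after_def mem_Collect_eq Un_iff by linarith
  qed
  note l = least_of_correct[of r0 ks]
  show "r = None \<Longrightarrow> noncovering_after i J = {}"
    using l right_compatible_correct(1)[OF T(1) r0] unfolding split r(1) T(2) by auto
  have "real c0 \<le> 3 * lg J" using right_compatible_edges(3)[OF r0 assms(4)] .
  moreover have "real c1 + real (length js) \<le> 16 * real d * real w"
  proof -
    have "c1 + length js \<le> 16 * d * w" using s(2,3) by linarith
    then have "real (c1 + length js) \<le> real (16 * d * w)" by (rule of_nat_mono)
    then show ?thesis by simp
  qed
  ultimately show "real c \<le> 3 * lg J + 16 * real d * real w" by (simp add: r(2))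
  show "least_fin (noncovering_after i J) k" if "r = Some k"
  proof (cases r0)
    case None
    then have "?A = {}" using right_compatible_correct(1)[OF T(1) r0] unfolding T(2) by blast
    moreover have "least_fin (set_option r0 \<union> set ks) k" using l that unfolding r(1) by blast
    then have "least_fin (set ks) k" unfolding None by (simp only: option.set Un_empty_left)
    ultimately show ?thesis unfolding split by (simp only: Un_empty_left)
  next
    case (Some k0)
    have "least_fin ?A k0" using right_compatible_correct(2)[OF T(1) r0 Some] unfolding T(2) .
    moreover have "least_fin (insert k0 (set ks)) k" using l that Some unfolding r(1) by (metis insert_is_Un option.set(2))
    ultimately show ?thesis using least_fin_trans unfolding split by (metis Un_commute)
  qed
qed

lemma covers_correct:
  assumes "pierced J d w" "interval_tree J V" "start i < fin i" "covers i V = (cs, c)"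
  shows "set cs = covering i J" "length cs \<le> 8 * d * w" "c \<le> 16 * d * w"
proof -
  interpret pierced J d w by fact
  obtain js c1 where js: "stab (fin i) V = (js, c1)" by fastforce
  note s = stab_interval_tree[OF assms(2) js]
  have eq: "cs = filter (\<lambda>j. start j \<le> start i \<and> fin i \<le> fin j) js" "c = c1 + length js"
    using assms(4) by (auto simp: covers_def js)
  show "set cs = covering i J"
  proof (rule set_eqI)
    fix k
    have "k \<in> set cs \<longleftrightarrow> (k \<in> J \<and> start k \<le> fin i \<and> fin i \<le> fin k) \<and> start k \<le> start i \<and> fin i \<le> fin k"
      by (simp only: eq set_filter s(1) contains_def mem_Collect_eq)
    then show "k \<in> set cs \<longleftrightarrow> k \<in> covering i J"
      using assms(3) unfolding covering_def mem_Collect_eq by linarith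
  qed
  show "length cs \<le> 8 * d * w"
    using s(2) length_filter_le[of "\<lambda>j. start j \<le> start i \<and> fin i \<le> fin j" js] unfolding eq(1) by linarith
  show "c \<le> 16 * d * w" using s(2,3) by (simp add: eq)
qed


text \<open>The paths are read against the old edges until all cuts are done; by then every solid
  edge invalidated by \<open>i\<close> is gone, and the new edges can take over. The dashed heavy
  edges grow through the changed targets, through the cuts, and through the larger factor
  \<open>lg\<close>.\<close>

lemma insertCF_correct:
  assumes inv: "forest_inv I D" and ins: "insertCF i D = (D', c)" and i: "i \<notin> I"
    and J: "valid (insert i I)" and d: "\<And>x. card {j \<in> insert i I. contains j x} \<le> d" "1 \<le> d"
  shows "forest_inv (insert i I) D'"
    and "real c + potential (insert i I) (paths D') \<le> potential I (paths D) + 3000 * real d * (lg (insert i I))\<^sup>2"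
proof -
  let ?J = "insert i I"
  define L where "L = lg ?J"
  interpret old: schedule I "search D" by (rule forest_inv_schedule[OF inv])
  have st: "search_tree (search D)" "avl_set (search D) = I" "interval_tree I (ivals D)"
    "paths_ok (edges I) I (paths D)"
    using inv by (auto simp: forest_inv_def)
  have finJ: "finite ?J" using J by (simp add: valid_def)
  have L1: "1 \<le> L" "lg I \<le> L" unfolding L_def by (rule lg_ge_1) (rule lg_mono[OF finJ], blast)
  obtain w where w: "pierced ?J d w" "real w \<le> 3 * L" unfolding L_def by (rule pierced_exists[OF J d])
  interpret pierced ?J d w by fact
  obtain b c0 where c0: "avl_member i (search D) = (b, c0)" by fastforce
  have "\<not> b" using member_cost(1)[OF inv c0] i by simp
  obtain T c1 where T: "avl_insert i (search D) = (T, c1)" by fastforce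
  note T' = search_tree_insert[OF st(1) T]
  obtain V c2 where V: "itree_insert i (ivals D) = (V, c2)" by fastforce
  note V' = itree_insert_correct[OF st(3) refl V]
  define F0 where "F0 = Node Leaf i Leaf # paths D"
  obtain r c3 where r: "next_noncovering i T V = (r, c3)" by fastforce
  obtain F1 c4 where F1: "(case r of None \<Rightarrow> (F0, 1) | Some k \<Rightarrow> cut i k F0) = (F1, c4)" by fastforce
  obtain cs c5 where cs: "covers i V = (cs, c5)" by fastforce
  obtain F2 c6 where F2: "cut_all i cs F1 = (F2, c6)" by fastforce
  obtain c7 where D': "expose_least \<lparr>paths = F2, search = T, ivals = V\<rparr> = (D', c7)"
    and c: "c = c0 + c1 + c2 + c3 + c4 + c5 + c6 + c7"
    using ins \<open>\<not> b\<close> c0 T V r F1 cs F2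
    by (auto simp: insertCF_def F0_def[symmetric] split: prod.splits)
  interpret new: schedule ?J T by unfold_locales (use J T' st in auto)
  have ii: "start i < fin i" "i \<in> ?J" using J by (auto simp: valid_def)
  have nc: "noncovering_after i ?J = noncovering_after i I" by (auto simp: noncovering_after_def)
  note N = next_noncovering_correct[OF w(1) new.schedule_axioms V'(1) ii(2) r, unfolded nc]
  note cov = covers_correct[OF w(1) V'(1) ii(1) cs]
  have inc: "\<And>a b. (a, b) \<in> edges I \<Longrightarrow> fin a < fin b" by (rule edges_fin[OF old.valid_I])
  \<comment> \<open>The new interval is a path by itself: the elements are those of the new set, the
    edges those of the old one.\<close>
  have okF0: "paths_ok (edges I) ?J F0" using st(4) i by (auto simp: paths_ok_def F0_def)
  let ?H = "heavy (edges ?J)"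
  have finH: "finite ?H" using new.finite_E by (auto simp: heavy_def intro: finite_subset)
  have F1': "paths_ok (edges I) ?J F1 \<and> solid F1 \<subseteq> solid F0 \<and>
    (\<forall>p v. least_fin (noncovering_after i I) p \<longrightarrow> (v, p) \<in> solid F1 \<longrightarrow> \<not> compatible v i) \<and>
    card (?H - solid F1) \<le> card (?H - solid F0) + 1 \<and>
    real c4 + paths_potential F1 \<le> paths_potential F0 + 12 * L"
  proof (cases r)
    case None
    then have "noncovering_after i I = {}" using N(1) by simp
    moreover have "F1 = F0" "c4 = 1" using F1 None by auto
    ultimately show ?thesis using okF0 L1 by (auto simp: least_fin_def)
  next
    case (Some k)
    have k: "least_fin (noncovering_after i I) k" by (rule N(2)[OF Some])
    then have kJ: "k \<in> ?J" by (auto simp: least_fin_def noncovering_after_def)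
    have "cut i k F0 = (F1, c4)" using F1 Some by simp
    note C = cut_correct[OF this okF0 kJ finJ inc]
    obtain e where "solid F0 \<subseteq> insert e (solid F1)" using C by blast
    from card_diff_insert[OF finH this] have "card (?H - solid F1) \<le> card (?H - solid F0) + 1" .
    moreover have "p = k" if "least_fin (noncovering_after i I) p" for p
      by (rule least_fin_unique[OF _ _ that k, of I]) (use old.valid_I in \<open>auto simp: valid_def noncovering_after_def\<close>)
    ultimately show ?thesis using C unfolding L_def by blast
  qed
  have csJ: "set cs \<subseteq> ?J" using cov(1) by (auto simp: covering_def)
  note F2' = cut_all_correct[OF finJ inc finH F2 conjunct1[OF F1'] csJ]
  \<comment> \<open>A surviving solid edge that is not an edge of the new set would come from an
    interval compatible with \<open>i\<close> and lead to a node at which that predecessor was cut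
    off.\<close>
  have solF2: "solid F2 \<subseteq> edges ?J"
  proof (rule ccontr)
    assume "\<not> solid F2 \<subseteq> edges ?J"
    then obtain v p where vp: "(v, p) \<in> solid F2" "(v, p) \<notin> edges ?J" by auto
    have "(v, p) \<in> edges I" using F2' vp by (auto simp: paths_ok_def)
    note lost = edges_insert_lost[OF J i this vp(2)]
    have "covering i I \<subseteq> set cs" using cov(1) by (auto simp: covering_def)
    then have "p \<in> set cs \<or> least_fin (noncovering_after i I) p" using lost(2) by blast
    moreover have "(v, p) \<in> solid F1" using vp F2' by blast
    ultimately show False using F1' F2' vp lost(1) by blast
  qed
  then have okF2: "paths_ok (edges ?J) ?J F2" using F2' by (simp add: paths_ok_def)
  note ex = new.expose_least_correct[OF _ _ D', simplified, OF okF2]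
  show "forest_inv ?J D'"
    using J T' st V' ex by (simp add: forest_inv_def)
  define X where "X = real d * L\<^sup>2"
  define Y where "Y = real d * L"
  note XY = cost_scale[OF d(2) L1(1) w(2), folded X_def Y_def]
  have "real c0 \<le> 3 * L" using member_cost(2)[OF inv c0] L1 by linarith
  moreover have "real c1 \<le> 3 * L" using T'(3) old.ht_T L1 by linarith
  moreover have "real c2 \<le> 810 * X"
    using of_nat_mono[OF V'(2), where 'a = real] XY(5) by simp
  moreover have "real c3 \<le> 3 * L + 48 * Y" using N(3) XY(4) by (simp add: L_def)
  moreover have "real c5 \<le> 48 * Y"
    using of_nat_mono[OF cov(3), where 'a = real] XY(4) by simp
  moreover have len: "real (length cs) \<le> 24 * Y"
    using of_nat_mono[OF cov(2), where 'a = real] XY(4) by simp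
  have "Y * L = X" by (simp add: X_def Y_def power2_eq_square)
  then have lenL: "real (length cs) * L \<le> 24 * X" using mult_right_mono[OF len, of L] L1 by (simp add: mult.assoc)
  have "real c6 + paths_potential F2 \<le> paths_potential F1 + 312 * X + 1"
    using F2' lenL by (simp add: L_def)
  \<comment> \<open>The 1 is the potential of the new path with the single node
    \<open>i\<close>.\<close>
  moreover have "real c4 + paths_potential F1 \<le> paths_potential (paths D) + 1 + 12 * L"
    using F1' by (simp add: F0_def)
  moreover have "real c7 + potential ?J (paths D') \<le> paths_potential F2 + 16 * L * real (card (?H - solid F2)) + 60 * X"
    using ex XY(3) by (simp add: potential_def[of ?J F2] L_def)
  \<comment> \<open>Sixteen times: \<open>9 * X\<close> for the changed targets, \<open>L\<close>
    for the cut at \<open>r\<close>, \<open>24 * X\<close> for the cuts at covering intervals, and 2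
    for the passage from \<open>lg I\<close> to \<open>L\<close>.\<close>
  moreover have "16 * L * real (card (?H - solid F2)) \<le>
    16 * lg I * real (card (heavy (edges I) - solid (paths D))) + 32 + 144 * X + 16 * L + 384 * X"
  proof -
    define h where "h = real (card (heavy (edges I) - solid (paths D)))"
    have "solid F0 = solid (paths D)" by (simp add: F0_def)
    then have "real (card (?H - solid F2)) \<le> h + 9 * Y + 1 + real (length cs)"
      using dashed_heavy_change(1)[OF J i d, of "solid (paths D)"] F1' F2'
      by (simp add: h_def Y_def L_def)
    then have "L * real (card (?H - solid F2)) \<le> L * (h + 9 * Y + 1 + real (length cs))"
      using L1 by (intro mult_left_mono) auto
    also have "\<dots> = L * h + 9 * (Y * L) + L + real (length cs) * L" by (simp add: algebra_simps)
    also have "\<dots> \<le> L * h + 9 * X + L + 24 * X" using lenL \<open>Y * L = X\<close> by simp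
    finally have 1: "L * real (card (?H - solid F2)) \<le> L * h + 9 * X + L + 24 * X" .
    have "(L - lg I) * h \<le> (L - lg I) * real (card I)"
      using L1 card_heavy_edges[OF old.valid_I] by (intro mult_left_mono) (auto simp: h_def)
    also have "\<dots> \<le> 2" using lg_insert(1)[OF old.finite_I i] by (simp add: L_def)
    finally have "L * h \<le> lg I * h + 2" by (simp add: algebra_simps)
    with 1 show ?thesis unfolding h_def by linarith
  qed
  ultimately have "real c + potential ?J (paths D') \<le> potential I (paths D) + 3000 * X"
    using XY L1 unfolding c potential_def[of I] of_nat_add by linarith
  then show "real c + potential ?J (paths D') \<le> potential I (paths D) + 3000 * real d * (lg ?J)\<^sup>2"
    by (simp add: X_def L_def)
qed

text \<open>Edges between other intervals survive the removal, by \<open>edges_remove\<close>, so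
  dropping the solid edges at \<open>i\<close> already makes the paths valid. The factor
  \<open>lg\<close> of the potential can only fall.\<close>

lemma removeCF_correct:
  assumes inv: "forest_inv I D" and rem: "removeCF i D = (D', c)" and i: "i \<in> I"
    and d: "\<And>x. card {j \<in> I. contains j x} \<le> d" "1 \<le> d"
  shows "forest_inv (I - {i}) D'"
    and "real c + potential (I - {i}) (paths D') \<le> potential I (paths D) + 4000 * real d * (lg I)\<^sup>2"
proof -
  let ?J = "I - {i}"
  define L where "L = lg I"
  interpret old: schedule I "search D" by (rule forest_inv_schedule[OF inv])
  have st: "search_tree (search D)" "avl_set (search D) = I" "interval_tree I (ivals D)"
    "paths_ok (edges I) I (paths D)"
    using inv by (auto simp: forest_inv_def)
  have J: "valid ?J" by (rule valid_subset[OF old.valid_I]) auto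
  have II: "insert i ?J = I" "i \<notin> ?J" using i by auto
  have L1: "1 \<le> L" "1 \<le> lg ?J" "lg ?J \<le> L"
    unfolding L_def by (rule lg_ge_1, rule lg_ge_1, rule lg_mono[OF old.finite_I]) blast
  obtain w where w: "pierced I d w" "real w \<le> 3 * L" unfolding L_def by (rule pierced_exists[OF old.valid_I d])
  interpret pierced I d w by fact
  obtain b c0 where c0: "avl_member i (search D) = (b, c0)" by fastforce
  have "b" using member_cost(1)[OF inv c0] i by simp
  define u where "u = tree_of i (paths D)"
  define G where "G = without i (paths D)"
  note sp = paths_ok_split[OF st(4) i, folded u_def G_def]
  obtain s c1 where s: "splay i u = (s, c1)" by fastforce
  have "fin_sorted (inorder u)" by (rule paths_ok_fin_sorted[OF sp(2)]) (rule edges_fin[OF old.valid_I])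
  then obtain l r where lr: "s = Node l i r" using splay_root[of u i] sp(1) s by auto
  define F where "F = add_tree l (add_tree r G)"
  obtain T c2 where T: "avl_delete i (search D) = (T, c2)" by fastforce
  note T' = search_tree_delete[OF st(1) T]
  obtain V c3 where V: "itree_delete i (ivals D) = (V, c3)" by fastforce
  note V' = itree_delete_correct[OF st(3) i V]
  obtain c4 where D': "expose_least \<lparr>paths = F, search = T, ivals = V\<rparr> = (D', c4)"
    and c: "c = c0 + c1 + c2 + c3 + c4"
    using rem \<open>b\<close> c0 T V s lr
    by (auto simp: removeCF_def u_def[symmetric] G_def[symmetric] F_def[symmetric] split: prod.splits)
  interpret new: schedule ?J T by unfold_locales (use J T' st in auto)
  have in_u: "inorder u = inorder l @ i # inorder r" using inorder_splay[of i u] s lr by simp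
  have dist: "distinct (inorder l @ i # inorder r @ elems G)" and setI: "set (inorder l @ i # inorder r @ elems G) = I"
    and sol: "pairs (inorder l @ i # inorder r) \<union> solid G \<subseteq> edges I"
    using sp(2) in_u by (auto simp: paths_ok_def)
  have solF: "solid F = pairs (inorder l) \<union> (pairs (inorder r) \<union> solid G)" by (simp add: F_def)
  have elF: "elems F = inorder l @ inorder r @ elems G" by (simp add: F_def)
  note sub = pairs_split(1,2)[of "inorder l" i "inorder r"] pairs_split(3)[of "inorder r" i]
    pairs_split(4)[of i "inorder r"]
  have sol': "solid F \<subseteq> edges I" using sol sub unfolding solF by blast
  have set_F: "set (elems F) = ?J" using dist setI unfolding elF by auto
  have "solid F \<subseteq> edges ?J"
  proof (rule subrelI)
    fix v p assume vp: "(v, p) \<in> solid F"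
    then have "v \<noteq> i" "p \<noteq> i" using solid_in[OF vp] set_F by auto
    then show "(v, p) \<in> edges ?J" using edges_remove sol' vp by blast
  qed
  then have okF: "paths_ok (edges ?J) ?J F" using dist set_F unfolding paths_ok_def elF by auto
  note ex = new.expose_least_correct[OF _ _ D', simplified, OF okF]
  show "forest_inv ?J D'"
    using J T' st V' ex by (simp add: forest_inv_def)
  define X where "X = real d * L\<^sup>2"
  define Y where "Y = real d * L"
  note XY = cost_scale[OF d(2) L1(1) w(2), folded X_def Y_def]
  have "(lg ?J)\<^sup>2 \<le> L\<^sup>2" using L1 by (intro power_mono) auto
  then have LJ: "60 * (lg ?J)\<^sup>2 \<le> 60 * X" using XY(3) by linarith
  have "real c0 \<le> 3 * L" using member_cost(2)[OF inv c0] by (simp add: L_def)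
  moreover have "real c2 \<le> 3 * L" using T'(3) old.ht_T by (simp add: L_def)
  moreover have "real c3 \<le> 3600 * X"
    using of_nat_mono[OF V'(2), where 'a = real] XY(5) by simp
  moreover have "real c1 + paths_potential F \<le> paths_potential (paths D) + 4 * L"
  proof -
    have "splay_potential l + splay_potential r \<le> splay_potential s"
      using rank_nonneg[of "Node l i r"] unfolding lr splay_potential.simps by linarith
    then show ?thesis
      using splay_amortised[OF s] rank_le_lg[OF sp(2) old.finite_I] L1(1)
      by (simp add: F_def sp(4) L_def)
  qed
  moreover have "real c4 + potential ?J (paths D') \<le> paths_potential F +
    16 * lg ?J * real (card (heavy (edges ?J) - solid F)) + 60 * X"
    using ex LJ by (simp add: potential_def[of ?J F])
  moreover have "16 * lg ?J * real (card (heavy (edges ?J) - solid F)) \<le>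
    16 * L * real (card (heavy (edges I) - solid (paths D))) + 144 * X + 32 * L"
  proof -
    define h where "h = real (card (heavy (edges I) - solid (paths D)))"
    let ?H = "heavy (edges ?J)"
    have finH: "finite ?H" using new.finite_E by (auto simp: heavy_def intro: finite_subset)
    \<comment> \<open>The solid edges into and out of \<open>i\<close> are the only ones lost. If
      \<open>i\<close> is at an end of its path, the inserted pair is arbitrary and
      harmless.\<close>
    have "solid (paths D) \<subseteq> insert (last (inorder l), i) (insert (i, hd (inorder r)) (solid F))"
      using sub(2,4) unfolding sp(3) solid_Cons in_u solF by blast
    from card_diff_insert[OF finH this] card_diff_insert[OF finH subset_refl, of "solid F" "(i, hd (inorder r))"]
    have "card (?H - solid F) \<le> card (?H - solid (paths D)) + 2" by linarith
    moreover have "real (card (?H - solid (paths D))) \<le> h + 9 * Y"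
      using dashed_heavy_change(2)[of i ?J d "solid (paths D)"] old.valid_I d
      unfolding II(1) by (simp add: h_def Y_def L_def)
    ultimately have "real (card (?H - solid F)) \<le> h + 9 * Y + 2" by linarith
    then have "lg ?J * real (card (?H - solid F)) \<le> L * (h + 9 * Y + 2)"
      using L1 by (intro mult_mono) auto
    also have "\<dots> = L * h + 9 * X + 2 * L" by (simp add: X_def Y_def power2_eq_square algebra_simps)
    finally show ?thesis unfolding h_def by linarith
  qed
  ultimately have "real c + potential ?J (paths D') \<le> potential I (paths D) + 4000 * X"
    using XY L1 unfolding c potential_def[of I] of_nat_add L_def[symmetric] by linarith
  then show "real c + potential ?J (paths D') \<le> potential I (paths D) + 4000 * real d * (lg I)\<^sup>2"
    by (simp add: X_def L_def)
qed

section \<open>Sequences of operations\<close>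

definition operation_bound :: "nat \<Rightarrow> operation \<Rightarrow> interval set \<Rightarrow> real" where
  "operation_bound d p I = (case p of Query _ \<Rightarrow> lg I | _ \<Rightarrow> real d * (lg I)\<^sup>2)"

lemma perform_correct:
  assumes inv: "forest_inv I D" and p: "perform p D = (b, D', c)"
    and J: "valid (update p I)" and d: "1 \<le> d"
      "\<And>x. card {j \<in> I. contains j x} \<le> d" "\<And>x. card {j \<in> update p I. contains j x} \<le> d"
  shows "forest_inv (update p I) D' \<and>
    real c + potential (update p I) (paths D') \<le> potential I (paths D) + 16000 * operation_bound d p (update p I) \<and>
    (p = Query i \<longrightarrow> (b \<longleftrightarrow> i \<in> greedy I))"
proof -
  have L: "1 \<le> lg I" by (rule lg_ge_1)
  have d1: "1 \<le> real d" using d(1) by simp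
  have "1 * lg I \<le> real d * (lg I)\<^sup>2" using L d1 by (intro mult_mono) (auto simp: power2_eq_square)
  then have unchanged: "real k \<le> 16000 * (real d * (lg I)\<^sup>2)" if "real k \<le> 3 * lg I" for k
    using that L by linarith
  show ?thesis
  proof (cases p)
    case (Insert j)
    then have ins: "insertCF j D = (D', c)" using p by simp
    show ?thesis
    proof (cases "j \<in> I")
      case True
      obtain b' k where m: "avl_member j (search D) = (b', k)" by fastforce
      then have "D' = D" "c = k" using ins member_cost(1)[OF inv m] True by (auto simp: insertCF_def)
      then show ?thesis
        using inv unchanged[OF member_cost(2)[OF inv m]] True Insert
        by (simp add: insert_absorb operation_bound_def)
    next
      case False
      have "3000 * real d * (lg (insert j I))\<^sup>2 \<le> 16000 * (real d * (lg (insert j I))\<^sup>2)"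
        by (simp add: mult.assoc)
      moreover have "forest_inv (insert j I) D'"
        "real c + potential (insert j I) (paths D') \<le> potential I (paths D) + 3000 * real d * (lg (insert j I))\<^sup>2"
        using insertCF_correct[OF inv ins False _ _ d(1)] J d(3) Insert by simp_all
      ultimately have "forest_inv (insert j I) D'"
        "real c + potential (insert j I) (paths D') \<le> potential I (paths D) + 16000 * (real d * (lg (insert j I))\<^sup>2)"
        by (blast, linarith)
      then show ?thesis using Insert by (simp add: operation_bound_def)
    qed
  next
    case (Remove j)
    then have rem: "removeCF j D = (D', c)" using p by simp
    show ?thesis
    proof (cases "j \<in> I")
      case False
      obtain b' k where m: "avl_member j (search D) = (b', k)" by fastforce
      then have "D' = D" "c = k" using rem member_cost(1)[OF inv m] False by (auto simp: removeCF_def)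
      then show ?thesis
        using inv unchanged[OF member_cost(2)[OF inv m]] False Remove
        by (simp add: operation_bound_def)
    next
      case True
      \<comment> \<open>The amortised bound refers to the set after the removal. The logarithm at
        most halves, so its square loses a factor of 4, and \<open>4 * 4000\<close> is the constant
        16000.\<close>
      have "lg I \<le> 2 * lg (I - {j})"
        using lg_insert(2)[of "I - {j}" j] True inv by (simp add: insert_absorb forest_inv_def valid_def)
      then have "(lg I)\<^sup>2 \<le> (2 * lg (I - {j}))\<^sup>2" using L by (intro power_mono) auto
      then have "real d * (lg I)\<^sup>2 \<le> real d * (4 * (lg (I - {j}))\<^sup>2)"
        by (intro mult_left_mono) (auto simp: power_mult_distrib)
      then show ?thesis
        using removeCF_correct[OF inv rem True d(2,1)] Remove by (simp add: operation_bound_def)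
    qed
  next
    case (Query j)
    then have "queryCF j D = (b, D', c)" using p by simp
    from queryCF_correct[OF inv this] show ?thesis using Query L by (auto simp: operation_bound_def)
  qed
qed

lemma set_after_Suc: "t < length ops \<Longrightarrow> set_after ops (Suc t) = update (ops ! t) (set_after ops t)"
  by (simp add: set_after_def take_Suc_conv_app_nth)

lemma state_after_Suc:
  "t < length ops \<Longrightarrow> state_after ops (Suc t) = fst (snd (perform (ops ! t) (state_after ops t)))"
  by (simp add: state_after_def take_Suc_conv_app_nth)

lemma set_after_0 [simp]: "set_after ops 0 = {}" and state_after_0 [simp]: "state_after ops 0 = empty_forest"
  by (simp_all add: set_after_def state_after_def)

lemma valid_set_after:
  assumes "admissible ops" "t \<le> length ops"
  shows "valid (set_after ops t)"
proof -
  have "finite (set_after ops t) \<and> (\<forall>i\<in>set_after ops t. start i < fin i)"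
    using assms(2)
  proof (induction t)
    case (Suc t)
    have "is_interval (operand (ops ! t))" using assms(1) Suc.prems by (simp add: admissible_def)
    then show ?case using Suc by (cases "ops ! t") (auto simp: set_after_Suc is_interval_def)
  qed simp
  then show ?thesis using assms by (simp add: valid_def admissible_def)
qed

text \<open>Intervals through a common point overlap pairwise. \<open>depth\<close> considers sets
  from \<open>t = 1\<close> on; at \<open>t = 0\<close> the set is empty. The maximum with 1
  provides the lower bound on \<open>d\<close> that the cost lemmas ask for.\<close>

lemma pierced_by_depth:
  assumes "admissible ops" "t \<le> length ops"
  shows "card {j \<in> set_after ops t. contains j x} \<le> max 1 (depth ops)"
proof (cases t)
  case (Suc t')
  let ?K = "{card J | J t. 1 \<le> t \<and> t \<le> length ops \<and> J \<subseteq> set_after ops t \<and>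
    (\<forall>i\<in>J. \<forall>j\<in>J. i \<noteq> j \<longrightarrow> overlap i j)}"
  have "?K \<subseteq> card ` (\<Union>t\<le>length ops. Pow (set_after ops t))" by auto
  moreover have "finite (\<Union>t\<le>length ops. Pow (set_after ops t))"
    using valid_set_after[OF assms(1)] by (auto simp: valid_def)
  ultimately have "finite ?K" by (meson finite_imageI finite_subset)
  moreover have "card {j \<in> set_after ops t. contains j x} \<in> ?K"
    using assms(2) Suc by (fastforce simp: overlap_def compatible_def contains_def)
  ultimately have "card {j \<in> set_after ops t. contains j x} \<le> Max ?K" by (rule Max_ge)
  then show ?thesis by (simp add: depth_def)
qed simp

lemma forest_inv_empty: "forest_inv {} empty_forest"
  by (simp add: forest_inv_def empty_forest_def valid_def search_tree_def interval_tree_def red_black_def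
    endpoints_def paths_ok_def elems_def solid_def exposed_def least_fin_def)

lemma potential_empty: "potential {} (paths empty_forest) = 0"
  by (simp add: potential_def empty_forest_def paths_potential_def heavy_def edges_def)

lemma forest_inv_state_after:
  assumes "admissible ops" "t \<le> length ops"
  shows "forest_inv (set_after ops t) (state_after ops t)"
  using assms(2)
proof (induction t)
  case 0
  then show ?case by (simp add: forest_inv_empty)
next
  case (Suc t)
  then have t: "t < length ops" "t \<le> length ops" by simp_all
  obtain b D' c where p: "perform (ops ! t) (state_after ops t) = (b, D', c)" by (metis prod_cases3)
  show ?case
    using perform_correct[OF Suc.IH[OF t(2)] p, of "max 1 (depth ops)"]
      valid_set_after[OF assms(1) Suc.prems] pierced_by_depth[OF assms(1) t(2)] pierced_by_depth[OF assms(1) Suc.prems]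
    by (simp add: state_after_Suc[OF t(1)] set_after_Suc[OF t(1)] p)
qed

lemma operation_correct:
  assumes "admissible ops" "t < length ops"
  shows "(ops ! t = Query i \<longrightarrow> (answer ops t \<longleftrightarrow> i \<in> greedy (set_after ops t))) \<and>
    real (time ops t) + potential (set_after ops (Suc t)) (paths (state_after ops (Suc t))) \<le>
      potential (set_after ops t) (paths (state_after ops t)) + 16000 * amortised_bound ops t"
proof -
  have t: "t \<le> length ops" "Suc t \<le> length ops" using assms by simp_all
  obtain b D' c where p: "perform (ops ! t) (state_after ops t) = (b, D', c)" by (metis prod_cases3)
  have bound: "amortised_bound ops t = operation_bound (max 1 (depth ops)) (ops ! t) (set_after ops (Suc t))"
    by (cases "ops ! t") (simp_all add: amortised_bound_def operation_bound_def lg_def Let_def)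
  note P = perform_correct[OF forest_inv_state_after[OF assms(1) t(1)] p, of "max 1 (depth ops)",
      folded set_after_Suc[OF assms(2)], OF valid_set_after[OF assms(1) t(2)] max.cobounded1
      pierced_by_depth[OF assms(1) t(1)] pierced_by_depth[OF assms(1) t(2)], of i]
  show ?thesis
    unfolding answer_def time_def p state_after_Suc[OF assms(2)] bound using P by simp
qed

text \<open>The potentials telescope, starting from 0. The final one is kept on the left for the
  sake of the induction and dropped in the theorem, as it is nonnegative.\<close>

lemma total_time:
  assumes "admissible ops" "n \<le> length ops"
  shows "(\<Sum>t<n. real (time ops t)) + potential (set_after ops n) (paths (state_after ops n)) \<le>
    16000 * (\<Sum>t<n. amortised_bound ops t)"
  using assms(2)
proof (induction n)
  case 0
  then show ?case by (simp add: potential_empty)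
next
  case (Suc n)
  then show ?case using conjunct2[OF operation_correct[OF assms(1), of n]] by (simp add: distrib_left)
qed

theorem theorem2:
  shows "(\<forall>ops. admissible ops \<longrightarrow>
            (\<forall>t<length ops. \<forall>i. ops ! t = Query i \<longrightarrow>
               (answer ops t \<longleftrightarrow> i \<in> greedy (set_after ops t)))) \<and>
         (\<exists>C::real. \<forall>ops. admissible ops \<longrightarrow>
            (\<Sum>t<length ops. real (time ops t)) \<le> C * (\<Sum>t<length ops. amortised_bound ops t))"
proof (intro conjI exI allI impI)
  fix ops assume "admissible ops"
  from total_time[OF this order_refl]
  show "(\<Sum>t<length ops. real (time ops t)) \<le> 16000 * (\<Sum>t<length ops. amortised_bound ops t)"
    using potential_ge_0[of "set_after ops (length ops)" "paths (state_after ops (length ops))"] by linarith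
qed (use operation_correct in blast)

end
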